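(* Let $a_1,\dots,a_5>0$ be such that the function $t\mapsto \frac{e^{a_4 t}-1}{a_4 t}+\left(\frac{a_4}{2}-\frac16\right)\frac{e^{-a_5t^2}-1}{a_5 t}$ (extended by continuity at $t=0$) is positive on $\mathbb{R}$. Let $g:\mathbb{R}\to\mathbb{R}$ satisfy: (1) $g\in C^{10}(\mathbb{R})$ and $g''$ is bounded on $\mathbb{R}$; (2) there exist constants $C,\kappa$ such that $|g^{(i)}(t)|\le C(1+|t|^\kappa)$ for all $t\in\mathbb{R}$ and $i=1,\dots,10$; (3) $\int_{\mathbb{R}} t^k e^{g(t)}\,dt<+\infty$ for all $k\in\mathbb{N}$. Let $\ell>0$, $h_d=\ell^2 d^{-1/5}$, and let $a_d^{\mathrm{gbO}}(\ell)$ be the mean acceptance rate at stationarity of the gbOMA algorithm with step $h_d$ and parameters $a_1,\dots,a_5$ for the product target $\pi_d(x)=Z_d\prod_{i=1}^d e^{g(x_i)}$ on $\mathbb{R}^d$. Then $$\lim_{d\to+\infty}a_d^{\mathrm{gbO}}(\ell)=a^{\mathrm{gbO}}(\ell),\qquad a^{\mathrm{gbO}}(\ell)=2\,\Phi\!\left(-K^{\mathrm{gbO}}\ell^5/2\right),$$ where $\Phi(t)=\frac{1}{\sqrt{2\pi}}\int_{-\infty}^te^{-s^2/2}\,ds$ and $K^{\mathrm{gbO}}$ is the constant depending only on $g,a_1,a_3,a_4$ defined in the context.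
   Context: Target: $\pi_d(x)=Z_d\prod_{i=1}^d e^{g(x_i)}$, $x\in\mathbb{R}^d$, with $Z_d$ the normalising constant; $\pi_1$ is the one-dimensional density proportional to $e^{g}$. For $m\in\mathbb{R}$, $h>0$, $a>0$ set (extended by continuity at $m=0$) $$T_1(m,h,a)=\frac{e^{ahm/2}-1}{am},\quad T_2(m,h,a)=\frac{e^{-ah^2m^2/4}-1}{am},\quad T_3(m,h,a)=\frac{e^{ahm/2}-1-ahm/2}{a^2m^2}.$$ gbOMA proposal (with $\Sigma=\mathrm{I}_d$; for the product target it acts coordinatewise): from $x\in\mathbb{R}^d$ the proposal $y$ has independent coordinates $y_i=\mu(x_i)+s(x_i)\xi_i$, with $\xi_i$ i.i.d. standard Gaussian and $$\mu(u)=u+T_1(g''(u),h_d,a_1)g'(u)-\tfrac13T_3(g''(u),h_d,a_3)g^{(3)}(u)+\left(\tfrac{a_1}{2}+\tfrac16\right)T_2(g''(u),h_d,a_2)g'(u),$$ $$s(u)=\left(T_1(g''(u),2h_d,a_4)+\left(\tfrac{a_4}{2}-\tfrac16\right)T_2(g''(u),2h_d,a_5)\right)^{1/2}.$$ Let $q_d^{\mathrm{gbO}}(x,y)$ be its transition density and $$\alpha_d^{\mathrm{gbO}}(x,y)=\min\left(1,\frac{\pi_d(y)q_d^{\mathrm{gbO}}(y,x)}{\pi_d(x)q_d^{\mathrm{gbO}}(x,y)}\right),\qquad a_d^{\mathrm{gbO}}(\ell)=\int_{\mathbb{R}^d}\int_{\mathbb{R}^d}\pi_d(x)q_d^{\mathrm{gbO}}(x,y)\alpha_d^{\mathrm{gbO}}(x,y)\,dx\,dy.$$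 Constant: let $X\sim\pi_1$, $\xi$ an independent standard Gaussian, and (all derivatives of $g$ evaluated at $x$) $$c^{\mathrm{gbO}}(x,\xi)=\tfrac{1}{720}\xi^5g^{(5)}+\tfrac1{144}\xi^3g^{(5)}+\tfrac1{48}\xi^3g^{(4)}g'+\tfrac1{48}\xi g^{(4)}g'+\tfrac{1}{72}a_3\xi g^{(3)}g''+\tfrac16a_4^2\xi^3g^{(3)}g''-\tfrac16a_4^2\xi g^{(3)}g''+\tfrac5{144}\xi^3g^{(3)}g''+\tfrac1{48}\xi g^{(3)}g''+\tfrac1{24}\xi g^{(3)}(g')^2-\tfrac1{24}a_1^2\xi g'(g'')^2+\tfrac16a_4^2\xi g'(g'')^2+\tfrac1{24}\xi g'(g'')^2 .$$ Then $K^{\mathrm{gbO}}=\left(\mathbb{E}[c^{\mathrm{gbO}}(X,\xi)^2]\right)^{1/2}\ge0$. *)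

theory Defs
  imports "HOL-Probability.Probability"
begin

text \<open>
  Throughout, \<open>(deriv ^^ i) g\<close> is the \<open>i\<close>-th derivative of \<open>g\<close>. Points of \<open>d\<close>-dimensional space are
  (extensional) functions on the index set \<open>{..<d}\<close>, because the dimension tends to infinity.
\<close>

definition Rd :: "nat \<Rightarrow> (nat \<Rightarrow> real) measure" where
  "Rd d = Pi\<^sub>M {..<d} (\<lambda>_. lborel)"

definition C_k :: "nat \<Rightarrow> (real \<Rightarrow> real) \<Rightarrow> bool" where
  "C_k k f \<longleftrightarrow> (\<forall>i<k. \<forall>t. (deriv ^^ i) f differentiable (at t)) \<and> continuous_on UNIV ((deriv ^^ k) f)"


text \<open>The values at \<open>m = 0\<close> (and at \<open>t = 0\<close> further below) are the continuous extensions.\<close>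

definition T1 :: "real \<Rightarrow> real \<Rightarrow> real \<Rightarrow> real" where
  "T1 m h a = (if m = 0 then h / 2 else (exp (a * h * m / 2) - 1) / (a * m))"

definition T2 :: "real \<Rightarrow> real \<Rightarrow> real \<Rightarrow> real" where
  "T2 m h a = (if m = 0 then 0 else (exp (- (a * h\<^sup>2 * m\<^sup>2 / 4)) - 1) / (a * m))"

definition T3 :: "real \<Rightarrow> real \<Rightarrow> real \<Rightarrow> real" where
  "T3 m h a = (if m = 0 then h\<^sup>2 / 8
               else (exp (a * h * m / 2) - 1 - a * h * m / 2) / (a\<^sup>2 * m\<^sup>2))"

definition gbO_positivity_fun :: "real \<Rightarrow> real \<Rightarrow> real \<Rightarrow> real" where
  "gbO_positivity_fun a4 a5 t =
     (if t = 0 then 1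
      else (exp (a4 * t) - 1) / (a4 * t)
           + (a4 / 2 - 1 / 6) * ((exp (- (a5 * t\<^sup>2)) - 1) / (a5 * t)))"


definition norm_const :: "(real \<Rightarrow> real) \<Rightarrow> nat \<Rightarrow> real" where
  "norm_const g d = 1 / (LINT x|Rd d. (\<Prod>i<d. exp (g (x i))))"

definition target :: "(real \<Rightarrow> real) \<Rightarrow> nat \<Rightarrow> (nat \<Rightarrow> real) \<Rightarrow> real" where
  "target g d x = norm_const g d * (\<Prod>i<d. exp (g (x i)))"

definition target1 :: "(real \<Rightarrow> real) \<Rightarrow> real \<Rightarrow> real" where
  "target1 g t = exp (g t) / (LINT u|lborel. exp (g u))"


definition gbO_mean :: "(real \<Rightarrow> real) \<Rightarrow> real \<Rightarrow> real \<Rightarrow> real \<Rightarrow> real \<Rightarrow> real \<Rightarrow> real" where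
  "gbO_mean g a1 a2 a3 h u =
     u + T1 ((deriv ^^ 2) g u) h a1 * deriv g u
       - 1 / 3 * T3 ((deriv ^^ 2) g u) h a3 * (deriv ^^ 3) g u
       + (a1 / 2 + 1 / 6) * T2 ((deriv ^^ 2) g u) h a2 * deriv g u"

definition gbO_sd :: "(real \<Rightarrow> real) \<Rightarrow> real \<Rightarrow> real \<Rightarrow> real \<Rightarrow> real \<Rightarrow> real" where
  "gbO_sd g a4 a5 h u =
     sqrt (T1 ((deriv ^^ 2) g u) (2 * h) a4
           + (a4 / 2 - 1 / 6) * T2 ((deriv ^^ 2) g u) (2 * h) a5)"

text \<open>
  The proposal from \<open>x\<close> has independent coordinates \<open>y i = gbO_mean (x i) + gbO_sd (x i) * \<xi> i\<close> with
  standard Gaussian \<open>\<xi> i\<close>; its density at \<open>y\<close> is therefore the following product. (The second argument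
  of \<open>normal_density\<close> is the standard deviation, not the variance.)
\<close>

definition gbO_density ::
  "(real \<Rightarrow> real) \<Rightarrow> real \<Rightarrow> real \<Rightarrow> real \<Rightarrow> real \<Rightarrow> real \<Rightarrow> real \<Rightarrow> nat
    \<Rightarrow> (nat \<Rightarrow> real) \<Rightarrow> (nat \<Rightarrow> real) \<Rightarrow> real" where
  "gbO_density g a1 a2 a3 a4 a5 h d x y =
     (\<Prod>i<d. normal_density (gbO_mean g a1 a2 a3 h (x i)) (gbO_sd g a4 a5 h (x i)) (y i))"


definition MH_acceptance ::
  "('a \<Rightarrow> real) \<Rightarrow> ('a \<Rightarrow> 'a \<Rightarrow> real) \<Rightarrow> 'a \<Rightarrow> 'a \<Rightarrow> real" where
  "MH_acceptance p q x y = min 1 ((p y * q y x) / (p x * q x y))"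

definition mean_acceptance_rate ::
  "'a measure \<Rightarrow> ('a \<Rightarrow> real) \<Rightarrow> ('a \<Rightarrow> 'a \<Rightarrow> real) \<Rightarrow> real" where
  "mean_acceptance_rate M p q = (LINT y|M. LINT x|M. p x * q x y * MH_acceptance p q x y)"

definition gbO_acceptance ::
  "(real \<Rightarrow> real) \<Rightarrow> real \<Rightarrow> real \<Rightarrow> real \<Rightarrow> real \<Rightarrow> real \<Rightarrow> real \<Rightarrow> nat \<Rightarrow> real" where
  "gbO_acceptance g a1 a2 a3 a4 a5 l d =
     (let h = l\<^sup>2 * real d powr (- 1 / 5)
      in mean_acceptance_rate (Rd d) (target g d) (gbO_density g a1 a2 a3 a4 a5 h d))"


definition gbO_c ::
  "(real \<Rightarrow> real) \<Rightarrow> real \<Rightarrow> real \<Rightarrow> real \<Rightarrow> real \<Rightarrow> real \<Rightarrow> real" where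
  "gbO_c g a1 a3 a4 x \<xi> =
     (let g1 = deriv g x; g2 = (deriv ^^ 2) g x; g3 = (deriv ^^ 3) g x;
          g4 = (deriv ^^ 4) g x; g5 = (deriv ^^ 5) g x
      in 1 / 720 * \<xi> ^ 5 * g5
       + 1 / 144 * \<xi> ^ 3 * g5
       + 1 / 48 * \<xi> ^ 3 * g4 * g1
       + 1 / 48 * \<xi> * g4 * g1
       + 1 / 72 * a3 * \<xi> * g3 * g2
       + 1 / 6 * a4\<^sup>2 * \<xi> ^ 3 * g3 * g2
       - 1 / 6 * a4\<^sup>2 * \<xi> * g3 * g2
       + 5 / 144 * \<xi> ^ 3 * g3 * g2
       + 1 / 48 * \<xi> * g3 * g2
       + 1 / 24 * \<xi> * g3 * g1\<^sup>2
       - 1 / 24 * a1\<^sup>2 * \<xi> * g1 * g2\<^sup>2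
       + 1 / 6 * a4\<^sup>2 * \<xi> * g1 * g2\<^sup>2
       + 1 / 24 * \<xi> * g1 * g2\<^sup>2)"

text \<open>Independence of \<open>X\<close> and \<open>\<xi>\<close>: their joint law is the product of the two marginal laws.\<close>

definition gbO_K :: "(real \<Rightarrow> real) \<Rightarrow> real \<Rightarrow> real \<Rightarrow> real \<Rightarrow> real" where
  "gbO_K g a1 a3 a4 =
     sqrt (LINT z|(density lborel (\<lambda>x. ennreal (target1 g x))
                   \<Otimes>\<^sub>M density lborel (\<lambda>\<xi>. ennreal (std_normal_density \<xi>))).
             (gbO_c g a1 a3 a4 (fst z) (snd z))\<^sup>2)"

definition Phi :: "real \<Rightarrow> real" where
  "Phi t = 1 / sqrt (2 * pi) * (LINT s:{..t}|lborel. exp (- s\<^sup>2 / 2))"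

end

theory Submission
  imports Defs "HOL-Real_Asymp.Real_Asymp"
begin

text \<open>
  Write \<open>\<rho> x y\<close> for the joint density of the current and the proposed position of one coordinate at
  stationarity, and \<open>R = ln (\<rho> y x / \<rho> x y)\<close> for its log-ratio. Target and proposal are products,
  so the acceptance probability is \<open>min 1 (exp S)\<close>, where \<open>S\<close> is a sum of \<open>d\<close> independent copies of
  \<open>R\<close>, and the theorem is a central limit theorem for the triangular array of these copies. Three
  observations carry it.

  Reversal. Swapping \<open>x\<close> and \<open>y\<close> turns \<open>R\<close> into \<open>- R\<close> and multiplies the law by \<open>exp R\<close>, so
  \<open>E[exp R * f (- R)] = E[f R]\<close> for every \<open>f\<close>. With \<open>f\<close> the identity and the expansion
  \<open>R * exp R = R + R\<^sup>2 + O(\<bar>R\<bar>\<^sup>3 (1 + exp R))\<close> this gives \<open>2 E[R] = - E[R\<^sup>2] + O(E[\<bar>R\<bar>\<^sup>3])\<close>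
  (\<open>mean_logratio\<close>). The mean of \<open>S\<close> is therefore asymptotically minus half of its variance, and
  \<open>R\<close> has to be expanded to its leading order only, not to the order of its mean. Two limits suffice,
  \<open>d E[R\<^sup>2] \<longlonglongrightarrow> \<sigma>\<^sup>2\<close> and \<open>d E[\<bar>R\<bar>\<^sup>3] \<longlonglongrightarrow> 0\<close>: characteristic functions and Levy's theorem
  show that \<open>S\<close> converges in law to a normal variable of mean \<open>- \<sigma>\<^sup>2 / 2\<close> and variance \<open>\<sigma>\<^sup>2\<close>, for
  which the expectation of \<open>min 1 (exp s)\<close> is \<open>2 \<Phi>(- \<sigma> / 2)\<close> (\<open>product_acceptance_limit\<close>).

  Midpoint expansion. Put \<open>h = \<epsilon>\<^sup>2\<close> and \<open>\<delta> = y - x\<close>, which is of order \<open>\<epsilon>\<close>. The log-ratio is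
  antisymmetric in \<open>(x, y)\<close> and depends on \<open>\<epsilon>\<close> through \<open>h\<close> only, so its expansion around the midpoint
  \<open>(x + y) / 2\<close> contains odd powers of \<open>\<delta>\<close> and hence only terms of odd total order in \<open>\<epsilon>\<close>.
  The algorithm is designed to make orders 1 and 3 vanish; order 5 is the polynomial \<open>c\<close> of the
  statement (\<open>order5_identity\<close>). Replacing the midpoint by \<open>x\<close> and \<open>\<delta> / \<epsilon>\<close> by the Gaussian
  \<open>\<xi>\<close> costs one more order, so \<open>R = \<epsilon>\<^sup>5 c(x, \<xi>) + O(\<epsilon>\<^sup>6)\<close>, where the error has polynomial growth
  in \<open>(x, \<xi>)\<close> uniformly in \<open>\<epsilon>\<close> (\<open>log_ratio_expansion\<close>).

  Moments. Polynomials are integrable under \<open>\<pi>\<^sub>1\<close> and under the Gaussian law, so dominated convergence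
  gives \<open>\<epsilon>\<^sup>-\<^sup>1\<^sup>0 E[R\<^sup>2] \<longlonglongrightarrow> K\<^sup>2\<close> and \<open>E[\<bar>R\<bar>\<^sup>3] = O(\<epsilon>\<^sup>1\<^sup>5)\<close>. The scaling \<open>h = l\<^sup>2 d\<^sup>-\<^sup>1\<^sup>/\<^sup>5\<close> means
  \<open>d \<epsilon>\<^sup>1\<^sup>0 = l\<^sup>1\<^sup>0\<close>, which turns these into the two limits above with \<open>\<sigma> = K l\<^sup>5\<close>.
\<close>

section \<open>Triangular arrays of reversible pairs\<close>

text \<open>
  Both \<open>z n\<close> and \<open>exp (w / n)\<close> lie in the closed unit disc, on which the \<open>n\<close>-th power is Lipschitz
  with constant \<open>n\<close>; this is where \<open>Re w \<le> 0\<close> enters. No logarithm of \<open>z n\<close> has to be chosen.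
\<close>
lemma tendsto_power_exp:
  fixes z :: "nat \<Rightarrow> complex"
  assumes lim: "(\<lambda>n. of_nat n * (z n - 1)) \<longlonglongrightarrow> w"
    and le1: "\<And>n. norm (z n) \<le> 1" and w: "Re w \<le> 0"
  shows "(\<lambda>n. z n ^ n) \<longlonglongrightarrow> exp w"
proof -
  have d: "((\<lambda>h. exp (h * w)) has_field_derivative w) (at 0)"
    by (auto intro!: derivative_eq_intros)
  have "(\<lambda>h. (exp ((0 + h) * w) - exp (0 * w)) / h) \<midarrow>0\<rightarrow> w"
    using DERIV_D[OF d] by simp
  then have "((\<lambda>h. (exp (h * w) - 1) / h) \<longlongrightarrow> w) (at 0)" by simp
  moreover have "filterlim (\<lambda>n. inverse (of_nat n) :: complex) (at 0) sequentially"
    unfolding filterlim_at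
    by (auto intro: tendsto_inverse_0_at_top[OF filterlim_real_sequentially] lim_inverse_n
          eventually_sequentiallyI[of 1])
  ultimately have e: "(\<lambda>n. (exp (inverse (of_nat n) * w) - 1) / inverse (of_nat n)) \<longlonglongrightarrow> w"
    by (rule filterlim_compose)
  have "(\<lambda>n. of_nat n * (z n - 1) - (exp (inverse (of_nat n) * w) - 1) / inverse (of_nat n)) \<longlonglongrightarrow> w - w"
    by (intro tendsto_diff lim e)
  then have e2: "(\<lambda>n. norm (of_nat n * (z n - 1) - (exp (inverse (of_nat n) * w) - 1) / inverse (of_nat n))) \<longlonglongrightarrow> 0"
    by (intro tendsto_norm_zero) simp
  have "\<forall>\<^sub>F n in sequentially. norm (z n ^ n - exp w) \<le>
     norm (of_nat n * (z n - 1) - (exp (inverse (of_nat n) * w) - 1) / inverse (of_nat n))"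
  proof (rule eventually_sequentiallyI[of 1])
    fix n :: nat assume n: "n \<ge> 1"
    have "norm (z n ^ n - exp (inverse (of_nat n) * w) ^ n)
        \<le> of_nat n * norm (z n - exp (inverse (of_nat n) * w))"
      using w n by (intro norm_power_diff le1) (auto simp: mult_nonneg_nonpos divide_nonpos_nonneg)
    also have "exp (inverse (of_nat n) * w) ^ n = exp w"
      using n by (simp flip: exp_of_nat_mult mult.assoc)
    also have "of_nat n * norm (z n - exp (inverse (of_nat n) * w))
       = norm (of_nat n * (z n - exp (inverse (of_nat n) * w)))"
      by (simp add: norm_mult)
    also have "of_nat n * (z n - exp (inverse (of_nat n) * w)) =
       of_nat n * (z n - 1) - (exp (inverse (of_nat n) * w) - 1) / inverse (of_nat n)"
      using n by (simp add: field_simps)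
    finally show "norm (z n ^ n - exp w) \<le> norm (of_nat n * (z n - 1) - (exp (inverse (of_nat n) * w) - 1) / inverse (of_nat n))" .
  qed
  then have "(\<lambda>n. norm (z n ^ n - exp w)) \<longlonglongrightarrow> 0"
    by (rule tendsto_sandwich[OF _ _ tendsto_const e2, rotated]) auto
  then show ?thesis
    by (simp add: tendsto_norm_zero_iff LIM_zero_iff)
qed

text \<open>
  The chain lives on pairs of points, while independence of the coordinates is a statement about
  points whose coordinates are pairs. This regrouping passes from one to the other; boxes suffice to
  identify the measures, and on a box both sides factorise by Fubini.
\<close>
lemma PiM_pair_eq_distr:
  assumes N: "sigma_finite_measure N" and I: "finite I"
  shows "Pi\<^sub>M I (\<lambda>_. N \<Otimes>\<^sub>M N) =
    distr (Pi\<^sub>M I (\<lambda>_. N) \<Otimes>\<^sub>M Pi\<^sub>M I (\<lambda>_. N)) (Pi\<^sub>M I (\<lambda>_. N \<Otimes>\<^sub>M N))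
      (\<lambda>(x, y). \<lambda>i\<in>I. (x i, y i))" (is "_ = ?D")
proof -
  interpret N: sigma_finite_measure N by fact
  interpret NN: pair_sigma_finite N N ..
  interpret P: product_sigma_finite "\<lambda>_. N" by standard
  interpret P2: product_sigma_finite "\<lambda>_. N \<Otimes>\<^sub>M N"
    by (simp add: product_sigma_finite_def NN.sigma_finite_measure_axioms)
  interpret F: finite_product_sigma_finite "\<lambda>_. N" I by standard fact
  interpret FF: pair_sigma_finite "Pi\<^sub>M I (\<lambda>_. N)" "Pi\<^sub>M I (\<lambda>_. N)" ..
  have m[measurable]: "(\<lambda>(x, y). \<lambda>i\<in>I. (x i, y i)) \<in>
     measurable (Pi\<^sub>M I (\<lambda>_. N) \<Otimes>\<^sub>M Pi\<^sub>M I (\<lambda>_. N)) (Pi\<^sub>M I (\<lambda>_. N \<Otimes>\<^sub>M N))"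
    by measurable
  show ?thesis
  proof (rule P2.PiM_eqI[symmetric, OF I])
    fix A assume A: "\<And>i. i \<in> I \<Longrightarrow> A i \<in> sets (N \<Otimes>\<^sub>M N)"
    then have PA[measurable]: "Pi\<^sub>E I A \<in> sets (Pi\<^sub>M I (\<lambda>_. N \<Otimes>\<^sub>M N))"
      using I by (intro sets_PiM_I_finite) auto
    have "emeasure ?D (Pi\<^sub>E I A) =
       (\<integral>\<^sup>+z. indicator (Pi\<^sub>E I A) ((\<lambda>(x, y). \<lambda>i\<in>I. (x i, y i)) z) \<partial>(Pi\<^sub>M I (\<lambda>_. N) \<Otimes>\<^sub>M Pi\<^sub>M I (\<lambda>_. N)))"
      by (simp add: nn_integral_indicator[symmetric] nn_integral_distr del: nn_integral_indicator)
    also have "\<dots> = (\<integral>\<^sup>+x. \<integral>\<^sup>+y. indicator (Pi\<^sub>E I A) (\<lambda>i\<in>I. (x i, y i)) \<partial>Pi\<^sub>M I (\<lambda>_. N) \<partial>Pi\<^sub>M I (\<lambda>_. N))"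
      by (subst F.nn_integral_fst[symmetric]) (auto simp: split_beta')
    also have "\<dots> = (\<integral>\<^sup>+x. \<integral>\<^sup>+y. (\<Prod>i\<in>I. indicator (A i) (x i, y i)) \<partial>Pi\<^sub>M I (\<lambda>_. N) \<partial>Pi\<^sub>M I (\<lambda>_. N))"
    proof (intro nn_integral_cong)
      fix x y
      show "(indicator (Pi\<^sub>E I A) (\<lambda>i\<in>I. (x i, y i)) :: ennreal) = (\<Prod>i\<in>I. indicator (A i) (x i, y i))"
      proof (cases "\<forall>i\<in>I. (x i, y i) \<in> A i")
        case True
        then show ?thesis by (auto intro!: prod.neutral[symmetric])
      next
        case False
        then obtain i where "i \<in> I" "(x i, y i) \<notin> A i" by auto
        then show ?thesis using I
          by (subst prod_zero) (auto simp: indicator_def PiE_iff)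
      qed
    qed
    also have "\<dots> = (\<integral>\<^sup>+x. (\<Prod>i\<in>I. \<integral>\<^sup>+v. indicator (A i) (x i, v) \<partial>N) \<partial>Pi\<^sub>M I (\<lambda>_. N))"
    proof (intro nn_integral_cong)
      fix x assume "x \<in> space (Pi\<^sub>M I (\<lambda>_. N))"
      then have xs: "x i \<in> space N" if "i \<in> I" for i using that by (auto simp: space_PiM)
      show "(\<integral>\<^sup>+y. (\<Prod>i\<in>I. indicator (A i) (x i, y i)) \<partial>Pi\<^sub>M I (\<lambda>_. N)) = (\<Prod>i\<in>I. \<integral>\<^sup>+v. indicator (A i) (x i, v) \<partial>N)"
      proof (rule P.product_nn_integral_prod[OF I])
        fix i assume i: "i \<in> I"
        note A[OF i, measurable] note xs[OF i, measurable]
        show "(\<lambda>v. indicator (A i) (x i, v) :: ennreal) \<in> borel_measurable N" by measurable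
      qed
    qed
    also have "\<dots> = (\<Prod>i\<in>I. \<integral>\<^sup>+u. \<integral>\<^sup>+v. indicator (A i) (u, v) \<partial>N \<partial>N)"
    proof (rule P.product_nn_integral_prod[OF I])
      fix i assume i: "i \<in> I"
      note A[OF i, measurable]
      show "(\<lambda>u. \<integral>\<^sup>+v. indicator (A i) (u, v) \<partial>N) \<in> borel_measurable N" by measurable
    qed
    also have "\<dots> = (\<Prod>i\<in>I. emeasure (N \<Otimes>\<^sub>M N) (A i))"
      using A by (intro prod.cong) (auto simp: N.emeasure_pair_measure)
    finally show "emeasure ?D (Pi\<^sub>E I A) = (\<Prod>i\<in>I. emeasure (N \<Otimes>\<^sub>M N) (A i))" .
  qed simp
qed

text \<open>
  The remainder of the second-order expansion of \<open>r * exp r\<close>. The factor \<open>1 + exp r\<close>, rather than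
  \<open>exp \<bar>r\<bar>\<close>, matters: by reversal \<open>E[\<bar>R\<bar>\<^sup>3 exp R] = E[\<bar>R\<bar>\<^sup>3]\<close>, whereas an exponential moment of
  \<open>\<bar>R\<bar>\<close> need not exist.
\<close>
lemma abs_exp_remainder:
  "\<bar>r * exp r - r - r\<^sup>2\<bar> \<le> \<bar>r\<bar> ^ 3 * (1 + exp r) / 2" for r :: real
proof -
  obtain t where t: "exp r - 1 - r = exp t * r\<^sup>2 / 2" and le: "exp t \<le> 1 + exp r"
  proof (cases "r \<ge> 0")
    case True
    obtain t where t: "\<bar>t\<bar> \<le> \<bar>r\<bar>" "exp r = (\<Sum>m<2. (r ^ m) / fact m) + (exp t / fact 2) * r ^ 2"
      using Maclaurin_exp_le[of r 2] by blast
    have "exp t \<le> exp r" using t(1) True by (simp only: exp_le_cancel_iff)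
    then have "exp t \<le> 1 + exp r" by linarith
    then show ?thesis using t(2) by (intro that[of t]) (simp_all add: eval_nat_numeral)
  next
    case False
    obtain s where s: "r < s" "s < 0" "exp r = (\<Sum>m<2. (exp 0 / fact m) * r ^ m) + (exp s / fact 2) * r ^ 2"
      using Maclaurin_minus[of r 2 "\<lambda>_. exp" exp] False by (auto intro: DERIV_exp)
    have "exp s \<le> 1" using s by simp
    then have "exp s \<le> 1 + exp r" using exp_gt_zero[of r] by linarith
    then show ?thesis using s(3) by (intro that[of s]) (simp_all add: eval_nat_numeral)
  qed
  have "\<bar>exp r - 1 - r\<bar> = exp t * r\<^sup>2 / 2" unfolding t by simp
  also have "\<dots> \<le> r\<^sup>2 * (1 + exp r) / 2" using mult_right_mono[OF le, of "r\<^sup>2"] by (simp add: mult.commute)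
  finally have "\<bar>exp r - 1 - r\<bar> \<le> r\<^sup>2 * (1 + exp r) / 2" .
  then have "\<bar>r\<bar> * \<bar>exp r - 1 - r\<bar> \<le> \<bar>r\<bar> * (r\<^sup>2 * (1 + exp r) / 2)"
    by (intro mult_left_mono) auto
  also have "\<bar>r\<bar> * \<bar>exp r - 1 - r\<bar> = \<bar>r * exp r - r - r\<^sup>2\<bar>"
    by (subst abs_mult[symmetric]) (simp add: algebra_simps power2_eq_square)
  also have "\<bar>r\<bar> * (r\<^sup>2 * (1 + exp r) / 2) = \<bar>r\<bar> ^ 3 * (1 + exp r) / 2"
    by (simp add: eval_nat_numeral)
  finally show ?thesis .
qed

text \<open>
  One coordinate of a stationary Metropolis--Hastings chain: \<open>\<rho> x y\<close> is the target density at \<open>x\<close>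
  times the proposal density from \<open>x\<close> to \<open>y\<close>.
\<close>
locale mh_pair = sigma_finite_measure N for N :: "'a measure" +
  fixes \<rho> :: "'a \<Rightarrow> 'a \<Rightarrow> real"
  assumes meas[measurable]: "case_prod \<rho> \<in> borel_measurable (N \<Otimes>\<^sub>M N)"
    and pos: "\<And>x y. \<rho> x y > 0"
    and total: "has_bochner_integral (N \<Otimes>\<^sub>M N) (case_prod \<rho>) 1"
begin

definition logratio :: "'a \<times> 'a \<Rightarrow> real" where
  "logratio z = ln (\<rho> (snd z) (fst z) / \<rho> (fst z) (snd z))"

definition law :: "('a \<times> 'a) measure" where
  "law = density (N \<Otimes>\<^sub>M N) (\<lambda>z. ennreal (case_prod \<rho> z))"

sublocale NN: pair_sigma_finite N N ..

lemma meas_swap[measurable]: "(\<lambda>z. \<rho> (snd z) (fst z)) \<in> borel_measurable (N \<Otimes>\<^sub>M N)"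
  using measurable_compose[OF measurable_pair_swap' meas] by (simp add: split_beta')

lemma meas_fst_snd[measurable]: "(\<lambda>z. \<rho> (fst z) (snd z)) \<in> borel_measurable (N \<Otimes>\<^sub>M N)"
  using meas by (simp add: split_beta')

lemma meas_logratio[measurable]: "logratio \<in> borel_measurable (N \<Otimes>\<^sub>M N)"
  unfolding logratio_def[abs_def] by measurable

lemma sets_law[measurable_cong]: "sets law = sets (N \<Otimes>\<^sub>M N)"
  by (simp add: law_def)

lemma prob_law: "prob_space law"
proof
  have "emeasure law (space law) = (\<integral>\<^sup>+z. ennreal (case_prod \<rho> z) \<partial>(N \<Otimes>\<^sub>M N))"
    by (simp add: law_def emeasure_density cong: nn_integral_cong)
  also have "\<dots> = ennreal 1"
    using total pos by (intro nn_integral_eq_integral[of _ "case_prod \<rho>", THEN trans])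
      (auto simp: has_bochner_integral_iff less_imp_le)
  finally show "emeasure law (space law) = 1" by simp
qed

sublocale law: prob_space law by (rule prob_law)

lemma logratio_swap: "logratio (y, x) = - logratio (x, y)"
  using pos[of x y] pos[of y x] by (simp add: logratio_def ln_div)

lemma exp_logratio: "\<rho> x y * exp (logratio (x, y)) = \<rho> y x"
  using pos[of x y] pos[of y x] by (simp add: logratio_def)

lemma integrable_law_iff:
  fixes f :: "'a \<times> 'a \<Rightarrow> 'b :: {banach, second_countable_topology}"
  assumes "f \<in> borel_measurable (N \<Otimes>\<^sub>M N)"
  shows "integrable law f \<longleftrightarrow> integrable (N \<Otimes>\<^sub>M N) (\<lambda>z. case_prod \<rho> z *\<^sub>R f z)"
  unfolding law_def using assms pos by (subst integrable_density) (auto simp: less_imp_le)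

lemma integral_law:
  fixes f :: "'a \<times> 'a \<Rightarrow> 'b :: {banach, second_countable_topology}"
  assumes "f \<in> borel_measurable (N \<Otimes>\<^sub>M N)"
  shows "integral\<^sup>L law f = (\<integral>z. case_prod \<rho> z *\<^sub>R f z \<partial>(N \<Otimes>\<^sub>M N))"
  unfolding law_def using assms pos by (subst integral_density) (auto simp: less_imp_le)

text \<open>
  The change of variables that swaps the two points: it turns \<open>R\<close> into \<open>- R\<close> and \<open>\<rho>\<close> into \<open>\<rho> * exp R\<close>.
\<close>
lemma
  fixes f :: "real \<Rightarrow> real"
  assumes [measurable]: "f \<in> borel_measurable borel"
    and int: "integrable law (\<lambda>z. f (logratio z))"
  shows integrable_reversal: "integrable law (\<lambda>z. exp (logratio z) * f (- logratio z))"
    and expectation_reversal: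
      "law.expectation (\<lambda>z. exp (logratio z) * f (- logratio z)) = law.expectation (\<lambda>z. f (logratio z))"
proof -
  let ?h = "\<lambda>z. case_prod \<rho> z *\<^sub>R f (logratio z)"
  have eq: "(\<lambda>z. case_prod \<rho> z *\<^sub>R (exp (logratio z) * f (- logratio z))) = (\<lambda>(x, y). ?h (y, x))"
  proof (rule ext)
    fix z :: "'a \<times> 'a"
    obtain x y where z: "z = (x, y)" by fastforce
    have "case_prod \<rho> (x, y) *\<^sub>R (exp (logratio (x, y)) * f (- logratio (x, y))) = case_prod \<rho> (y, x) *\<^sub>R f (logratio (y, x))"
      using exp_logratio[of x y] by (simp add: logratio_swap[of y x] mult.assoc[symmetric])
    then show "case_prod \<rho> z *\<^sub>R (exp (logratio z) * f (- logratio z)) = (\<lambda>(x, y). ?h (y, x)) z"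
      by (simp add: z)
  qed
  have m[measurable]: "?h \<in> borel_measurable (N \<Otimes>\<^sub>M N)" by measurable
  have m2: "(\<lambda>z. exp (logratio z) * f (- logratio z)) \<in> borel_measurable (N \<Otimes>\<^sub>M N)"
    and m3: "(\<lambda>z. f (logratio z)) \<in> borel_measurable (N \<Otimes>\<^sub>M N)" by measurable
  have i: "integrable (N \<Otimes>\<^sub>M N) ?h"
    using int by (subst (asm) integrable_law_iff) auto
  show "integrable law (\<lambda>z. exp (logratio z) * f (- logratio z))"
    using NN.integrable_product_swap[OF i] by (simp only: integrable_law_iff[OF m2] eq)
  show "law.expectation (\<lambda>z. exp (logratio z) * f (- logratio z)) = law.expectation (\<lambda>z. f (logratio z))"
    using NN.integral_product_swap[OF m] by (simp only: integral_law[OF m2] integral_law[OF m3] eq)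
qed


lemma integrable_logratio_powers:
  assumes i3: "integrable law (\<lambda>z. \<bar>logratio z\<bar> ^ 3)" and k: "k \<le> 3"
  shows "integrable law (\<lambda>z. logratio z ^ k)"
proof (rule Bochner_Integration.integrable_bound[of law "\<lambda>z. 1 + \<bar>logratio z\<bar> ^ 3"])
  show "integrable law (\<lambda>z. 1 + \<bar>logratio z\<bar> ^ 3)" using i3 by simp
  show "AE z in law. norm (logratio z ^ k) \<le> norm (1 + \<bar>logratio z\<bar> ^ 3)"
  proof (intro AE_I2)
    fix z
    have "\<bar>logratio z\<bar> ^ k \<le> 1 + \<bar>logratio z\<bar> ^ 3"
    proof (cases "\<bar>logratio z\<bar> \<le> 1")
      case True then show ?thesis by (simp add: add_increasing2 power_le_one)
    next
      case False then have "\<bar>logratio z\<bar> ^ k \<le> \<bar>logratio z\<bar> ^ 3" using k by (intro power_increasing) auto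
      then show ?thesis by simp
    qed
    then show "norm (logratio z ^ k) \<le> norm (1 + \<bar>logratio z\<bar> ^ 3)" by (simp add: power_abs)
  qed
qed measurable

text \<open>
  Reversal with \<open>f r = - r\<close> says \<open>E[R exp R] = - E[R]\<close>, so the left-hand side is, up to sign,
  \<open>E[R exp R - R - R\<^sup>2]\<close>; reversal with \<open>f r = \<bar>r\<bar>\<^sup>3\<close> removes the factor \<open>exp R\<close> from the remainder.
\<close>
lemma mean_logratio:
  assumes i3: "integrable law (\<lambda>z. \<bar>logratio z\<bar> ^ 3)"
  shows "\<bar>2 * law.expectation logratio + law.expectation (\<lambda>z. logratio z ^ 2)\<bar>
    \<le> law.expectation (\<lambda>z. \<bar>logratio z\<bar> ^ 3)"
proof -
  have i1: "integrable law logratio" and i2: "integrable law (\<lambda>z. logratio z ^ 2)"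
    using integrable_logratio_powers[OF i3, of 1] integrable_logratio_powers[OF i3, of 2] by auto
  have j1: "integrable law (\<lambda>z. exp (logratio z) * logratio z)"
    and e1: "law.expectation (\<lambda>z. exp (logratio z) * logratio z) = - law.expectation logratio"
    using integrable_reversal[of "\<lambda>r. - r"] expectation_reversal[of "\<lambda>r. - r"] i1 by auto
  have j3: "integrable law (\<lambda>z. exp (logratio z) * \<bar>logratio z\<bar> ^ 3)"
    and e3: "law.expectation (\<lambda>z. exp (logratio z) * \<bar>logratio z\<bar> ^ 3) = law.expectation (\<lambda>z. \<bar>logratio z\<bar> ^ 3)"
    using integrable_reversal[of "\<lambda>r. \<bar>r\<bar> ^ 3"] expectation_reversal[of "\<lambda>r. \<bar>r\<bar> ^ 3"] i3 by auto
  have "2 * law.expectation logratio + law.expectation (\<lambda>z. logratio z ^ 2)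
     = - law.expectation (\<lambda>z. exp (logratio z) * logratio z - logratio z - logratio z ^ 2)"
    using i1 i2 j1 e1 by simp
  also have "\<bar>\<dots>\<bar> \<le> law.expectation (\<lambda>z. \<bar>exp (logratio z) * logratio z - logratio z - logratio z ^ 2\<bar>)"
    by (simp add: integral_abs_bound)
  also have "\<dots> \<le> law.expectation (\<lambda>z. (\<bar>logratio z\<bar> ^ 3 + exp (logratio z) * \<bar>logratio z\<bar> ^ 3) / 2)"
  proof (rule integral_mono)
    show "integrable law (\<lambda>z. \<bar>exp (logratio z) * logratio z - logratio z - logratio z ^ 2\<bar>)"
      using i1 i2 j1 by auto
    show "integrable law (\<lambda>z. (\<bar>logratio z\<bar> ^ 3 + exp (logratio z) * \<bar>logratio z\<bar> ^ 3) / 2)"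
      using i3 j3 by auto
    show "\<bar>exp (logratio z) * logratio z - logratio z - logratio z ^ 2\<bar>
      \<le> (\<bar>logratio z\<bar> ^ 3 + exp (logratio z) * \<bar>logratio z\<bar> ^ 3) / 2" for z
      using abs_exp_remainder[of "logratio z"] by (simp add: algebra_simps)
  qed
  also have "\<dots> = law.expectation (\<lambda>z. \<bar>logratio z\<bar> ^ 3)"
    using i3 j3 e3 by simp
  finally show ?thesis .
qed

text \<open>
  The second-order expansion of the characteristic function with \<open>E[R]\<close> replaced by \<open>- E[R\<^sup>2] / 2\<close>:
  second and third moments control it completely.
\<close>
lemma char_logratio:
  assumes i3: "integrable law (\<lambda>z. \<bar>logratio z\<bar> ^ 3)"
  shows "cmod (char (distr law borel logratio) t - 1
      + of_real (law.expectation (\<lambda>z. logratio z ^ 2)) * (of_real t ^ 2 + \<i> * of_real t) / 2)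
    \<le> (\<bar>t\<bar> ^ 3 / 6 + \<bar>t\<bar> / 2) * law.expectation (\<lambda>z. \<bar>logratio z\<bar> ^ 3)"
proof -
  let ?\<mu> = "distr law borel logratio"
  let ?E1 = "law.expectation logratio" and ?E2 = "law.expectation (\<lambda>z. logratio z ^ 2)"
    and ?E3 = "law.expectation (\<lambda>z. \<bar>logratio z\<bar> ^ 3)"
  interpret \<mu>: real_distribution ?\<mu>
    by (rule law.real_distribution_distr) measurable
  have m[measurable]: "logratio \<in> borel_measurable law" by measurable
  have int: "integrable ?\<mu> (\<lambda>x. x ^ k)" if "k \<le> 2" for k
    using integrable_logratio_powers[OF i3, of k] that by (simp add: integrable_distr_eq)
  have i3': "integrable ?\<mu> (\<lambda>x. \<bar>t\<bar> * \<bar>x\<bar> ^ Suc 2)"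
    using i3 by (simp add: integrable_distr_eq eval_nat_numeral)
  have "cmod (char ?\<mu> t - (\<Sum>k\<le>2. ((\<i> * t)^k / fact k) * \<mu>.expectation (\<lambda>x. x^k)))
     \<le> (\<bar>t\<bar>^2 / fact (Suc 2)) * \<mu>.expectation (\<lambda>x. min (2 * \<bar>x\<bar>^2 * Suc 2) (\<bar>t\<bar> * \<bar>x\<bar>^Suc 2))"
    by (rule \<mu>.char_approx2[OF int])
  also have "\<dots> \<le> (\<bar>t\<bar>^2 / fact (Suc 2)) * \<mu>.expectation (\<lambda>x. \<bar>t\<bar> * \<bar>x\<bar>^Suc 2)"
    by (intro mult_left_mono integral_mono i3' Bochner_Integration.integrable_bound[OF i3']) auto
  also have "\<dots> = \<bar>t\<bar> ^ 3 / 6 * ?E3"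
    by (simp add: integral_distr eval_nat_numeral)
  also have "(\<Sum>k\<le>2. ((\<i> * t)^k / fact k) * \<mu>.expectation (\<lambda>x. x^k)) = 1 + \<i> * t * ?E1 - t\<^sup>2 / 2 * ?E2"
  proof -
    have p: "\<mu>.prob UNIV = 1" using \<mu>.prob_space by simp
    have sum3: "(\<Sum>k\<le>2. f k) = f 0 + f 1 + f 2" for f :: "nat \<Rightarrow> complex"
      by (simp add: eval_nat_numeral)
    show ?thesis
      unfolding sum3 by (simp add: integral_distr p power_mult_distrib)
  qed
  finally have 1: "cmod (char ?\<mu> t - (1 + \<i> * t * ?E1 - t\<^sup>2 / 2 * ?E2)) \<le> \<bar>t\<bar> ^ 3 / 6 * ?E3" .
  have "\<i> * t * ?E1 + \<i> * t / 2 * ?E2 = \<i> * of_real (t / 2 * (2 * ?E1 + ?E2))"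
    by (simp add: algebra_simps)
  then have "cmod (\<i> * t * ?E1 + \<i> * t / 2 * ?E2) = \<bar>t\<bar> / 2 * \<bar>2 * ?E1 + ?E2\<bar>"
    by (simp only: norm_mult norm_of_real abs_mult) simp
  also have "\<dots> \<le> \<bar>t\<bar> / 2 * ?E3"
    by (intro mult_left_mono mean_logratio i3) auto
  finally have 2: "cmod (\<i> * t * ?E1 + \<i> * t / 2 * ?E2) \<le> \<bar>t\<bar> / 2 * ?E3" .
  have "char ?\<mu> t - 1 + of_real ?E2 * (of_real t ^ 2 + \<i> * of_real t) / 2
     = (char ?\<mu> t - (1 + \<i> * t * ?E1 - t\<^sup>2 / 2 * ?E2)) + (\<i> * t * ?E1 + \<i> * t / 2 * ?E2)"
    by (simp add: field_simps)
  then have "cmod (char ?\<mu> t - 1 + of_real ?E2 * (of_real t ^ 2 + \<i> * of_real t) / 2)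
     \<le> \<bar>t\<bar> ^ 3 / 6 * ?E3 + \<bar>t\<bar> / 2 * ?E3"
    using norm_triangle_mono[OF 1 2] by (simp only:)
  then show ?thesis by (simp only: distrib_right)
qed

text \<open>
  Boxes determine the product measure, and on a box the integral of a product density factorises.
\<close>
lemma PiM_law:
  assumes I: "finite I"
  shows "Pi\<^sub>M I (\<lambda>_. law) = density (Pi\<^sub>M I (\<lambda>_. N \<Otimes>\<^sub>M N)) (\<lambda>z. ennreal (\<Prod>i\<in>I. case_prod \<rho> (z i)))"
    (is "_ = ?D")
proof -
  interpret L: product_sigma_finite "\<lambda>_. law"
    by (simp add: product_sigma_finite_def law.sigma_finite_measure_axioms)
  interpret P2: product_sigma_finite "\<lambda>_. N \<Otimes>\<^sub>M N"
    by (simp add: product_sigma_finite_def NN.sigma_finite_measure_axioms)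
  have sets_eq: "sets (Pi\<^sub>M I (\<lambda>_. law)) = sets (Pi\<^sub>M I (\<lambda>_. N \<Otimes>\<^sub>M N))"
    by (intro sets_PiM_cong) (auto simp: sets_law)
  show ?thesis
  proof (rule L.PiM_eqI[symmetric, OF I])
    show "sets ?D = sets (Pi\<^sub>M I (\<lambda>_. law))" by (simp add: sets_eq)
    fix A assume A: "\<And>i. i \<in> I \<Longrightarrow> A i \<in> sets law"
    then have A': "A i \<in> sets (N \<Otimes>\<^sub>M N)" if "i \<in> I" for i using that by (simp add: sets_law)
    then have PA[measurable]: "Pi\<^sub>E I A \<in> sets (Pi\<^sub>M I (\<lambda>_. N \<Otimes>\<^sub>M N))"
      using I by (intro sets_PiM_I_finite) auto
    have "emeasure ?D (Pi\<^sub>E I A) =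
       (\<integral>\<^sup>+z. ennreal (\<Prod>i\<in>I. case_prod \<rho> (z i)) * indicator (Pi\<^sub>E I A) z \<partial>Pi\<^sub>M I (\<lambda>_. N \<Otimes>\<^sub>M N))"
      by (rule emeasure_density) measurable
    also have "\<dots> = (\<integral>\<^sup>+z. (\<Prod>i\<in>I. ennreal (case_prod \<rho> (z i)) * indicator (A i) (z i)) \<partial>Pi\<^sub>M I (\<lambda>_. N \<Otimes>\<^sub>M N))"
    proof (rule nn_integral_cong)
      fix z assume "z \<in> space (Pi\<^sub>M I (\<lambda>_. N \<Otimes>\<^sub>M N))"
      then have z: "z \<in> extensional I" by (auto simp: space_PiM PiE_def)
      have "(indicator (Pi\<^sub>E I A) z :: ennreal) = (\<Prod>i\<in>I. indicator (A i) (z i))"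
      proof (cases "\<forall>i\<in>I. z i \<in> A i")
        case True
        then show ?thesis using z by (auto intro!: prod.neutral[symmetric] simp: indicator_def PiE_iff)
      next
        case False
        then obtain i where "i \<in> I" "z i \<notin> A i" by auto
        then show ?thesis using I by (subst prod_zero) (auto simp: indicator_def PiE_iff)
      qed
      then show "ennreal (\<Prod>i\<in>I. case_prod \<rho> (z i)) * indicator (Pi\<^sub>E I A) z = (\<Prod>i\<in>I. ennreal (case_prod \<rho> (z i)) * indicator (A i) (z i))"
        using pos by (simp add: prod.distrib prod_ennreal less_imp_le split: prod.splits) 
    qed
    also have "\<dots> = (\<Prod>i\<in>I. \<integral>\<^sup>+z. ennreal (case_prod \<rho> z) * indicator (A i) z \<partial>(N \<Otimes>\<^sub>M N))"
    proof (rule P2.product_nn_integral_prod[OF I])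
      fix i assume i: "i \<in> I"
      note A'[OF i, measurable]
      show "(\<lambda>z. ennreal (case_prod \<rho> z) * indicator (A i) z) \<in> borel_measurable (N \<Otimes>\<^sub>M N)" by measurable
    qed
    also have "\<dots> = (\<Prod>i\<in>I. emeasure law (A i))"
      using A' by (intro prod.cong) (auto simp: law_def emeasure_density)
    finally show "emeasure ?D (Pi\<^sub>E I A) = (\<Prod>i\<in>I. emeasure law (A i))" .
  qed
qed

lemma char_sum_logratio:
  "char (distr (Pi\<^sub>M {..<n} (\<lambda>_. law)) borel (\<lambda>z. \<Sum>i<n. logratio (z i))) t
     = char (distr law borel logratio) t ^ n"
proof -
  interpret L: product_sigma_finite "\<lambda>_. law"
    by (simp add: product_sigma_finite_def law.sigma_finite_measure_axioms)
  have m[measurable]: "logratio \<in> borel_measurable law" by measurable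
  have int: "integrable law (\<lambda>z. iexp (t * logratio z))"
    by (intro law.integrable_const_bound[of _ 1]) auto
  have "char (distr (Pi\<^sub>M {..<n} (\<lambda>_. law)) borel (\<lambda>z. \<Sum>i<n. logratio (z i))) t
     = (\<integral>z. (\<Prod>i<n. iexp (t * logratio (z i))) \<partial>Pi\<^sub>M {..<n} (\<lambda>_. law))"
    unfolding char_def
    by (subst integral_distr) (auto simp: sum_distrib_left sum_distrib_right exp_sum)
  also have "\<dots> = (\<Prod>i<n. \<integral>z. iexp (t * logratio z) \<partial>law)"
    using int by (intro L.product_integral_prod) auto
  also have "\<dots> = char (distr law borel logratio) t ^ n"
    unfolding char_def by (subst integral_distr) auto
  finally show ?thesis .
qed


lemma real_distribution_sum_logratio:
  fixes n :: nat
  shows "real_distribution (distr (Pi\<^sub>M {..<n} (\<lambda>_. law)) borel (\<lambda>z. \<Sum>i<n. logratio (z i)))"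
proof -
  have "prob_space (Pi\<^sub>M {..<n} (\<lambda>_. law))"
    by (intro prob_space_PiM prob_law)
  moreover have [measurable]: "logratio \<in> borel_measurable law" by measurable
  ultimately show ?thesis
    by (intro prob_space.real_distribution_distr) auto
qed

text \<open>
  Since \<open>\<rho> y x = \<rho> x y * exp R\<close> in each coordinate, the minimum of the two products is the joint
  density of the chain times \<open>min 1 (exp S)\<close>.
\<close>
lemma acceptance_eq_expectation:
  fixes n :: nat
  shows "(LINT y|Pi\<^sub>M {..<n} (\<lambda>_. N). LINT x|Pi\<^sub>M {..<n} (\<lambda>_. N).
       min (\<Prod>i<n. \<rho> (x i) (y i)) (\<Prod>i<n. \<rho> (y i) (x i)))
   = (LINT s|distr (Pi\<^sub>M {..<n} (\<lambda>_. law)) borel (\<lambda>z. \<Sum>i<n. logratio (z i)). min 1 (exp s))"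
proof -
  let ?Q = "Pi\<^sub>M {..<n} (\<lambda>_. N)" and ?Q2 = "Pi\<^sub>M {..<n} (\<lambda>_. N \<Otimes>\<^sub>M N)"
  let ?\<tau> = "\<lambda>(x, y). \<lambda>i\<in>{..<n}. (x i, y i)"
  interpret P2: product_sigma_finite "\<lambda>_. N \<Otimes>\<^sub>M N"
    by (simp add: product_sigma_finite_def NN.sigma_finite_measure_axioms)
  interpret P: product_sigma_finite "\<lambda>_. N" by standard
  interpret F: finite_product_sigma_finite "\<lambda>_. N" "{..<n}" by standard (rule finite_lessThan)
  interpret FF: pair_sigma_finite ?Q ?Q ..
  define H where "H z = (\<Prod>i<n. case_prod \<rho> (z i)) * min 1 (exp (\<Sum>i<n. logratio (z i)))" for z
  have [measurable]: "logratio \<in> borel_measurable law" by measurable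
  have mH[measurable]: "H \<in> borel_measurable ?Q2" unfolding H_def[abs_def] by measurable
  have m\<tau>[measurable]: "?\<tau> \<in> measurable (?Q \<Otimes>\<^sub>M ?Q) ?Q2" by measurable
  have p: "(\<Prod>i<n. case_prod \<rho> (z i)) > 0" for z :: "nat \<Rightarrow> 'a \<times> 'a"
    using pos by (intro prod_pos) (auto split: prod.splits)
  have H: "H (?\<tau> (x, y)) = min (\<Prod>i<n. \<rho> (x i) (y i)) (\<Prod>i<n. \<rho> (y i) (x i))" for x y
  proof -
    have "(\<Prod>i<n. \<rho> (y i) (x i)) = (\<Prod>i<n. \<rho> (x i) (y i)) * exp (\<Sum>i<n. logratio (x i, y i))"
      by (simp add: exp_sum prod.distrib[symmetric] exp_logratio)
    then show ?thesis
      using p[of "\<lambda>i. (x i, y i)"] by (simp add: H_def min_mult_distrib_left)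
  qed
  have "integrable ?Q2 (\<lambda>z. \<Prod>i<n. case_prod \<rho> (z i))"
    using total by (intro P2.product_integrable_prod) (auto simp: has_bochner_integral_iff)
  then have iH: "integrable ?Q2 H"
  proof (rule Bochner_Integration.integrable_bound)
    show "AE z in ?Q2. norm (H z) \<le> norm (\<Prod>i<n. case_prod \<rho> (z i))"
    proof (intro AE_I2)
      fix z
      have "(\<Prod>i<n. case_prod \<rho> (z i)) * min 1 (exp (\<Sum>i<n. logratio (z i))) \<le> (\<Prod>i<n. case_prod \<rho> (z i)) * 1"
        using p[of z] by (intro mult_left_mono) auto
      moreover have "H z \<ge> 0" using p[of z] by (simp add: H_def)
      ultimately show "norm (H z) \<le> norm (\<Prod>i<n. case_prod \<rho> (z i))"
        using p[of z] by (simp add: H_def[symmetric])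
    qed
  qed measurable
  have eqD: "?Q2 = distr (?Q \<Otimes>\<^sub>M ?Q) ?Q2 ?\<tau>"
    by (rule PiM_pair_eq_distr[OF sigma_finite_measure_axioms]) simp
  have iH': "integrable (?Q \<Otimes>\<^sub>M ?Q) (\<lambda>z. H (?\<tau> z))"
    using iH by (subst (asm) eqD, subst (asm) integrable_distr_eq) auto
  have "(LINT y|?Q. LINT x|?Q. min (\<Prod>i<n. \<rho> (x i) (y i)) (\<Prod>i<n. \<rho> (y i) (x i)))
    = (LINT y|?Q. LINT x|?Q. H (?\<tau> (x, y)))"
    by (simp only: H)
  also have "\<dots> = (LINT z|(?Q \<Otimes>\<^sub>M ?Q). H (?\<tau> z))"
    using FF.integral_snd[of "\<lambda>x y. H (?\<tau> (x, y))"] iH' by (simp add: split_beta')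
  also have "\<dots> = (LINT z|?Q2. H z)"
    by (subst integral_distr[OF m\<tau> mH, symmetric]) (simp only: eqD[symmetric])
  also have "\<dots> = (LINT z|Pi\<^sub>M {..<n} (\<lambda>_. law). min 1 (exp (\<Sum>i<n. logratio (z i))))"
    using p by (subst PiM_law, simp, subst integral_density) (auto simp: H_def[abs_def] less_imp_le)
  also have "\<dots> = (LINT s|distr (Pi\<^sub>M {..<n} (\<lambda>_. law)) borel (\<lambda>z. \<Sum>i<n. logratio (z i)). min 1 (exp s))"
    by (subst integral_distr) auto
  finally show ?thesis .
qed

end

text \<open>
  The exponent changes sign at \<open>z = \<sigma> / 2\<close>. Above that point the minimum is 1; below it,
  multiplication by \<open>exp (\<sigma> z - \<sigma>\<^sup>2 / 2)\<close> translates the Gaussian density by \<open>\<sigma>\<close>. Both parts have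
  mass \<open>\<Phi>(- \<sigma> / 2)\<close>. For \<open>\<sigma> = 0\<close> the exponent vanishes identically and the same splitting works,
  so degenerate limits need no separate treatment.
\<close>
lemma expectation_min_1_exp_normal:
  fixes \<sigma> :: real
  assumes "\<sigma> \<ge> 0"
  shows "(LINT z|std_normal_distribution. min 1 (exp (\<sigma> * z - \<sigma>\<^sup>2 / 2))) = 2 * Phi (- \<sigma> / 2)"
proof -
  have Phi: "Phi a = (LINT z|lborel. indicator {..a} z * std_normal_density z)" for a
    by (simp add: Phi_def set_lebesgue_integral_def std_normal_density_def mult_ac flip: integral_mult_right_zero)
  have int: "integrable lborel (\<lambda>z. indicator A z * std_normal_density (z - c))" if [measurable]: "A \<in> sets borel" for A c
  proof (rule Bochner_Integration.integrable_bound)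
    show "integrable lborel (\<lambda>z. std_normal_density (z - c))"
      using lborel_integrable_real_affine[of std_normal_density 1 "-c"] by simp
  qed (auto simp: indicator_def)
  have "(LINT z|std_normal_distribution. min 1 (exp (\<sigma> * z - \<sigma>\<^sup>2 / 2)))
    = (LINT z|lborel. std_normal_density z * min 1 (exp (\<sigma> * z - \<sigma>\<^sup>2 / 2)))"
    by (subst integral_density) auto
  also have "\<dots> = (LINT z|lborel. indicator {\<sigma>/2<..} z * std_normal_density (z - 0)
      + indicator {..\<sigma>/2} z * std_normal_density (z - \<sigma>))"
  proof (intro Bochner_Integration.integral_cong refl)
    fix z
    have e: "std_normal_density z * exp (\<sigma> * z - \<sigma>\<^sup>2 / 2) = std_normal_density (z - \<sigma>)"
      by (simp add: std_normal_density_def exp_add[symmetric] power2_eq_square field_simps)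
    have "min 1 (exp (\<sigma> * z - \<sigma>\<^sup>2 / 2)) = (if z > \<sigma> / 2 then 1 else exp (\<sigma> * z - \<sigma>\<^sup>2 / 2))"
    proof (cases "z > \<sigma> / 2")
      case True
      then have "\<sigma> * (z - \<sigma> / 2) \<ge> 0" using assms by (intro mult_nonneg_nonneg) auto
      then show ?thesis using True by (simp add: power2_eq_square algebra_simps)
    next
      case False
      then have "\<sigma> * (z - \<sigma> / 2) \<le> 0" using assms by (intro mult_nonneg_nonpos) auto
      then show ?thesis using False by (simp add: power2_eq_square algebra_simps min_def)
    qed
    then show "std_normal_density z * min 1 (exp (\<sigma> * z - \<sigma>\<^sup>2 / 2)) = indicator {\<sigma>/2<..} z * std_normal_density (z - 0)
      + indicator {..\<sigma>/2} z * std_normal_density (z - \<sigma>)"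
      using e by (auto simp: indicator_def)
  qed
  also have "\<dots> = (LINT z|lborel. indicator {\<sigma>/2<..} z * std_normal_density (z - 0))
      + (LINT z|lborel. indicator {..\<sigma>/2} z * std_normal_density (z - \<sigma>))"
    by (intro Bochner_Integration.integral_add int) auto
  also have "(LINT z|lborel. indicator {\<sigma>/2<..} z * std_normal_density (z - 0)) = Phi (- \<sigma> / 2)"
  proof -
    have "(LINT z|lborel. indicator {\<sigma>/2<..} z * std_normal_density (z - 0))
      = (LINT z|lborel. indicator {\<sigma>/2<..} (- z) * std_normal_density z)"
      by (subst lborel_integral_real_affine[of "-1" _ 0]) (auto simp: std_normal_density_def)
    also have "\<dots> = (LINT z|lborel. indicator {..-\<sigma>/2} z * std_normal_density z)"
      using AE_lborel_singleton[of "- \<sigma> / 2"]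
      by (intro integral_cong_AE) (auto simp: indicator_def)
    finally show ?thesis by (simp add: Phi)
  qed
  also have "(LINT z|lborel. indicator {..\<sigma>/2} z * std_normal_density (z - \<sigma>)) = Phi (- \<sigma> / 2)"
    unfolding Phi
    by (subst lborel_integral_real_affine[of "1" _ \<sigma>]) (auto simp: indicator_def intro!: Bochner_Integration.integral_cong)
  finally show ?thesis by simp
qed

text \<open>
  By \<open>char_logratio\<close>, \<open>n (\<phi> - 1)\<close> converges to the exponent of the characteristic function of the
  normal law with mean \<open>- \<sigma>\<^sup>2 / 2\<close> and variance \<open>\<sigma>\<^sup>2\<close>. That law is written as the image of the
  standard normal law under an affine map, so that \<open>\<sigma> = 0\<close> is included.
\<close>
theorem product_acceptance_limit:
  fixes \<rho> :: "nat \<Rightarrow> 'a \<Rightarrow> 'a \<Rightarrow> real" and \<sigma> :: real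
  assumes mh: "\<And>n. mh_pair N (\<rho> n)" and \<sigma>: "\<sigma> \<ge> 0"
    and i3: "\<forall>\<^sub>F n in sequentially. integrable (mh_pair.law N (\<rho> n)) (\<lambda>z. \<bar>mh_pair.logratio (\<rho> n) z\<bar> ^ 3)"
    and m2: "(\<lambda>n. n * (LINT z|mh_pair.law N (\<rho> n). mh_pair.logratio (\<rho> n) z ^ 2)) \<longlonglongrightarrow> \<sigma>\<^sup>2"
    and m3: "(\<lambda>n. n * (LINT z|mh_pair.law N (\<rho> n). \<bar>mh_pair.logratio (\<rho> n) z\<bar> ^ 3)) \<longlonglongrightarrow> 0"
  shows "(\<lambda>n. LINT y|Pi\<^sub>M {..<n} (\<lambda>_. N). LINT x|Pi\<^sub>M {..<n} (\<lambda>_. N).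
       min (\<Prod>i<n. \<rho> n (x i) (y i)) (\<Prod>i<n. \<rho> n (y i) (x i))) \<longlonglongrightarrow> 2 * Phi (- \<sigma> / 2)"
proof -
  interpret mh_pair N "\<rho> n" for n by (rule mh)
  define \<mu> where "\<mu> n = distr (Pi\<^sub>M {..<n} (\<lambda>_. law n)) borel (\<lambda>z. \<Sum>i<n. logratio n (z i))" for n
  define \<phi> where "\<phi> n t = char (distr (law n) borel (logratio n)) t" for n t
  define \<nu> where "\<nu> = distr std_normal_distribution borel (\<lambda>z. \<sigma> * z - \<sigma>\<^sup>2 / 2)"
  interpret snd: real_distribution std_normal_distribution by (rule real_dist_normal_dist)
  have \<mu>: "real_distribution (\<mu> n)" for n
    unfolding \<mu>_def by (rule real_distribution_sum_logratio)
  have \<nu>: "real_distribution \<nu>" unfolding \<nu>_def by (rule snd.real_distribution_distr) simp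
  have char_\<nu>: "char \<nu> t = exp (- of_real (\<sigma>\<^sup>2) * (of_real t ^ 2 + \<i> * of_real t) / 2)" for t
  proof -
    have "char \<nu> t = (CLINT z|std_normal_distribution. iexp (t * (\<sigma> * z - \<sigma>\<^sup>2 / 2)))"
      unfolding char_def \<nu>_def by (subst integral_distr) auto
    also have "\<dots> = (CLINT z|std_normal_distribution. iexp (- t * \<sigma>\<^sup>2 / 2) * iexp ((t * \<sigma>) * z))"
      by (simp add: exp_add[symmetric] algebra_simps)
    also have "\<dots> = iexp (- t * \<sigma>\<^sup>2 / 2) * char std_normal_distribution (t * \<sigma>)"
      unfolding char_def by (rule integral_mult_right_zero)
    also have "\<dots> = exp (- of_real (\<sigma>\<^sup>2) * (of_real t ^ 2 + \<i> * of_real t) / 2)"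
      unfolding char_std_normal_distribution
      by (simp add: exp_of_real[symmetric] exp_add[symmetric] algebra_simps power_mult_distrib add_divide_distrib diff_divide_distrib)
    finally show ?thesis .
  qed
  have "(\<lambda>n. char (\<mu> n) t) \<longlonglongrightarrow> char \<nu> t" for t
  proof -
    let ?c = "(of_real t ^ 2 + \<i> * of_real t) / 2 :: complex"
    let ?E2 = "\<lambda>n. LINT z|law n. logratio n z ^ 2" and ?E3 = "\<lambda>n. LINT z|law n. \<bar>logratio n z\<bar> ^ 3"
    have "(\<lambda>n. of_nat n * (\<phi> n t - 1) + of_real (n * ?E2 n) * ?c) \<longlonglongrightarrow> 0"
    proof (rule Lim_null_comparison)
      show "\<forall>\<^sub>F n in sequentially. norm (of_nat n * (\<phi> n t - 1) + of_real (n * ?E2 n) * ?c)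
         \<le> (\<bar>t\<bar> ^ 3 / 6 + \<bar>t\<bar> / 2) * (n * ?E3 n)"
        using i3
      proof eventually_elim
        case (elim n)
        have "of_nat n * (\<phi> n t - 1) + of_real (n * ?E2 n) * ?c
          = of_nat n * (\<phi> n t - 1 + of_real (?E2 n) * (of_real t ^ 2 + \<i> * of_real t) / 2)"
          by (simp add: algebra_simps)
        then have "norm (of_nat n * (\<phi> n t - 1) + of_real (n * ?E2 n) * ?c)
          = n * norm (\<phi> n t - 1 + of_real (?E2 n) * (of_real t ^ 2 + \<i> * of_real t) / 2)"
          by (simp only: norm_mult norm_of_nat)
        also have "\<dots> \<le> n * ((\<bar>t\<bar> ^ 3 / 6 + \<bar>t\<bar> / 2) * ?E3 n)"
          unfolding \<phi>_def by (intro mult_left_mono char_logratio elim) auto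
        finally show ?case by (simp add: mult_ac)
      qed
      show "(\<lambda>n. (\<bar>t\<bar> ^ 3 / 6 + \<bar>t\<bar> / 2) * (n * ?E3 n)) \<longlonglongrightarrow> 0"
        using tendsto_mult[OF tendsto_const m3, of "\<bar>t\<bar> ^ 3 / 6 + \<bar>t\<bar> / 2"] by simp
    qed
    moreover have "(\<lambda>n. of_real (n * ?E2 n) * ?c) \<longlonglongrightarrow> of_real (\<sigma>\<^sup>2) * ?c"
      by (intro tendsto_mult tendsto_const tendsto_of_real m2)
    ultimately have "(\<lambda>n. (of_nat n * (\<phi> n t - 1) + of_real (n * ?E2 n) * ?c) - of_real (n * ?E2 n) * ?c)
        \<longlonglongrightarrow> 0 - of_real (\<sigma>\<^sup>2) * ?c"
      by (rule tendsto_diff)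
    then have lim: "(\<lambda>n. of_nat n * (\<phi> n t - 1)) \<longlonglongrightarrow> - of_real (\<sigma>\<^sup>2) * ?c" by simp
    have "(\<lambda>n. \<phi> n t ^ n) \<longlonglongrightarrow> exp (- of_real (\<sigma>\<^sup>2) * ?c)"
    proof (rule tendsto_power_exp[OF lim])
      show "cmod (\<phi> n t) \<le> 1" for n
        unfolding \<phi>_def by (intro real_distribution.cmod_char_le_1 law.real_distribution_distr) measurable
      have "Re (- of_real (\<sigma>\<^sup>2) * ?c) = - (\<sigma>\<^sup>2 * t\<^sup>2 / 2)"
        by (simp flip: of_real_power)
      then show "Re (- of_real (\<sigma>\<^sup>2) * ?c) \<le> 0" by simp
    qed
    moreover have "char (\<mu> n) t = \<phi> n t ^ n" for n
      unfolding \<mu>_def \<phi>_def by (rule char_sum_logratio)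
    ultimately show ?thesis by (simp add: char_\<nu>)
  qed
  then have wc: "weak_conv_m \<mu> \<nu>"
    by (intro levy_continuity \<mu> \<nu>)
  have "(\<lambda>n. LINT s|\<mu> n. min 1 (exp s)) \<longlonglongrightarrow> (LINT s|\<nu>. min 1 (exp s))"
  proof (rule weak_conv_imp_integral_bdd_continuous_conv[OF \<mu> \<nu> wc, of _ 1])
    show "isCont (\<lambda>s::real. min 1 (exp s)) x" for x by (intro continuous_intros)
  qed auto
  also have "(LINT s|\<nu>. min 1 (exp s)) = 2 * Phi (- \<sigma> / 2)"
    unfolding \<nu>_def by (subst integral_distr) (auto simp: expectation_min_1_exp_normal[OF \<sigma>])
  finally show ?thesis
    unfolding \<mu>_def acceptance_eq_expectation .
qed

section \<open>Error terms with polynomial growth in space\<close>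

text \<open>
  \<open>f = O(\<epsilon>\<^sup>k)\<close> as \<open>\<epsilon>\<close> tends to 0 from the right, uniformly in \<open>z\<close> up to a polynomial weight. Such
  bounds survive composition with maps of polynomial growth and integration against laws that have
  all moments, which is all that is done with error terms below.
\<close>
definition unif_O :: "nat \<Rightarrow> (real \<Rightarrow> 's::real_normed_vector \<Rightarrow> real) \<Rightarrow> bool" where
  "unif_O k f \<longleftrightarrow> (\<exists>C N \<epsilon>0. \<epsilon>0 > 0 \<and>
     (\<forall>\<epsilon> z. 0 < \<epsilon> \<and> \<epsilon> \<le> \<epsilon>0 \<longrightarrow> \<bar>f \<epsilon> z\<bar> \<le> C * \<epsilon> ^ k * (1 + norm z) ^ N))"

lemma unif_OI:
  assumes "\<epsilon>0 > 0" "\<And>\<epsilon> z. 0 < \<epsilon> \<Longrightarrow> \<epsilon> \<le> \<epsilon>0 \<Longrightarrow> \<bar>f \<epsilon> z\<bar> \<le> C * \<epsilon> ^ k * (1 + norm z) ^ N"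
  shows "unif_O k f"
  using assms unfolding unif_O_def by blast

lemma unif_OE:
  assumes "unif_O k f"
  obtains C N \<epsilon>0 where "C \<ge> 0" "\<epsilon>0 > 0" "\<epsilon>0 \<le> 1"
    "\<And>\<epsilon> z. 0 < \<epsilon> \<Longrightarrow> \<epsilon> \<le> \<epsilon>0 \<Longrightarrow> \<bar>f \<epsilon> z\<bar> \<le> C * \<epsilon> ^ k * (1 + norm z) ^ N"
proof -
  obtain C N \<epsilon>0 where *: "\<epsilon>0 > 0"
    "\<And>\<epsilon> z. 0 < \<epsilon> \<Longrightarrow> \<epsilon> \<le> \<epsilon>0 \<Longrightarrow> \<bar>f \<epsilon> z\<bar> \<le> C * \<epsilon> ^ k * (1 + norm z) ^ N"
    using assms unfolding unif_O_def by blast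
  have "\<bar>f \<epsilon> z\<bar> \<le> \<bar>C\<bar> * \<epsilon> ^ k * (1 + norm z) ^ N" if "0 < \<epsilon>" "\<epsilon> \<le> min \<epsilon>0 1" for \<epsilon> z
  proof -
    have "\<bar>f \<epsilon> z\<bar> \<le> C * \<epsilon> ^ k * (1 + norm z) ^ N" using that * by auto
    also have "\<dots> \<le> \<bar>C\<bar> * \<epsilon> ^ k * (1 + norm z) ^ N"
      using that by (intro mult_right_mono) auto
    finally show ?thesis .
  qed
  then show ?thesis using * by (intro that[of "\<bar>C\<bar>" "min \<epsilon>0 1" N]) auto
qed

lemma unif_O_mono:
  assumes "unif_O k g" "\<epsilon>1 > 0" "\<And>\<epsilon> z. 0 < \<epsilon> \<Longrightarrow> \<epsilon> \<le> \<epsilon>1 \<Longrightarrow> \<bar>f \<epsilon> z\<bar> \<le> \<bar>g \<epsilon> z\<bar>"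
  shows "unif_O k f"
proof -
  obtain C N \<epsilon>0 where g: "C \<ge> 0" "\<epsilon>0 > 0"
    "\<And>\<epsilon> z. 0 < \<epsilon> \<Longrightarrow> \<epsilon> \<le> \<epsilon>0 \<Longrightarrow> \<bar>g \<epsilon> z\<bar> \<le> C * \<epsilon> ^ k * (1 + norm z) ^ N"
    using assms(1) by (rule unif_OE) blast
  show ?thesis
    using g assms(2)
    by (intro unif_OI[of "min \<epsilon>0 \<epsilon>1" f C k N]) (auto intro: order_trans[OF assms(3) g(3)])
qed

lemma unif_O_cong:
  assumes "unif_O k g" "\<epsilon>1 > 0" "\<And>\<epsilon> z. 0 < \<epsilon> \<Longrightarrow> \<epsilon> \<le> \<epsilon>1 \<Longrightarrow> f \<epsilon> z = g \<epsilon> z"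
  shows "unif_O k f"
  using assms(1,2) by (rule unif_O_mono) (simp add: assms(3))

lemma unif_O_add:
  assumes "unif_O k f" "unif_O k g"
  shows "unif_O k (\<lambda>\<epsilon> z. f \<epsilon> z + g \<epsilon> z)"
proof -
  obtain C N \<epsilon>0 where f: "C \<ge> 0" "\<epsilon>0 > 0"
    "\<And>\<epsilon> z. 0 < \<epsilon> \<Longrightarrow> \<epsilon> \<le> \<epsilon>0 \<Longrightarrow> \<bar>f \<epsilon> z\<bar> \<le> C * \<epsilon> ^ k * (1 + norm z) ^ N"
    using assms(1) by (rule unif_OE) blast
  obtain C' N' \<epsilon>0' where g: "C' \<ge> 0" "\<epsilon>0' > 0"
    "\<And>\<epsilon> z. 0 < \<epsilon> \<Longrightarrow> \<epsilon> \<le> \<epsilon>0' \<Longrightarrow> \<bar>g \<epsilon> z\<bar> \<le> C' * \<epsilon> ^ k * (1 + norm z) ^ N'"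
    using assms(2) by (rule unif_OE) blast
  show ?thesis
  proof (rule unif_OI[of "min \<epsilon>0 \<epsilon>0'" _ "C + C'" _ "max N N'"])
    fix \<epsilon> z assume \<epsilon>: "0 < \<epsilon>" "\<epsilon> \<le> min \<epsilon>0 \<epsilon>0'"
    have "\<bar>f \<epsilon> z + g \<epsilon> z\<bar> \<le> C * \<epsilon> ^ k * (1 + norm z) ^ N + C' * \<epsilon> ^ k * (1 + norm z) ^ N'"
      using f(3)[of \<epsilon> z] g(3)[of \<epsilon> z] \<epsilon> by (intro order_trans[OF abs_triangle_ineq]) auto
    also have "\<dots> \<le> C * \<epsilon> ^ k * (1 + norm z) ^ (max N N') + C' * \<epsilon> ^ k * (1 + norm z) ^ (max N N')"
      using f(1) g(1) \<epsilon> by (intro add_mono mult_left_mono power_increasing) auto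
    finally show "\<bar>f \<epsilon> z + g \<epsilon> z\<bar> \<le> (C + C') * \<epsilon> ^ k * (1 + norm z) ^ (max N N')"
      by (simp add: algebra_simps)
  qed (use f g in auto)
qed

lemma unif_O_minus: "unif_O k f \<Longrightarrow> unif_O k (\<lambda>\<epsilon> z. - f \<epsilon> z)"
  by (rule unif_O_mono[of k f 1]) auto

lemma unif_O_diff: "unif_O k f \<Longrightarrow> unif_O k g \<Longrightarrow> unif_O k (\<lambda>\<epsilon> z. f \<epsilon> z - g \<epsilon> z)"
  using unif_O_add[of k f "\<lambda>\<epsilon> z. - g \<epsilon> z"] unif_O_minus[of k g] by simp

lemma unif_O_mult:
  assumes "unif_O j f" "unif_O k g"
  shows "unif_O (j + k) (\<lambda>\<epsilon> z. f \<epsilon> z * g \<epsilon> z)"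
proof -
  obtain C N \<epsilon>0 where f: "C \<ge> 0" "\<epsilon>0 > 0"
    "\<And>\<epsilon> z. 0 < \<epsilon> \<Longrightarrow> \<epsilon> \<le> \<epsilon>0 \<Longrightarrow> \<bar>f \<epsilon> z\<bar> \<le> C * \<epsilon> ^ j * (1 + norm z) ^ N"
    using assms(1) by (rule unif_OE) blast
  obtain C' N' \<epsilon>0' where g: "C' \<ge> 0" "\<epsilon>0' > 0"
    "\<And>\<epsilon> z. 0 < \<epsilon> \<Longrightarrow> \<epsilon> \<le> \<epsilon>0' \<Longrightarrow> \<bar>g \<epsilon> z\<bar> \<le> C' * \<epsilon> ^ k * (1 + norm z) ^ N'"
    using assms(2) by (rule unif_OE) blast
  show ?thesis
  proof (rule unif_OI[of "min \<epsilon>0 \<epsilon>0'" _ "C * C'" _ "N + N'"])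
    fix \<epsilon> z assume \<epsilon>: "0 < \<epsilon>" "\<epsilon> \<le> min \<epsilon>0 \<epsilon>0'"
    have "\<bar>f \<epsilon> z * g \<epsilon> z\<bar> \<le> (C * \<epsilon> ^ j * (1 + norm z) ^ N) * (C' * \<epsilon> ^ k * (1 + norm z) ^ N')"
      unfolding abs_mult using f(1) f(3)[of \<epsilon> z] g(3)[of \<epsilon> z] \<epsilon> by (intro mult_mono) auto
    then show "\<bar>f \<epsilon> z * g \<epsilon> z\<bar> \<le> C * C' * \<epsilon> ^ (j + k) * (1 + norm z) ^ (N + N')"
      by (simp add: power_add mult_ac)
  qed (use f g in auto)
qed

lemma unif_O_le:
  assumes "unif_O k f" "j \<le> k"
  shows "unif_O j f"
proof -
  obtain C N \<epsilon>0 where f: "C \<ge> 0" "\<epsilon>0 > 0" "\<epsilon>0 \<le> 1"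
    "\<And>\<epsilon> z. 0 < \<epsilon> \<Longrightarrow> \<epsilon> \<le> \<epsilon>0 \<Longrightarrow> \<bar>f \<epsilon> z\<bar> \<le> C * \<epsilon> ^ k * (1 + norm z) ^ N"
    using assms(1) by (rule unif_OE) blast
  show ?thesis
  proof (rule unif_OI[OF f(2), of _ C _ N])
    fix \<epsilon> z assume \<epsilon>: "0 < \<epsilon>" "\<epsilon> \<le> \<epsilon>0"
    have "\<bar>f \<epsilon> z\<bar> \<le> C * \<epsilon> ^ k * (1 + norm z) ^ N" using f(4) \<epsilon> by auto
    also have "\<dots> \<le> C * \<epsilon> ^ j * (1 + norm z) ^ N"
      using f(1,3) \<epsilon> assms(2) by (intro mult_right_mono mult_left_mono power_decreasing) auto
    finally show "\<bar>f \<epsilon> z\<bar> \<le> C * \<epsilon> ^ j * (1 + norm z) ^ N" .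
  qed
qed

lemma unif_O_const: "unif_O 0 (\<lambda>_ _. c)"
  by (rule unif_OI[of 1 _ "\<bar>c\<bar>" 0 0]) auto

lemma unif_O_eps: "unif_O k (\<lambda>\<epsilon> _. \<epsilon> ^ k)"
  by (rule unif_OI[of 1 _ 1 k 0]) auto

lemma unif_O_norm: "unif_O 0 (\<lambda>_ z. norm z)"
  by (rule unif_OI[of 1 _ 1 0 1]) auto

lemma unif_O_mult0:
  "unif_O 0 f \<Longrightarrow> unif_O k g \<Longrightarrow> unif_O k (\<lambda>\<epsilon> z. f \<epsilon> z * g \<epsilon> z)"
  using unif_O_mult[of 0 f k g] by simp

lemma unif_O_mult0':
  "unif_O k f \<Longrightarrow> unif_O 0 g \<Longrightarrow> unif_O k (\<lambda>\<epsilon> z. f \<epsilon> z * g \<epsilon> z)"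
  using unif_O_mult[of k f 0 g] by simp

lemma unif_O_eps_mult:
  "unif_O 0 f \<Longrightarrow> unif_O k (\<lambda>\<epsilon> z. \<epsilon> ^ k * f \<epsilon> z)"
  using unif_O_mult[OF unif_O_eps[of k]] by fastforce

lemma unif_O_power: "unif_O k f \<Longrightarrow> unif_O (k * n) (\<lambda>\<epsilon> z. f \<epsilon> z ^ n)"
proof (induction n)
  case (Suc n)
  then show ?case using unif_O_mult[of k f "k * n" "\<lambda>\<epsilon> z. f \<epsilon> z ^ n"] by simp
qed (simp add: unif_O_const)

lemma unif_O_power0: "unif_O 0 f \<Longrightarrow> unif_O 0 (\<lambda>\<epsilon> z. f \<epsilon> z ^ n)"
  using unif_O_power[of 0 f n] by simp

lemma unif_O_cdiv: "unif_O k f \<Longrightarrow> unif_O k (\<lambda>\<epsilon> z. f \<epsilon> z / c)"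
  using unif_O_mult0'[OF _ unif_O_const[of "1 / c"]] by fastforce

lemma unif_O_abs: "unif_O k f \<Longrightarrow> unif_O k (\<lambda>\<epsilon> z. \<bar>f \<epsilon> z\<bar>)"
  by (rule unif_O_mono[of k f 1]) auto

lemma unif_O_divide_eps:
  assumes "unif_O (k + j) f"
  shows "unif_O k (\<lambda>\<epsilon> z. f \<epsilon> z / \<epsilon> ^ j)"
proof -
  obtain C N \<epsilon>0 where f: "C \<ge> 0" "\<epsilon>0 > 0"
    "\<And>\<epsilon> z. 0 < \<epsilon> \<Longrightarrow> \<epsilon> \<le> \<epsilon>0 \<Longrightarrow> \<bar>f \<epsilon> z\<bar> \<le> C * \<epsilon> ^ (k + j) * (1 + norm z) ^ N"
    using assms(1) by (rule unif_OE) blast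
  show ?thesis
  proof (rule unif_OI[OF f(2), of _ C _ N])
    fix \<epsilon> z assume \<epsilon>: "0 < \<epsilon>" "\<epsilon> \<le> \<epsilon>0"
    show "\<bar>f \<epsilon> z / \<epsilon> ^ j\<bar> \<le> C * \<epsilon> ^ k * (1 + norm z) ^ N"
      using f(3)[OF \<epsilon>, of z] \<epsilon> by (simp add: abs_divide divide_le_eq power_add mult_ac)
  qed
qed

lemma unif_O_compose:
  assumes f: "unif_O k f" and Y: "unif_O 0 (\<lambda>\<epsilon> z. norm (Y \<epsilon> z))"
  shows "unif_O k (\<lambda>\<epsilon> z. f \<epsilon> (Y \<epsilon> z))"
proof -
  obtain C N \<epsilon>0 where f: "C \<ge> 0" "\<epsilon>0 > 0"
    "\<And>\<epsilon> z. 0 < \<epsilon> \<Longrightarrow> \<epsilon> \<le> \<epsilon>0 \<Longrightarrow> \<bar>f \<epsilon> z\<bar> \<le> C * \<epsilon> ^ k * (1 + norm z) ^ N"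
    using f by (rule unif_OE) blast
  have "unif_O k (\<lambda>\<epsilon> z. (C * \<epsilon> ^ k) * (1 + norm (Y \<epsilon> z)) ^ N)"
    by (intro unif_O_mult0' unif_O_mult0 unif_O_power0 unif_O_add unif_O_const Y unif_O_eps)
  then show ?thesis using f(2)
  proof (rule unif_O_mono)
    fix \<epsilon> z assume "0 < \<epsilon>" "\<epsilon> \<le> \<epsilon>0"
    then show "\<bar>f \<epsilon> (Y \<epsilon> z)\<bar> \<le> \<bar>(C * \<epsilon> ^ k) * (1 + norm (Y \<epsilon> z)) ^ N\<bar>"
      using f(3)[of \<epsilon> "Y \<epsilon> z"] by linarith
  qed
qed

lemma unif_O_cong_mult:
  assumes "unif_O k (\<lambda>\<epsilon> z. f \<epsilon> z - f0 \<epsilon> z)" "unif_O k (\<lambda>\<epsilon> z. g \<epsilon> z - g0 \<epsilon> z)"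
    "unif_O 0 f0" "unif_O 0 g0"
  shows "unif_O k (\<lambda>\<epsilon> z. f \<epsilon> z * g \<epsilon> z - f0 \<epsilon> z * g0 \<epsilon> z)"
proof -
  have g: "unif_O 0 g"
    using unif_O_add[OF unif_O_le[OF assms(2), of 0] assms(4)] by simp
  have "unif_O k (\<lambda>\<epsilon> z. f0 \<epsilon> z * (g \<epsilon> z - g0 \<epsilon> z) + (f \<epsilon> z - f0 \<epsilon> z) * g \<epsilon> z)"
    by (intro unif_O_add unif_O_mult0[OF assms(3,2)] unif_O_mult0'[OF assms(1) g])
  then show ?thesis by (simp add: algebra_simps)
qed

lemma unif_O_cong_power:
  assumes "unif_O k (\<lambda>\<epsilon> z. f \<epsilon> z - f0 \<epsilon> z)" "unif_O 0 f0"
  shows "unif_O k (\<lambda>\<epsilon> z. f \<epsilon> z ^ n - f0 \<epsilon> z ^ n)"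
proof (induction n)
  case 0
  show ?case using unif_O_const[of 0] by (rule unif_O_mono[OF unif_O_mult0[OF _ assms(1)], of _ 1]) auto
next
  case (Suc n)
  then show ?case
    using unif_O_cong_mult[OF assms(1) Suc assms(2) unif_O_power0[OF assms(2)]] by simp
qed

text \<open>
  An expansion at 0 of a function of one variable becomes an expansion in \<open>\<epsilon>\<close> after substituting
  \<open>\<epsilon>\<^sup>2 * b x\<close>. Boundedness of \<open>b\<close> is essential: it keeps the argument in the neighbourhood of 0 for
  all \<open>x\<close> at once. This is the use of the boundedness of the second derivative of the log-density.
\<close>
lemma unif_O_substitute:
  assumes f: "f \<in> O[nhds 0](\<lambda>t::real. t ^ k)" and b: "bounded (range b)"
  shows "unif_O (2 * k) (\<lambda>\<epsilon> x. f (\<epsilon>\<^sup>2 * b x))"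
proof -
  obtain M where M: "\<And>x. \<bar>b x\<bar> \<le> M" "M > 0"
    using b unfolding bounded_pos by auto
  obtain c where c: "c > 0" "\<forall>\<^sub>F t in nhds 0. norm (f t) \<le> c * norm (t ^ k)"
    using f by (elim landau_o.bigE)
  then obtain \<eta> where \<eta>: "\<eta> > 0" "\<And>t. \<bar>t\<bar> < \<eta> \<Longrightarrow> \<bar>f t\<bar> \<le> c * \<bar>t\<bar> ^ k"
    by (auto simp: eventually_nhds_metric dist_real_def power_abs)
  define \<epsilon>0 where "\<epsilon>0 = sqrt (\<eta> / (2 * M))"
  have \<epsilon>0: "\<epsilon>0 > 0" using \<eta> M by (simp add: \<epsilon>0_def)
  show ?thesis
  proof (rule unif_OI[OF \<epsilon>0, of _ "c * M ^ k" _ 0])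
    fix \<epsilon> x assume \<epsilon>: "0 < \<epsilon>" "\<epsilon> \<le> \<epsilon>0"
    have "\<epsilon>\<^sup>2 \<le> \<epsilon>0\<^sup>2" using \<epsilon> by (intro power_mono) auto
    also have "\<epsilon>0\<^sup>2 = \<eta> / (2 * M)" using \<eta> M by (simp add: \<epsilon>0_def)
    finally have "\<epsilon>\<^sup>2 * M \<le> \<eta> / 2" using M by (simp add: field_simps)
    moreover have *: "\<bar>\<epsilon>\<^sup>2 * b x\<bar> \<le> \<epsilon>\<^sup>2 * M" using M(1)[of x] by (simp add: abs_mult mult_left_mono)
    ultimately have "\<bar>\<epsilon>\<^sup>2 * b x\<bar> < \<eta>" using \<eta> by linarith
    then have "\<bar>f (\<epsilon>\<^sup>2 * b x)\<bar> \<le> c * \<bar>\<epsilon>\<^sup>2 * b x\<bar> ^ k" by (rule \<eta>)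
    also have "\<dots> \<le> c * (\<epsilon>\<^sup>2 * M) ^ k" using * c(1) by (intro mult_left_mono power_mono) auto
    finally show "\<bar>f (\<epsilon>\<^sup>2 * b x)\<bar> \<le> c * M ^ k * \<epsilon> ^ (2 * k) * (1 + norm x) ^ 0"
      by (simp add: power_mult_distrib power_mult power_even_eq power2_eq_square mult_ac)
  qed
qed

text \<open>
  Taylor's theorem with a Lagrange remainder; the intermediate point is at most \<open>\<bar>m\<bar> + \<bar>\<delta>\<bar>\<close> in
  absolute value, so polynomial growth of the last derivative bounds the remainder.
\<close>
lemma unif_O_taylor:
  fixes f :: "nat \<Rightarrow> real \<Rightarrow> real" and m \<delta> :: "real \<Rightarrow> 's::real_normed_vector \<Rightarrow> real"
  assumes deriv: "\<And>k x. k < n \<Longrightarrow> (f k has_real_derivative f (Suc k) x) (at x)"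
    and fn: "unif_O 0 (\<lambda>_. f n)" and m: "unif_O 0 m" and \<delta>: "unif_O 1 \<delta>"
  shows "unif_O n (\<lambda>\<epsilon> z. f 0 (m \<epsilon> z + \<delta> \<epsilon> z) - (\<Sum>k<n. f k (m \<epsilon> z) / fact k * \<delta> \<epsilon> z ^ k))"
proof -
  obtain C N \<epsilon>0 where f: "C \<ge> 0" "\<epsilon>0 > 0" "\<epsilon>0 \<le> 1"
    "\<And>\<epsilon> x. 0 < \<epsilon> \<Longrightarrow> \<epsilon> \<le> \<epsilon>0 \<Longrightarrow> \<bar>f n x\<bar> \<le> C * \<epsilon> ^ 0 * (1 + norm x) ^ N"
    using fn by (rule unif_OE) blast
  have f': "\<bar>f n x\<bar> \<le> C * (1 + \<bar>x\<bar>) ^ N" for x using f(4)[of \<epsilon>0] f(2) by simp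
  have "unif_O n (\<lambda>\<epsilon> z. (C * (1 + (\<bar>m \<epsilon> z\<bar> + \<bar>\<delta> \<epsilon> z\<bar>)) ^ N / fact n) * \<delta> \<epsilon> z ^ n)"
    using unif_O_power[OF \<delta>, of n] unif_O_le[OF \<delta>, of 0]
    by (intro unif_O_mult0 unif_O_cdiv unif_O_power0 unif_O_add unif_O_const unif_O_abs m) auto
  then show ?thesis
  proof (rule unif_O_mono[of _ _ 1])
    fix \<epsilon> z
    obtain \<theta> where \<theta>: "\<bar>\<theta>\<bar> \<le> \<bar>\<delta> \<epsilon> z\<bar>" "f 0 (m \<epsilon> z + \<delta> \<epsilon> z) =
      (\<Sum>k<n. f k (m \<epsilon> z + 0) / fact k * \<delta> \<epsilon> z ^ k) + f n (m \<epsilon> z + \<theta>) / fact n * \<delta> \<epsilon> z ^ n"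
      using Maclaurin_bi_le[of "\<lambda>k t. f k (m \<epsilon> z + t)" "\<lambda>t. f 0 (m \<epsilon> z + t)" n "\<delta> \<epsilon> z"]
      by (auto intro!: DERIV_shift[THEN iffD1] deriv simp: add.commute)
    have "\<bar>f n (m \<epsilon> z + \<theta>)\<bar> \<le> C * (1 + \<bar>m \<epsilon> z + \<theta>\<bar>) ^ N" by (rule f')
    also have "\<dots> \<le> C * (1 + (\<bar>m \<epsilon> z\<bar> + \<bar>\<delta> \<epsilon> z\<bar>)) ^ N"
      using \<theta>(1) f(1) by (intro mult_left_mono power_mono) auto
    finally have "\<bar>f n (m \<epsilon> z + \<theta>) / fact n * \<delta> \<epsilon> z ^ n\<bar> \<le> (C * (1 + (\<bar>m \<epsilon> z\<bar> + \<bar>\<delta> \<epsilon> z\<bar>)) ^ N / fact n) * \<bar>\<delta> \<epsilon> z ^ n\<bar>"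
      by (simp add: abs_mult mult_right_mono divide_right_mono)
    also have "\<dots> \<le> \<bar>(C * (1 + (\<bar>m \<epsilon> z\<bar> + \<bar>\<delta> \<epsilon> z\<bar>)) ^ N / fact n) * \<delta> \<epsilon> z ^ n\<bar>"
      using f(1) by (simp add: abs_mult)
    finally show "\<bar>f 0 (m \<epsilon> z + \<delta> \<epsilon> z) - (\<Sum>k<n. f k (m \<epsilon> z) / fact k * \<delta> \<epsilon> z ^ k)\<bar>
      \<le> \<bar>(C * (1 + (\<bar>m \<epsilon> z\<bar> + \<bar>\<delta> \<epsilon> z\<bar>)) ^ N / fact n) * \<delta> \<epsilon> z ^ n\<bar>"
      using \<theta>(2) by simp
  qed simp
qed

text \<open>
  Congruence modulo \<open>O(\<epsilon>\<^sup>k)\<close>, stated as a relation so that sums and products of truncated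
  expansions can be formed by resolution.
\<close>
definition unif_cong :: "nat \<Rightarrow> (real \<Rightarrow> 's::real_normed_vector \<Rightarrow> real) \<Rightarrow> (real \<Rightarrow> 's \<Rightarrow> real) \<Rightarrow> bool" where
  "unif_cong k f f0 \<longleftrightarrow> unif_O k (\<lambda>\<epsilon> z. f \<epsilon> z - f0 \<epsilon> z)"

lemma unif_cong_refl: "unif_cong k f f"
  unfolding unif_cong_def by (rule unif_O_mono[OF unif_O_eps, of 1]) auto

lemma unif_cong_add:
  "unif_cong k f f0 \<Longrightarrow> unif_cong k g g0 \<Longrightarrow> unif_cong k (\<lambda>\<epsilon> z. f \<epsilon> z + g \<epsilon> z) (\<lambda>\<epsilon> z. f0 \<epsilon> z + g0 \<epsilon> z)"
  unfolding unif_cong_def by (drule (1) unif_O_add) (simp add: algebra_simps)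

lemma unif_cong_diff:
  "unif_cong k f f0 \<Longrightarrow> unif_cong k g g0 \<Longrightarrow> unif_cong k (\<lambda>\<epsilon> z. f \<epsilon> z - g \<epsilon> z) (\<lambda>\<epsilon> z. f0 \<epsilon> z - g0 \<epsilon> z)"
  unfolding unif_cong_def by (drule (1) unif_O_diff) (simp add: algebra_simps)

lemma unif_cong_mult:
  "unif_cong k f f0 \<Longrightarrow> unif_cong k g g0 \<Longrightarrow> unif_O 0 f0 \<Longrightarrow> unif_O 0 g0 \<Longrightarrow>
    unif_cong k (\<lambda>\<epsilon> z. f \<epsilon> z * g \<epsilon> z) (\<lambda>\<epsilon> z. f0 \<epsilon> z * g0 \<epsilon> z)"
  unfolding unif_cong_def by (rule unif_O_cong_mult)

lemma unif_cong_power: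
  "unif_cong k f f0 \<Longrightarrow> unif_O 0 f0 \<Longrightarrow> unif_cong k (\<lambda>\<epsilon> z. f \<epsilon> z ^ n) (\<lambda>\<epsilon> z. f0 \<epsilon> z ^ n)"
  unfolding unif_cong_def by (rule unif_O_cong_power)

lemma unif_cong_mult_O:
  "unif_cong k f f0 \<Longrightarrow> unif_O j p \<Longrightarrow> unif_cong (j + k) (\<lambda>\<epsilon> z. p \<epsilon> z * f \<epsilon> z) (\<lambda>\<epsilon> z. p \<epsilon> z * f0 \<epsilon> z)"
  unfolding unif_cong_def right_diff_distrib[symmetric] by (rule unif_O_mult)

lemma unif_cong_compose:
  "unif_cong k f f0 \<Longrightarrow> unif_O 0 (\<lambda>\<epsilon> z. norm (Y \<epsilon> z)) \<Longrightarrow> unif_cong k (\<lambda>\<epsilon> z. f \<epsilon> (Y \<epsilon> z)) (\<lambda>\<epsilon> z. f0 \<epsilon> (Y \<epsilon> z))"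
  unfolding unif_cong_def by (rule unif_O_compose)

lemma unif_cong_trans:
  "unif_cong k f f0 \<Longrightarrow> unif_cong k f0 f1 \<Longrightarrow> unif_cong k f f1"
  unfolding unif_cong_def by (drule (1) unif_O_add) simp

lemma unif_cong_le: "unif_cong k f f0 \<Longrightarrow> j \<le> k \<Longrightarrow> unif_cong j f f0"
  unfolding unif_cong_def by (rule unif_O_le)

lemma unif_cong_cdiv: "unif_cong k f f0 \<Longrightarrow> unif_cong k (\<lambda>\<epsilon> z. f \<epsilon> z / c) (\<lambda>\<epsilon> z. f0 \<epsilon> z / c)"
  unfolding unif_cong_def diff_divide_distrib[symmetric] by (rule unif_O_cdiv)

lemma unif_cong_const: "unif_cong k (\<lambda>_ _. c) (\<lambda>_ _. c)"
  by (rule unif_cong_refl)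

lemma unif_O_congD: "unif_cong k f f0 \<Longrightarrow> unif_O 0 f0 \<Longrightarrow> unif_O 0 f"
  using unif_O_add[OF unif_O_le[of k "\<lambda>\<epsilon> z. f \<epsilon> z - f0 \<epsilon> z" 0], of f0] by (simp add: unif_cong_def)

lemmas unif_O_intros = unif_O_add unif_O_diff unif_O_minus unif_O_mult0 unif_O_power0 unif_O_const unif_O_cdiv

lemma unif_O_compose_real:
  "unif_O 0 (\<lambda>_. f) \<Longrightarrow> unif_O 0 Y \<Longrightarrow> unif_O 0 (\<lambda>\<epsilon> z. f (Y \<epsilon> z))" for f :: "real \<Rightarrow> real"
  by (rule unif_O_compose[of 0 "\<lambda>_. f"]) (auto intro: unif_O_abs)

context
  fixes X Y :: "real \<Rightarrow> 's::real_normed_vector \<Rightarrow> real"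
  assumes X: "unif_O 0 X" and YX: "unif_O 1 (\<lambda>\<epsilon> z. Y \<epsilon> z - X \<epsilon> z)"
begin

lemma unif_O_Y: "unif_O 0 Y"
  using unif_O_add[OF unif_O_le[OF YX, of 0] X] by simp

lemma unif_O_mid: "unif_O 0 (\<lambda>\<epsilon> z. (X \<epsilon> z + Y \<epsilon> z) / 2)"
  by (intro unif_O_intros X unif_O_Y)

text \<open>
  Both endpoints are expanded around the midpoint, with opposite increments. In the difference the
  even derivatives cancel and in the sum the odd ones, which is what makes the log-ratio expand in
  odd powers of \<open>Y - X\<close>.
\<close>
lemma taylor_midpoint:
  fixes f :: "nat \<Rightarrow> real \<Rightarrow> real"
  assumes deriv: "\<And>k x. k < n \<Longrightarrow> (f k has_real_derivative f (Suc k) x) (at x)"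
    and fn: "unif_O 0 (\<lambda>_. f n)"
  shows "unif_cong n (\<lambda>\<epsilon> z. f 0 (Y \<epsilon> z))
      (\<lambda>\<epsilon> z. \<Sum>k<n. f k ((X \<epsilon> z + Y \<epsilon> z) / 2) / fact k * ((Y \<epsilon> z - X \<epsilon> z) / 2) ^ k)" (is ?Y)
    and "unif_cong n (\<lambda>\<epsilon> z. f 0 (X \<epsilon> z))
      (\<lambda>\<epsilon> z. \<Sum>k<n. f k ((X \<epsilon> z + Y \<epsilon> z) / 2) / fact k * (- ((Y \<epsilon> z - X \<epsilon> z) / 2)) ^ k)" (is ?X)
proof -
  have d: "unif_O 1 (\<lambda>\<epsilon> z. (Y \<epsilon> z - X \<epsilon> z) / 2)" by (intro unif_O_cdiv YX)
  have e1: "(x + y) / 2 + (y - x) / 2 = y" and e2: "(x + y) / 2 + - ((y - x) / 2) = x" for x y :: real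
    by (simp_all add: field_simps)
  show ?Y using unif_O_taylor[OF deriv fn unif_O_mid d] by (simp only: unif_cong_def e1)
  show ?X using unif_O_taylor[OF deriv fn unif_O_mid unif_O_minus[OF d]] by (simp only: unif_cong_def e2)
qed

lemma taylor_midpoint_diff:
  fixes f :: "nat \<Rightarrow> real \<Rightarrow> real"
  assumes deriv: "\<And>k x. k < n \<Longrightarrow> (f k has_real_derivative f (Suc k) x) (at x)"
    and fn: "unif_O 0 (\<lambda>_. f n)"
  shows "unif_cong n (\<lambda>\<epsilon> z. f 0 (Y \<epsilon> z) - f 0 (X \<epsilon> z))
      (\<lambda>\<epsilon> z. \<Sum>k<n. if odd k then f k ((X \<epsilon> z + Y \<epsilon> z) / 2) * (Y \<epsilon> z - X \<epsilon> z) ^ k / (2 ^ (k - 1) * fact k) else 0)"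
proof -
  have "(\<Sum>k<n. a k / fact k * (d / 2) ^ k) - (\<Sum>k<n. a k / fact k * (- (d / 2)) ^ k)
     = (\<Sum>k<n. if odd k then a k * d ^ k / (2 ^ (k - 1) * fact k) else 0)" for a :: "nat \<Rightarrow> real" and d
    unfolding sum_subtractf[symmetric]
  proof (intro sum.cong refl)
    fix k
    have "(2::real) ^ k = 2 * 2 ^ (k - 1)" if "odd k" using that by (cases k) auto
    then show "a k / fact k * (d / 2) ^ k - a k / fact k * (- (d / 2)) ^ k =
      (if odd k then a k * d ^ k / (2 ^ (k - 1) * fact k) else 0)"
      by (cases "even k") (simp_all add: power_minus_odd power_divide)
  qed
  with unif_cong_diff[OF taylor_midpoint[OF deriv fn]] show ?thesis by simp
qed

lemma taylor_midpoint_sum: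
  fixes f :: "nat \<Rightarrow> real \<Rightarrow> real"
  assumes deriv: "\<And>k x. k < n \<Longrightarrow> (f k has_real_derivative f (Suc k) x) (at x)"
    and fn: "unif_O 0 (\<lambda>_. f n)"
  shows "unif_cong n (\<lambda>\<epsilon> z. f 0 (Y \<epsilon> z) + f 0 (X \<epsilon> z))
      (\<lambda>\<epsilon> z. \<Sum>k<n. if even k then 2 * f k ((X \<epsilon> z + Y \<epsilon> z) / 2) * (Y \<epsilon> z - X \<epsilon> z) ^ k / (2 ^ k * fact k) else 0)"
proof -
  have "(\<Sum>k<n. a k / fact k * (d / 2) ^ k) + (\<Sum>k<n. a k / fact k * (- (d / 2)) ^ k)
     = (\<Sum>k<n. if even k then 2 * a k * d ^ k / (2 ^ k * fact k) else 0)" for a :: "nat \<Rightarrow> real" and d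
    unfolding sum.distrib[symmetric]
    by (intro sum.cong refl) (simp add: power_minus_odd power_divide mult_ac)
  with unif_cong_add[OF taylor_midpoint[OF deriv fn]] show ?thesis by simp
qed

lemma taylor_diff:
  fixes f :: "nat \<Rightarrow> real \<Rightarrow> real"
  assumes deriv: "\<And>k x. k < n \<Longrightarrow> (f k has_real_derivative f (Suc k) x) (at x)"
    and fn: "unif_O 0 (\<lambda>_. f n)"
  shows "n = 2 \<Longrightarrow> unif_cong 2 (\<lambda>\<epsilon> z. f 0 (Y \<epsilon> z) - f 0 (X \<epsilon> z))
      (\<lambda>\<epsilon> z. f 1 ((X \<epsilon> z + Y \<epsilon> z) / 2) * (Y \<epsilon> z - X \<epsilon> z))"
   and "n = 4 \<Longrightarrow> unif_cong 4 (\<lambda>\<epsilon> z. f 0 (Y \<epsilon> z) - f 0 (X \<epsilon> z))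
      (\<lambda>\<epsilon> z. f 1 ((X \<epsilon> z + Y \<epsilon> z) / 2) * (Y \<epsilon> z - X \<epsilon> z) + f 3 ((X \<epsilon> z + Y \<epsilon> z) / 2) * (Y \<epsilon> z - X \<epsilon> z) ^ 3 / 24)"
   and "n = 6 \<Longrightarrow> unif_cong 6 (\<lambda>\<epsilon> z. f 0 (Y \<epsilon> z) - f 0 (X \<epsilon> z))
      (\<lambda>\<epsilon> z. f 1 ((X \<epsilon> z + Y \<epsilon> z) / 2) * (Y \<epsilon> z - X \<epsilon> z) + f 3 ((X \<epsilon> z + Y \<epsilon> z) / 2) * (Y \<epsilon> z - X \<epsilon> z) ^ 3 / 24
       + f 5 ((X \<epsilon> z + Y \<epsilon> z) / 2) * (Y \<epsilon> z - X \<epsilon> z) ^ 5 / 1920)"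
proof -
  have s: "(\<Sum>k<2. a k) = a 0 + a 1" "(\<Sum>k<4. a k) = a 0 + a 1 + a 2 + a 3"
    "(\<Sum>k<6. a k) = a 0 + a 1 + a 2 + a 3 + a 4 + a 5" for a :: "nat \<Rightarrow> real"
    by (simp_all add: eval_nat_numeral)
  note * = taylor_midpoint_diff[OF deriv fn]
  {
    assume "n = 2" with * show "unif_cong 2 (\<lambda>\<epsilon> z. f 0 (Y \<epsilon> z) - f 0 (X \<epsilon> z))
      (\<lambda>\<epsilon> z. f 1 ((X \<epsilon> z + Y \<epsilon> z) / 2) * (Y \<epsilon> z - X \<epsilon> z))"
      by (simp add: s fact_numeral)
  next
    assume "n = 4" with * show "unif_cong 4 (\<lambda>\<epsilon> z. f 0 (Y \<epsilon> z) - f 0 (X \<epsilon> z))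
      (\<lambda>\<epsilon> z. f 1 ((X \<epsilon> z + Y \<epsilon> z) / 2) * (Y \<epsilon> z - X \<epsilon> z) + f 3 ((X \<epsilon> z + Y \<epsilon> z) / 2) * (Y \<epsilon> z - X \<epsilon> z) ^ 3 / 24)"
      by (simp add: s fact_numeral)
  next
    assume "n = 6" with * show "unif_cong 6 (\<lambda>\<epsilon> z. f 0 (Y \<epsilon> z) - f 0 (X \<epsilon> z))
      (\<lambda>\<epsilon> z. f 1 ((X \<epsilon> z + Y \<epsilon> z) / 2) * (Y \<epsilon> z - X \<epsilon> z) + f 3 ((X \<epsilon> z + Y \<epsilon> z) / 2) * (Y \<epsilon> z - X \<epsilon> z) ^ 3 / 24
       + f 5 ((X \<epsilon> z + Y \<epsilon> z) / 2) * (Y \<epsilon> z - X \<epsilon> z) ^ 5 / 1920)"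
      by (simp add: s fact_numeral)
  }
qed

lemma taylor_sum:
  fixes f :: "nat \<Rightarrow> real \<Rightarrow> real"
  assumes deriv: "\<And>k x. k < n \<Longrightarrow> (f k has_real_derivative f (Suc k) x) (at x)"
    and fn: "unif_O 0 (\<lambda>_. f n)"
  shows "n = 1 \<Longrightarrow> unif_cong 1 (\<lambda>\<epsilon> z. f 0 (Y \<epsilon> z) + f 0 (X \<epsilon> z))
      (\<lambda>\<epsilon> z. 2 * f 0 ((X \<epsilon> z + Y \<epsilon> z) / 2))"
   and "n = 3 \<Longrightarrow> unif_cong 3 (\<lambda>\<epsilon> z. f 0 (Y \<epsilon> z) + f 0 (X \<epsilon> z))
      (\<lambda>\<epsilon> z. 2 * f 0 ((X \<epsilon> z + Y \<epsilon> z) / 2) + f 2 ((X \<epsilon> z + Y \<epsilon> z) / 2) * (Y \<epsilon> z - X \<epsilon> z) ^ 2 / 4)"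
   and "n = 5 \<Longrightarrow> unif_cong 5 (\<lambda>\<epsilon> z. f 0 (Y \<epsilon> z) + f 0 (X \<epsilon> z))
      (\<lambda>\<epsilon> z. 2 * f 0 ((X \<epsilon> z + Y \<epsilon> z) / 2) + f 2 ((X \<epsilon> z + Y \<epsilon> z) / 2) * (Y \<epsilon> z - X \<epsilon> z) ^ 2 / 4
       + f 4 ((X \<epsilon> z + Y \<epsilon> z) / 2) * (Y \<epsilon> z - X \<epsilon> z) ^ 4 / 192)"
proof -
  have s: "(\<Sum>k<1. a k) = a 0" "(\<Sum>k<3. a k) = a 0 + a 1 + a 2"
    "(\<Sum>k<5. a k) = a 0 + a 1 + a 2 + a 3 + a 4" for a :: "nat \<Rightarrow> real"
    by (simp_all add: eval_nat_numeral)
  note * = taylor_midpoint_sum[OF deriv fn]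
  {
    assume "n = 1" with * show "unif_cong 1 (\<lambda>\<epsilon> z. f 0 (Y \<epsilon> z) + f 0 (X \<epsilon> z))
      (\<lambda>\<epsilon> z. 2 * f 0 ((X \<epsilon> z + Y \<epsilon> z) / 2))"
      by (simp add: s fact_numeral)
  next
    assume "n = 3" with * show "unif_cong 3 (\<lambda>\<epsilon> z. f 0 (Y \<epsilon> z) + f 0 (X \<epsilon> z))
      (\<lambda>\<epsilon> z. 2 * f 0 ((X \<epsilon> z + Y \<epsilon> z) / 2) + f 2 ((X \<epsilon> z + Y \<epsilon> z) / 2) * (Y \<epsilon> z - X \<epsilon> z) ^ 2 / 4)"
      by (simp add: s fact_numeral mult_ac)
  next
    assume "n = 5" with * show "unif_cong 5 (\<lambda>\<epsilon> z. f 0 (Y \<epsilon> z) + f 0 (X \<epsilon> z))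
      (\<lambda>\<epsilon> z. 2 * f 0 ((X \<epsilon> z + Y \<epsilon> z) / 2) + f 2 ((X \<epsilon> z + Y \<epsilon> z) / 2) * (Y \<epsilon> z - X \<epsilon> z) ^ 2 / 4
       + f 4 ((X \<epsilon> z + Y \<epsilon> z) / 2) * (Y \<epsilon> z - X \<epsilon> z) ^ 4 / 192)"
      by (simp add: s fact_numeral mult_ac)
  }
qed

end

section \<open>The one-variable profiles of the algorithm\<close>

text \<open>
  The entire functions \<open>(exp s - 1) / s\<close> and \<open>(exp s - 1 - s) / s\<^sup>2\<close>, in terms of which the
  coefficients of the algorithm can be written without case distinctions.
\<close>
definition exprel1 :: "real \<Rightarrow> real" where
  "exprel1 s = (if s = 0 then 1 else (exp s - 1) / s)"

definition exprel2 :: "real \<Rightarrow> real" where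
  "exprel2 s = (if s = 0 then 1 / 2 else (exp s - 1 - s) / s\<^sup>2)"

text \<open>
  Expansions are stated on \<open>nhds 0\<close> rather than \<open>at 0\<close>, because the second derivative of the
  log-density, which is substituted later, may vanish.
\<close>
lemma bigo_nhds_zero:
  fixes f g :: "real \<Rightarrow> real"
  assumes "f \<in> O[at 0](g)" "f 0 = 0"
  shows "f \<in> O[nhds 0](g)"
proof -
  obtain c where "c > 0" "\<forall>\<^sub>F x in at 0. norm (f x) \<le> c * norm (g x)"
    using assms(1) by (elim landau_o.bigE)
  then have "\<forall>\<^sub>F x in nhds 0. x \<noteq> 0 \<longrightarrow> norm (f x) \<le> c * norm (g x)"
    by (simp add: eventually_at_filter)
  then have "\<forall>\<^sub>F x in nhds 0. norm (f x) \<le> c * norm (g x)"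
    by eventually_elim (use assms(2) \<open>c > 0\<close> in auto)
  then show ?thesis by (rule bigoI)
qed

lemma exprel1_expansion: "(\<lambda>s. exprel1 s - (1 + s / 2 + s\<^sup>2 / 6)) \<in> O[nhds 0](\<lambda>s. s ^ 3)"
proof (rule bigo_nhds_zero)
  have "(\<lambda>s::real. (exp s - 1) / s - (1 + s / 2 + s\<^sup>2 / 6)) \<in> O[at 0](\<lambda>s. s ^ 3)"
    by real_asymp
  then show "(\<lambda>s. exprel1 s - (1 + s / 2 + s\<^sup>2 / 6)) \<in> O[at 0](\<lambda>s. s ^ 3)"
    by (subst landau_o.big.in_cong[where g = "\<lambda>s. (exp s - 1) / s - (1 + s / 2 + s\<^sup>2 / 6)"])
      (auto simp: exprel1_def eventually_at_filter)
qed (simp add: exprel1_def)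

lemma exprel2_expansion: "(\<lambda>s. exprel2 s - (1 / 2 + s / 6)) \<in> O[nhds 0](\<lambda>s. s ^ 2)"
proof (rule bigo_nhds_zero)
  have "(\<lambda>s::real. (exp s - 1 - s) / s\<^sup>2 - (1 / 2 + s / 6)) \<in> O[at 0](\<lambda>s. s ^ 2)"
    by real_asymp
  then show "(\<lambda>s. exprel2 s - (1 / 2 + s / 6)) \<in> O[at 0](\<lambda>s. s ^ 2)"
    by (subst landau_o.big.in_cong[where g = "\<lambda>s. (exp s - 1 - s) / s\<^sup>2 - (1 / 2 + s / 6)"])
      (auto simp: exprel2_def eventually_at_filter)
qed (simp add: exprel2_def)

lemma ln_expansion: "(\<lambda>u::real. ln (1 + u) - (u - u\<^sup>2 / 2)) \<in> O[nhds 0](\<lambda>u. u ^ 3)"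
  by (rule bigo_nhds_zero) (real_asymp, simp)

lemma bigo_power_nhds_mono:
  assumes "f \<in> O[nhds 0](\<lambda>t::real. t ^ j)" "k \<le> j"
  shows "f \<in> O[nhds 0](\<lambda>t::real. t ^ k)"
proof (rule landau_o.big_trans[OF assms(1)])
  have "\<forall>\<^sub>F t in nhds (0::real). t \<in> {-1<..<1}"
    by (rule eventually_nhds_in_open) auto
  then have "\<forall>\<^sub>F t in nhds (0::real). norm (t ^ j) \<le> 1 * norm (t ^ k)"
    by eventually_elim (use assms(2) in \<open>auto simp: power_abs intro!: power_decreasing\<close>)
  then show "(\<lambda>t::real. t ^ j) \<in> O[nhds 0](\<lambda>t. t ^ k)" by (rule bigoI)
qed

lemma exprel1_bigo: "(\<lambda>s. exprel1 s - 1) \<in> O[nhds 0](\<lambda>s. s ^ 1)"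
proof -
  have "(\<lambda>s. (exprel1 s - (1 + s / 2 + s\<^sup>2 / 6)) + (s ^ 1 / 2 + s\<^sup>2 / 6)) \<in> O[nhds 0](\<lambda>s. s ^ 1)"
    by (intro sum_in_bigo bigo_power_nhds_mono[OF exprel1_expansion]
       bigo_power_nhds_mono[of "\<lambda>s. s\<^sup>2 / 6" 2 1]) auto
  then show ?thesis by (simp add: algebra_simps)
qed

lemma bigo_nhds_compose:
  assumes f: "f \<in> O[nhds 0](\<lambda>s::real. s ^ k)" and u: "u \<in> O[nhds 0](\<lambda>t::real. t ^ j)" and j: "j > 0"
  shows "(\<lambda>t. f (u t)) \<in> O[nhds 0](\<lambda>t. t ^ (j * k))"
proof -
  obtain c where c: "c > 0" "\<forall>\<^sub>F t in nhds 0. norm (u t) \<le> c * norm (t ^ j)"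
    using u by (elim landau_o.bigE)
  have "((\<lambda>t::real. c * norm (t ^ j)) \<longlongrightarrow> c * norm ((0::real) ^ j)) (nhds 0)"
    by (intro tendsto_intros filterlim_ident)
  then have "((\<lambda>t::real. c * norm (t ^ j)) \<longlongrightarrow> 0) (nhds 0)" using j by (simp add: power_0_left)
  with c(2) have "(u \<longlongrightarrow> 0) (nhds 0)" by (rule Lim_null_comparison)
  then have "(\<lambda>t. f (u t)) \<in> O[nhds 0](\<lambda>t. u t ^ k)"
    by (rule landau_o.big.compose[OF f])
  also have "(\<lambda>t. u t ^ k) \<in> O[nhds 0](\<lambda>t. (t ^ j) ^ k)"
    by (intro landau_o.big_power u)
  finally show ?thesis by (simp add: power_mult)
qed

lemma bigo_cmult: "f \<in> O[F](g) \<Longrightarrow> (\<lambda>t. c * f t :: real) \<in> O[F](g)"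
  by (cases "c = 0") auto

lemma tendsto_imp_bigo1: "(f \<longlongrightarrow> c) F \<Longrightarrow> f \<in> O[F](\<lambda>_. 1 :: real)" for f :: "real \<Rightarrow> real"
  by (rule bigoI_tendsto[of _ _ c]) auto

text \<open>
  With \<open>t = h g''\<close>, the variance of the proposal is \<open>h * P t\<close> and its drift is
  \<open>h * (drift1 t * g' - (h / 3) * drift3 t * g''')\<close>: the parameters enter only through the three
  functions \<open>P\<close>, \<open>drift1\<close> and \<open>drift3\<close> of one variable and, up to the order that matters for the
  limit, only through their first few Taylor coefficients at 0.
\<close>
locale gbO_params =
  fixes a1 a2 a3 a4 a5 :: real
  assumes a_pos: "a1 > 0" "a2 > 0" "a3 > 0" "a4 > 0" "a5 > 0"
    and profile_pos: "\<And>t. gbO_positivity_fun a4 a5 t > 0"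
begin

abbreviation P :: "real \<Rightarrow> real" where "P \<equiv> gbO_positivity_fun a4 a5"

definition drift1 :: "real \<Rightarrow> real" where
  "drift1 t = exprel1 (a1 * t / 2) / 2 - (a1 / 2 + 1 / 6) * (t / 4) * exprel1 (- (a2 * t\<^sup>2 / 4))"

definition drift3 :: "real \<Rightarrow> real" where
  "drift3 t = exprel2 (a3 * t / 2) / 4"

lemma P_eq: "P t = exprel1 (a4 * t) - (a4 / 2 - 1 / 6) * t * exprel1 (- (a5 * t\<^sup>2))"
  using a_pos by (simp add: gbO_positivity_fun_def exprel1_def power2_eq_square field_simps)

lemma T1_eq: "h > 0 \<Longrightarrow> a > 0 \<Longrightarrow> T1 m h a = h / 2 * exprel1 (a * (h * m) / 2)"
  by (simp add: T1_def exprel1_def field_simps)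

lemma T2_eq: "h > 0 \<Longrightarrow> a > 0 \<Longrightarrow> T2 m h a = - (h * (h * m) / 4) * exprel1 (- (a * (h * m)\<^sup>2 / 4))"
  by (simp add: T2_def exprel1_def power2_eq_square field_simps)

lemma T3_eq: "h > 0 \<Longrightarrow> a > 0 \<Longrightarrow> T3 m h a = h\<^sup>2 / 4 * exprel2 (a * (h * m) / 2)"
  by (simp add: T3_def exprel2_def power2_eq_square field_simps)

lemma exprel1_linear: "(\<lambda>t. exprel1 (c * t) - (1 + c * t / 2 + c\<^sup>2 * t\<^sup>2 / 6)) \<in> O[nhds 0](\<lambda>t. t ^ 3)"
  using bigo_nhds_compose[OF exprel1_expansion, of "\<lambda>t. c * t" 1]
  by (simp add: power_mult_distrib)

lemma exprel1_square: "(\<lambda>t. t * exprel1 (c * t\<^sup>2) - t) \<in> O[nhds 0](\<lambda>t. t ^ 3)"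
proof -
  have "(\<lambda>t. exprel1 (c * t\<^sup>2) - 1) \<in> O[nhds 0](\<lambda>t. t ^ 2)"
    using bigo_nhds_compose[OF exprel1_bigo, of "\<lambda>t. c * t\<^sup>2" 2] by simp
  then have "(\<lambda>t. t * (exprel1 (c * t\<^sup>2) - 1)) \<in> O[nhds 0](\<lambda>t. t * t ^ 2)"
    by (intro landau_o.big_mult) auto
  then show ?thesis by (simp add: algebra_simps eval_nat_numeral)
qed

lemma P_expansion: "(\<lambda>t. P t - (1 + t / 6 + a4\<^sup>2 * t\<^sup>2 / 6)) \<in> O[nhds 0](\<lambda>t. t ^ 3)"
proof -
  have eq: "(exprel1 (a4 * t) - (1 + a4 * t / 2 + a4\<^sup>2 * t\<^sup>2 / 6))
     - (a4 / 2 - 1 / 6) * (t * exprel1 (- a5 * t\<^sup>2) - t) = P t - (1 + t / 6 + a4\<^sup>2 * t\<^sup>2 / 6)" for t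
    by (simp add: P_eq algebra_simps)
  then show ?thesis
    using sum_in_bigo(2)[OF exprel1_linear[of a4] bigo_cmult[OF exprel1_square[of "- a5"], of "a4 / 2 - 1 / 6"]]
    by (simp only: eq)
qed

lemma drift1_expansion: "(\<lambda>t. drift1 t - (1 / 2 - t / 24 + a1\<^sup>2 * t\<^sup>2 / 48)) \<in> O[nhds 0](\<lambda>t. t ^ 3)"
proof -
  have "(1 / 2) * (exprel1 (a1 / 2 * t) - (1 + a1 / 2 * t / 2 + (a1 / 2)\<^sup>2 * t\<^sup>2 / 6))
     - (a1 / 2 + 1 / 6) / 4 * (t * exprel1 (- a2 / 4 * t\<^sup>2) - t) = drift1 t - (1 / 2 - t / 24 + a1\<^sup>2 * t\<^sup>2 / 48)" for t
    by (simp add: drift1_def algebra_simps power_divide) (simp add: field_simps)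
  then show ?thesis
    using sum_in_bigo(2)[OF bigo_cmult[OF exprel1_linear[of "a1 / 2"], of "1 / 2"]
      bigo_cmult[OF exprel1_square[of "- a2 / 4"], of "(a1 / 2 + 1 / 6) / 4"]] by simp
qed

lemma drift3_expansion: "(\<lambda>t. drift3 t - (1 / 8 + a3 * t / 48)) \<in> O[nhds 0](\<lambda>t. t ^ 2)"
proof -
  have eq: "1 / 4 * (exprel2 (a3 / 2 * t) - (1 / 2 + a3 / 2 * t / 6)) = drift3 t - (1 / 8 + a3 * t / 48)" for t
    by (simp add: drift3_def field_simps)
  have "(\<lambda>t. exprel2 (a3 / 2 * t) - (1 / 2 + a3 / 2 * t / 6)) \<in> O[nhds 0](\<lambda>t. t ^ 2)"
    using bigo_nhds_compose[OF exprel2_expansion, of "\<lambda>t. a3 / 2 * t" 1] by simp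
  from bigo_cmult[OF this, of "1 / 4"] show ?thesis by (simp only: eq)
qed

lemma P_minus_1_bigo: "(\<lambda>t. P t - 1) \<in> O[nhds 0](\<lambda>t. t ^ 1)"
proof -
  have "(\<lambda>t. (P t - (1 + t / 6 + a4\<^sup>2 * t\<^sup>2 / 6)) + (t ^ 1 / 6 + (a4\<^sup>2 * t\<^sup>2 / 6))) \<in> O[nhds 0](\<lambda>t. t ^ 1)"
    by (intro sum_in_bigo bigo_power_nhds_mono[OF P_expansion]
       bigo_power_nhds_mono[of "\<lambda>s. a4\<^sup>2 * s\<^sup>2 / 6" 2 1]) auto
  then show ?thesis by (simp add: algebra_simps)
qed

lemma P_tendsto_1: "(P \<longlongrightarrow> 1) (nhds 0)"
proof -
  obtain c where c: "c > 0" "\<forall>\<^sub>F t in nhds 0. norm (P t - 1) \<le> c * norm (t ^ 1)"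
    using P_minus_1_bigo by (elim landau_o.bigE)
  have "((\<lambda>t::real. c * norm (t ^ 1)) \<longlongrightarrow> c * norm ((0::real) ^ 1)) (nhds 0)"
    by (intro tendsto_intros filterlim_ident)
  with c(2) have "((\<lambda>t. P t - 1) \<longlongrightarrow> 0) (nhds 0)" by (intro Lim_null_comparison[OF c(2)]) simp
  then show ?thesis by (simp add: LIM_zero_iff)
qed

lemma sqrt_P_bigo: "(\<lambda>t. sqrt (P t) - 1) \<in> O[nhds 0](\<lambda>t. t ^ 1)"
proof (rule landau_o.big_trans[OF _ P_minus_1_bigo], rule bigoI[of _ 1])
  show "\<forall>\<^sub>F t in nhds 0. norm (sqrt (P t) - 1) \<le> 1 * norm (P t - 1)"
  proof (intro always_eventually allI)
    fix t
    have "P t - 1 = (sqrt (P t) - 1) * (sqrt (P t) + 1)"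
      using profile_pos[of t] by (simp add: algebra_simps)
    then have "\<bar>P t - 1\<bar> = \<bar>sqrt (P t) - 1\<bar> * (sqrt (P t) + 1)"
      using profile_pos[of t] by (simp add: abs_mult)
    moreover have "\<bar>sqrt (P t) - 1\<bar> * (sqrt (P t) + 1) \<ge> \<bar>sqrt (P t) - 1\<bar> * 1"
      using profile_pos[of t] by (intro mult_left_mono) auto
    ultimately show "norm (sqrt (P t) - 1) \<le> 1 * norm (P t - 1)" by simp
  qed
qed

text \<open>
  With \<open>p\<close> and \<open>v\<close> the truncations of \<open>P\<close> and \<open>1 / P\<close>, \<open>1 / P - v = (1 - P * v) / P\<close>, and
  \<open>1 - p * v\<close> is \<open>t\<^sup>3\<close> times a polynomial.
\<close>
lemma inverse_P_expansion:
  "(\<lambda>t. 1 / P t - (1 - t / 6 + (1 / 36 - a4\<^sup>2 / 6) * t\<^sup>2)) \<in> O[nhds 0](\<lambda>t. t ^ 3)"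
proof -
  let ?p = "\<lambda>t::real. 1 + t / 6 + a4\<^sup>2 * t\<^sup>2 / 6" and ?v = "\<lambda>t::real. 1 - t / 6 + (1 / 36 - a4\<^sup>2 / 6) * t\<^sup>2"
  have cont: "(\<lambda>t. f t) \<in> O[nhds 0](\<lambda>_. 1)" if "(f \<longlongrightarrow> c) (nhds 0)" for f :: "real \<Rightarrow> real" and c
    using that by (rule tendsto_imp_bigo1) 
  have iP: "(\<lambda>t. 1 / P t) \<in> O[nhds 0](\<lambda>_. 1)"
    by (rule cont[of _ "1 / 1"]) (intro tendsto_divide P_tendsto_1 tendsto_const, simp)
  have v: "?v \<in> O[nhds 0](\<lambda>_. 1)"
    by (rule cont[of _ "?v 0"]) (intro tendsto_intros filterlim_ident; simp)
  let ?q = "\<lambda>t. (a4\<^sup>2 / 36 - (1 / 36 - a4\<^sup>2 / 6) / 6) - a4\<^sup>2 / 6 * (1 / 36 - a4\<^sup>2 / 6) * t"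
  have q: "?q \<in> O[nhds 0](\<lambda>_. 1)"
    by (rule cont[of _ "?q 0"]) (intro tendsto_intros filterlim_ident; simp)
  have "(\<lambda>t. (1 / P t) * (t ^ 3 * ?q t - (P t - ?p t) * ?v t)) \<in> O[nhds 0](\<lambda>t. 1 * (t ^ 3))"
  proof (intro landau_o.big_mult iP sum_in_bigo)
    show "(\<lambda>t. t ^ 3 * ?q t) \<in> O[nhds 0](\<lambda>t. t ^ 3)"
      using landau_o.big_mult[OF landau_o.big_refl q] by simp
    show "(\<lambda>t. (P t - ?p t) * ?v t) \<in> O[nhds 0](\<lambda>t. t ^ 3)"
      using landau_o.big_mult[OF P_expansion v] by simp
  qed
  moreover have "(1 / P t) * (t ^ 3 * ?q t - (P t - ?p t) * ?v t) = 1 / P t - ?v t" for t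
  proof -
    have "t ^ 3 * ?q t - (P t - ?p t) * ?v t = 1 - P t * ?v t"
      by (simp add: field_simps eval_nat_numeral)
    moreover have "1 / P t * (1 - P t * w) = 1 / P t - w" for w
      using profile_pos[of t] by (simp add: field_simps)
    ultimately show ?thesis by (simp only:)
  qed
  ultimately show ?thesis by (simp only: mult_1)
qed

text \<open>
  The expansion of \<open>ln (1 + u)\<close> at \<open>u = P - 1\<close>; the square of \<open>u\<close> is replaced by the square of its
  truncation \<open>w\<close> through \<open>u\<^sup>2 - w\<^sup>2 = (u - w) * (u + w)\<close>.
\<close>
lemma ln_P_expansion:
  "(\<lambda>t. ln (P t) / 2 - (t / 12 + (a4\<^sup>2 / 12 - 1 / 144) * t\<^sup>2)) \<in> O[nhds 0](\<lambda>t. t ^ 3)"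
proof -
  let ?r = "\<lambda>t. P t - (1 + t / 6 + a4\<^sup>2 * t\<^sup>2 / 6)"
  let ?u = "\<lambda>t. P t - 1"
  let ?w = "\<lambda>t. t / 6 + a4\<^sup>2 * t\<^sup>2 / 6"
  have l: "(\<lambda>t. ln (1 + ?u t) - (?u t - (?u t)\<^sup>2 / 2)) \<in> O[nhds 0](\<lambda>t. t ^ 3)"
    using bigo_nhds_compose[OF ln_expansion P_minus_1_bigo] by simp
  have s: "(\<lambda>t. ?u t + ?w t) \<in> O[nhds 0](\<lambda>_. 1)"
    by (rule tendsto_imp_bigo1[of _ "(1 - 1) + ?w 0"])
      (intro tendsto_intros P_tendsto_1 filterlim_ident; simp)
  have sq: "(\<lambda>t. ?r t * (?u t + ?w t)) \<in> O[nhds 0](\<lambda>t. t ^ 3)"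
    using landau_o.big_mult[OF P_expansion s] by simp
  let ?q = "\<lambda>t. - (a4\<^sup>2 / 36) - a4\<^sup>2 * a4\<^sup>2 * t / 72"
  have q: "?q \<in> O[nhds 0](\<lambda>_. 1)"
    by (rule tendsto_imp_bigo1[of _ "?q 0"]) (intro tendsto_intros filterlim_ident; simp)
  have q3: "(\<lambda>t. t ^ 3 * ?q t) \<in> O[nhds 0](\<lambda>t. t ^ 3)"
    using landau_o.big_mult[OF landau_o.big_refl q] by simp
  have eq: "1 / 2 * ((ln (1 + ?u t) - (?u t - (?u t)\<^sup>2 / 2)) + ?r t - 1 / 2 * (?r t * (?u t + ?w t)) + t ^ 3 * ?q t)
     = ln (P t) / 2 - (t / 12 + (a4\<^sup>2 / 12 - 1 / 144) * t\<^sup>2)" for t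
    by (simp add: field_simps eval_nat_numeral)
  show ?thesis
    using bigo_cmult[OF sum_in_bigo(1)[OF sum_in_bigo(2)[OF sum_in_bigo(1)[OF l P_expansion]
      bigo_cmult[OF sq, of "1 / 2"]] q3], of "1 / 2"] by (simp only: eq)
qed

end

section \<open>Expansion of the log-ratio of one coordinate\<close>

locale gbO_target = gbO_params +
  fixes g :: "real \<Rightarrow> real"
  assumes g_C10: "C_k 10 g"
    and g2_bounded: "bounded (range ((deriv ^^ 2) g))"
    and g_growth: "\<exists>C \<kappa> :: real. \<forall>i\<in>{1..10}. \<forall>t. \<bar>(deriv ^^ i) g t\<bar> \<le> C * (1 + \<bar>t\<bar> powr \<kappa>)"
begin

definition D :: "nat \<Rightarrow> real \<Rightarrow> real" where "D i = (deriv ^^ i) g"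

lemma D_0: "D 0 = g" by (simp add: D_def)

lemma D_deriv: "i < 10 \<Longrightarrow> (D i has_real_derivative D (Suc i) x) (at x)"
  using g_C10 by (auto simp: D_def C_k_def DERIV_deriv_iff_real_differentiable)

lemma D_derivs:
  "(D 1 has_real_derivative D 2 x) (at x)" "(D 2 has_real_derivative D 3 x) (at x)"
  "(D 3 has_real_derivative D 4 x) (at x)" "(D 4 has_real_derivative D 5 x) (at x)"
  "(D 5 has_real_derivative D 6 x) (at x)"
  using D_deriv[of 1 x] D_deriv[of 2 x] D_deriv[of 3 x] D_deriv[of 4 x] D_deriv[of 5 x]
  by (simp_all add: eval_nat_numeral)

lemma D2_bounded: "bounded (range (D 2))"
  using g2_bounded by (simp add: D_def)

lemma D_cont: "i < 10 \<Longrightarrow> continuous_on A (D i)"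
  using D_deriv by (intro DERIV_continuous_on) (auto intro: DERIV_subset)

text \<open>
  The exponent \<open>\<kappa>\<close> may be negative, in which case the assumed bound is not polynomial near 0; there
  continuity on \<open>{-1..1}\<close> takes over.
\<close>
lemma D_growth:
  assumes "i \<in> {1..<10}"
  shows "unif_O 0 (\<lambda>_. D i)"
proof -
  obtain C \<kappa> where C: "\<And>t. \<bar>D i t\<bar> \<le> C * (1 + \<bar>t\<bar> powr \<kappa>)"
    using g_growth assms unfolding D_def by fastforce
  have "compact (D i ` {-1..1})"
    using assms by (intro compact_continuous_image D_cont) auto
  then obtain B where B: "\<And>t. t \<in> {-1..1} \<Longrightarrow> \<bar>D i t\<bar> \<le> B"
    using compact_imp_bounded[of "D i ` {-1..1}"] unfolding bounded_iff by (auto intro: that)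
  define N where "N = nat \<lceil>\<kappa>\<rceil>"
  have "\<bar>D i t\<bar> \<le> (\<bar>B\<bar> + 2 * \<bar>C\<bar>) * (1 + \<bar>t\<bar>) ^ N" for t
  proof (cases "t \<in> {-1..1}")
    case True
    have "\<bar>D i t\<bar> \<le> (\<bar>B\<bar> + 2 * \<bar>C\<bar>) * 1" using B[OF True] by simp
    also have "\<dots> \<le> (\<bar>B\<bar> + 2 * \<bar>C\<bar>) * (1 + \<bar>t\<bar>) ^ N" by (intro mult_left_mono one_le_power) auto
    finally show ?thesis .
  next
    case False
    then have t: "\<bar>t\<bar> \<ge> 1" by auto
    have "\<bar>t\<bar> powr \<kappa> \<le> \<bar>t\<bar> powr real N" using t by (intro powr_mono) (auto simp: N_def intro: real_nat_ceiling_ge)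
    also have "\<dots> = \<bar>t\<bar> ^ N" using t by (simp add: powr_realpow)
    also have "\<dots> \<le> (1 + \<bar>t\<bar>) ^ N" by (intro power_mono) auto
    finally have p: "\<bar>t\<bar> powr \<kappa> \<le> (1 + \<bar>t\<bar>) ^ N" .
    have "1 \<le> (1 + \<bar>t\<bar>) ^ N" by (intro one_le_power) auto
    have "\<bar>D i t\<bar> \<le> C * (1 + \<bar>t\<bar> powr \<kappa>)" by (rule C)
    also have "\<dots> \<le> \<bar>C\<bar> * (1 + \<bar>t\<bar> powr \<kappa>)" by (intro mult_right_mono) auto
    also have "\<dots> \<le> \<bar>C\<bar> * (2 * (1 + \<bar>t\<bar>) ^ N)"
    proof (intro mult_left_mono)
      show "1 + \<bar>t\<bar> powr \<kappa> \<le> 2 * (1 + \<bar>t\<bar>) ^ N"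
        using p \<open>1 \<le> (1 + \<bar>t\<bar>) ^ N\<close> by linarith
    qed simp
    also have "\<dots> \<le> (\<bar>B\<bar> + 2 * \<bar>C\<bar>) * (1 + \<bar>t\<bar>) ^ N" by (simp add: algebra_simps)
    finally show ?thesis .
  qed
  then show ?thesis by (intro unif_OI[of 1 _ "\<bar>B\<bar> + 2 * \<bar>C\<bar>" 0 N]) auto
qed

text \<open>
  Up to constants, the log-density of proposing \<open>y\<close> from \<open>x\<close> is
  \<open>- log_sd \<epsilon> x - (\<delta> - \<epsilon>\<^sup>2 drift \<epsilon> x)\<^sup>2 prec \<epsilon> x / (2 \<epsilon>\<^sup>2)\<close> with \<open>\<delta> = y - x\<close>. Expanding the square
  leaves, up to numerical factors and powers of \<open>\<epsilon>\<close>, the coefficients \<open>prec\<close> of \<open>\<delta>\<^sup>2\<close>,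
  \<open>drift_prec\<close> of \<open>\<delta>\<close> and \<open>drift2_prec\<close> of 1, all of them functions of one point.
\<close>
definition curv :: "real \<Rightarrow> real \<Rightarrow> real" where "curv \<epsilon> x = \<epsilon>\<^sup>2 * D 2 x"

definition prec :: "real \<Rightarrow> real \<Rightarrow> real" where "prec \<epsilon> x = 1 / P (curv \<epsilon> x)"

definition log_sd :: "real \<Rightarrow> real \<Rightarrow> real" where "log_sd \<epsilon> x = ln (P (curv \<epsilon> x)) / 2"

definition drift :: "real \<Rightarrow> real \<Rightarrow> real" where
  "drift \<epsilon> x = drift1 (curv \<epsilon> x) * D 1 x - \<epsilon>\<^sup>2 / 3 * drift3 (curv \<epsilon> x) * D 3 x"

definition drift_prec :: "real \<Rightarrow> real \<Rightarrow> real" where "drift_prec \<epsilon> x = drift \<epsilon> x * prec \<epsilon> x"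
definition drift2_prec :: "real \<Rightarrow> real \<Rightarrow> real" where "drift2_prec \<epsilon> x = drift \<epsilon> x * drift_prec \<epsilon> x"

lemma prec_cong: "unif_cong 6 prec (\<lambda>\<epsilon> x. 1 + \<epsilon>\<^sup>2 * (- D 2 x / 6) + \<epsilon>^4 * ((1 / 36 - a4\<^sup>2 / 6) * D 2 x ^ 2))"
  using unif_O_substitute[OF inverse_P_expansion D2_bounded]
  unfolding unif_cong_def prec_def curv_def by (simp add: algebra_simps power_mult_distrib)

lemma log_sd_cong: "unif_cong 6 log_sd (\<lambda>\<epsilon> x. \<epsilon>\<^sup>2 * (D 2 x / 12) + \<epsilon>^4 * ((a4\<^sup>2 / 12 - 1 / 144) * D 2 x ^ 2))"
  using unif_O_substitute[OF ln_P_expansion D2_bounded]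
  unfolding unif_cong_def log_sd_def curv_def by (simp add: algebra_simps power_mult_distrib)

lemma drift_cong: "unif_cong 6 drift (\<lambda>\<epsilon> x. D 1 x / 2 + \<epsilon>\<^sup>2 * (- (D 3 x + D 1 x * D 2 x) / 24)
   + \<epsilon>^4 * (a1\<^sup>2 / 48 * D 1 x * D 2 x ^ 2 - a3 / 144 * D 2 x * D 3 x))"
proof -
  have 1: "unif_cong 6 (\<lambda>\<epsilon> x. drift1 (curv \<epsilon> x)) (\<lambda>\<epsilon> x. 1 / 2 - (\<epsilon>\<^sup>2 * D 2 x) / 24 + a1\<^sup>2 * (\<epsilon>\<^sup>2 * D 2 x)\<^sup>2 / 48)"
    using unif_O_substitute[OF drift1_expansion D2_bounded]
    unfolding unif_cong_def curv_def by simp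
  have 3: "unif_cong 4 (\<lambda>\<epsilon> x. drift3 (curv \<epsilon> x)) (\<lambda>\<epsilon> x. 1 / 8 + a3 * (\<epsilon>\<^sup>2 * D 2 x) / 48)"
    using unif_O_substitute[OF drift3_expansion D2_bounded]
    unfolding unif_cong_def curv_def by simp
  have p: "unif_O 2 (\<lambda>\<epsilon> x. \<epsilon>\<^sup>2 / 3 * D 3 x)"
    by (intro unif_O_mult0' unif_O_cdiv unif_O_eps D_growth) auto
  have d1: "unif_O 0 (\<lambda>\<epsilon> x. D 1 x)" by (rule D_growth) auto
  have "unif_cong 6 drift (\<lambda>\<epsilon> x. D 1 x * (1 / 2 - (\<epsilon>\<^sup>2 * D 2 x) / 24 + a1\<^sup>2 * (\<epsilon>\<^sup>2 * D 2 x)\<^sup>2 / 48)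
     - (\<epsilon>\<^sup>2 / 3 * D 3 x) * (1 / 8 + a3 * (\<epsilon>\<^sup>2 * D 2 x) / 48))"
    using unif_cong_diff[of 6, OF unif_cong_mult_O[OF 1 d1, simplified] unif_cong_mult_O[OF 3 p, simplified]]
    by (simp add: drift_def[abs_def] mult_ac)
  then show ?thesis by (simp add: algebra_simps power_mult_distrib diff_divide_distrib add_divide_distrib)
qed

lemma unif_O_eps0: "unif_O 0 (\<lambda>\<epsilon> _. \<epsilon> ^ k)"
  using unif_O_le[OF unif_O_eps, of 0 k] by simp

lemma drift_prec_cong: "unif_cong 6 drift_prec (\<lambda>\<epsilon> x. D 1 x / 2 + \<epsilon>\<^sup>2 * (- D 3 x / 24 - D 1 x * D 2 x / 8)
   + \<epsilon>^4 * ((a1\<^sup>2 / 48 + 1 / 48 - a4\<^sup>2 / 12) * (D 1 x * D 2 x ^ 2) + (1 - a3) / 144 * (D 2 x * D 3 x)))"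
proof -
  define p1 where "p1 x = - (D 3 x + D 1 x * D 2 x) / 24" for x
  define p2 where "p2 x = a1\<^sup>2 / 48 * D 1 x * D 2 x ^ 2 - a3 / 144 * D 2 x * D 3 x" for x
  define v1 where "v1 x = - D 2 x / 6" for x
  define v2 where "v2 x = (1 / 36 - a4\<^sup>2 / 6) * D 2 x ^ 2" for x
  note defs = p1_def p2_def v1_def v2_def
  have O: "unif_O 0 (\<lambda>\<epsilon> x. p1 x)" "unif_O 0 (\<lambda>\<epsilon> x. p2 x)" "unif_O 0 (\<lambda>\<epsilon> x. v1 x)" "unif_O 0 (\<lambda>\<epsilon> x. v2 x)" "unif_O 0 (\<lambda>\<epsilon> x. D 1 x)"
    unfolding defs by (intro unif_O_intros D_growth; simp)+
  have "unif_cong 6 drift_prec (\<lambda>\<epsilon> x. (D 1 x / 2 + \<epsilon>\<^sup>2 * p1 x + \<epsilon>^4 * p2 x) * (1 + \<epsilon>\<^sup>2 * v1 x + \<epsilon>^4 * v2 x))"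
    unfolding drift_prec_def[abs_def]
    by (intro unif_cong_mult drift_cong[folded defs] prec_cong[folded defs] unif_O_intros unif_O_eps0 O)
  moreover have "unif_cong 6 (\<lambda>\<epsilon> x. (D 1 x / 2 + \<epsilon>\<^sup>2 * p1 x + \<epsilon>^4 * p2 x) * (1 + \<epsilon>\<^sup>2 * v1 x + \<epsilon>^4 * v2 x))
     (\<lambda>\<epsilon> x. D 1 x / 2 + \<epsilon>\<^sup>2 * (p1 x + D 1 x / 2 * v1 x) + \<epsilon>^4 * (p2 x + p1 x * v1 x + D 1 x / 2 * v2 x))"
  proof -
    have "unif_O 6 (\<lambda>\<epsilon> x. \<epsilon>^6 * (p1 x * v2 x + p2 x * v1 x + \<epsilon>^2 * (p2 x * v2 x)))"
      by (intro unif_O_eps_mult unif_O_intros unif_O_eps0 O)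
    then show ?thesis unfolding unif_cong_def
      by (rule unif_O_cong[of _ _ 1]) (simp_all add: algebra_simps add_divide_distrib eval_nat_numeral)
  qed
  ultimately have "unif_cong 6 drift_prec (\<lambda>\<epsilon> x. D 1 x / 2 + \<epsilon>\<^sup>2 * (p1 x + D 1 x / 2 * v1 x) + \<epsilon>^4 * (p2 x + p1 x * v1 x + D 1 x / 2 * v2 x))"
    by (rule unif_cong_trans)
  moreover have "p1 x + D 1 x / 2 * v1 x = - D 3 x / 24 - D 1 x * D 2 x / 8" for x
    by (simp add: defs field_simps)
  moreover have "p2 x + p1 x * v1 x + D 1 x / 2 * v2 x =
    (a1\<^sup>2 / 48 + 1 / 48 - a4\<^sup>2 / 12) * (D 1 x * D 2 x ^ 2) + (1 - a3) / 144 * (D 2 x * D 3 x)" for x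
    by (simp add: defs field_simps power2_eq_square)
  ultimately show ?thesis by (simp only:)
qed

lemma drift2_prec_cong: "unif_cong 4 drift2_prec (\<lambda>\<epsilon> x. D 1 x ^ 2 / 4 + \<epsilon>\<^sup>2 * (- D 1 x * D 3 x / 24 - D 1 x ^ 2 * D 2 x / 12))"
proof -
  define p1 where "p1 x = - (D 3 x + D 1 x * D 2 x) / 24" for x
  define p2 where "p2 x = a1\<^sup>2 / 48 * D 1 x * D 2 x ^ 2 - a3 / 144 * D 2 x * D 3 x" for x
  define e1 where "e1 x = - D 3 x / 24 - D 1 x * D 2 x / 8" for x
  define e2 where "e2 x = (a1\<^sup>2 / 48 + 1 / 48 - a4\<^sup>2 / 12) * (D 1 x * D 2 x ^ 2) + (1 - a3) / 144 * (D 2 x * D 3 x)" for x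
  note defs = p1_def p2_def e1_def e2_def
  have O: "unif_O 0 (\<lambda>\<epsilon> x. p1 x)" "unif_O 0 (\<lambda>\<epsilon> x. p2 x)" "unif_O 0 (\<lambda>\<epsilon> x. e1 x)" "unif_O 0 (\<lambda>\<epsilon> x. e2 x)" "unif_O 0 (\<lambda>\<epsilon> x. D 1 x)"
    unfolding defs by (intro unif_O_intros D_growth; simp)+
  have "unif_cong 6 drift2_prec (\<lambda>\<epsilon> x. (D 1 x / 2 + \<epsilon>\<^sup>2 * p1 x + \<epsilon>^4 * p2 x) * (D 1 x / 2 + \<epsilon>\<^sup>2 * e1 x + \<epsilon>^4 * e2 x))"
    unfolding drift2_prec_def[abs_def]
    by (intro unif_cong_mult drift_cong[folded defs] drift_prec_cong[folded defs] unif_O_intros unif_O_eps0 O)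
  then have "unif_cong 4 drift2_prec (\<lambda>\<epsilon> x. (D 1 x / 2 + \<epsilon>\<^sup>2 * p1 x + \<epsilon>^4 * p2 x) * (D 1 x / 2 + \<epsilon>\<^sup>2 * e1 x + \<epsilon>^4 * e2 x))"
    by (rule unif_cong_le) simp
  moreover have "unif_cong 4 (\<lambda>\<epsilon> x. (D 1 x / 2 + \<epsilon>\<^sup>2 * p1 x + \<epsilon>^4 * p2 x) * (D 1 x / 2 + \<epsilon>\<^sup>2 * e1 x + \<epsilon>^4 * e2 x))
     (\<lambda>\<epsilon> x. D 1 x ^ 2 / 4 + \<epsilon>\<^sup>2 * (D 1 x / 2 * (p1 x + e1 x)))"
  proof -
    have "unif_O 4 (\<lambda>\<epsilon> x. \<epsilon>^4 * (p1 x * e1 x + D 1 x / 2 * (p2 x + e2 x) + \<epsilon>^2 * (p1 x * e2 x + p2 x * e1 x) + \<epsilon>^4 * (p2 x * e2 x)))"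
      by (intro unif_O_eps_mult unif_O_intros unif_O_eps0 O)
    then show ?thesis unfolding unif_cong_def
      by (rule unif_O_cong[of _ _ 1]) (simp_all add: algebra_simps add_divide_distrib eval_nat_numeral)
  qed
  ultimately have "unif_cong 4 drift2_prec (\<lambda>\<epsilon> x. D 1 x ^ 2 / 4 + \<epsilon>\<^sup>2 * (D 1 x / 2 * (p1 x + e1 x)))"
    by (rule unif_cong_trans)
  moreover have "D 1 x / 2 * (p1 x + e1 x) = - D 1 x * D 3 x / 24 - D 1 x ^ 2 * D 2 x / 12" for x
    by (simp add: defs field_simps power2_eq_square)
  ultimately show ?thesis by (simp only:)
qed


text \<open>
  The polynomial \<open>c\<close> of the statement, sorted by the derivatives of \<open>g\<close> that occur.
\<close>
definition c_poly :: "real \<Rightarrow> real \<Rightarrow> real" where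
  "c_poly x w = D 5 x * (w ^ 5 / 720 + w ^ 3 / 144) + D 4 x * D 1 x * (w ^ 3 + w) / 48
    + D 3 x * D 2 x * ((a3 / 72 - a4\<^sup>2 / 6 + 1 / 48) * w + (a4\<^sup>2 / 6 + 5 / 144) * w ^ 3)
    + D 3 x * D 1 x ^ 2 * w / 24
    + D 1 x * D 2 x ^ 2 * (a4\<^sup>2 / 6 + 1 / 24 - a1\<^sup>2 / 24) * w"

lemma gbO_c_eq: "gbO_c g a1 a3 a4 x w = c_poly x w"
proof -
  have "D 1 = deriv g" by (simp add: D_def)
  then show ?thesis
    by (simp add: gbO_c_def c_poly_def Let_def D_def field_simps)
qed

text \<open>
  The heart of the computation. The left-hand side is the sum of the truncated midpoint expansions of
  the five groups of terms of the log-ratio, with \<open>d = e * w\<close> for \<open>\<delta> = \<epsilon> * (\<delta> / \<epsilon>)\<close>. All terms of order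
  1 and 3 in \<open>e\<close> cancel and what remains is homogeneous of order 5. The coefficients of \<open>g'''\<close> at
  order 3, for instance, add up to \<open>1/24 + 1/12 - 1/8 = 0\<close> for \<open>d\<^sup>3\<close>.
\<close>
lemma order5_identity:
  fixes e w g1 g2 g3 g4 g5 A1 A3 A4 :: real
  defines "d \<equiv> e * w"
  shows "(g1 * d + g3 * d ^ 3 / 24 + g5 * d ^ 5 / 1920)
    - (e\<^sup>2 * (g3 / 12 * d + g5 / 12 * d ^ 3 / 24) + e ^ 4 * (2 * (A4\<^sup>2 / 12 - 1 / 144) * g2 * g3 * d))
    - w\<^sup>2 / 2 * (e\<^sup>2 * (- g3 / 6 * d + - g5 / 6 * d ^ 3 / 24) + e ^ 4 * (2 * (1 / 36 - A4\<^sup>2 / 6) * g2 * g3 * d))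
    - d * ((2 * (g1 / 2) + g3 / 2 * d\<^sup>2 / 4 + g5 / 2 * d ^ 4 / 192)
       + e\<^sup>2 * (2 * (- g3 / 24 - g1 * g2 / 8) + (- g5 / 24 - (3 * g2 * g3 + g1 * g4) / 8) * d\<^sup>2 / 4)
       + e ^ 4 * (2 * ((A1\<^sup>2 / 48 + 1 / 48 - A4\<^sup>2 / 12) * (g1 * g2 ^ 2) + (1 - A3) / 144 * (g2 * g3))))
    - e\<^sup>2 / 2 * ((g1 * g2 / 2 * d + (3 * g2 * g3 + g1 * g4) / 2 * d ^ 3 / 24)
       + e\<^sup>2 * ((- (g2 * g3 + g1 * g4) / 24 - (2 * g1 * g2 ^ 2 + g1 ^ 2 * g3) / 12) * d))
   = e ^ 5 * (g5 * (w ^ 5 / 720 + w ^ 3 / 144) + g4 * g1 * (w ^ 3 + w) / 48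
    + g3 * g2 * ((A3 / 72 - A4\<^sup>2 / 6 + 1 / 48) * w + (A4\<^sup>2 / 6 + 5 / 144) * w ^ 3)
    + g3 * g1 ^ 2 * w / 24
    + g1 * g2 ^ 2 * (A4\<^sup>2 / 6 + 1 / 24 - A1\<^sup>2 / 24) * w)"
  unfolding d_def by (simp add: field_simps eval_nat_numeral)

end

context gbO_target begin

text \<open>
  The log-ratio of one coordinate, grouped into differences and a sum of functions of one point, as
  the midpoint expansion requires. The reverse move has increment \<open>- \<delta>\<close>, so the linear terms in
  \<open>\<delta>\<close> add up, whereas all other terms are subtracted.
\<close>
definition log_ratio :: "real \<Rightarrow> real \<Rightarrow> real \<Rightarrow> real" where
  "log_ratio \<epsilon> x y = (g y - g x) - (log_sd \<epsilon> y - log_sd \<epsilon> x) - ((y - x) / \<epsilon>)\<^sup>2 / 2 * (prec \<epsilon> y - prec \<epsilon> x)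
     - (y - x) * (drift_prec \<epsilon> y + drift_prec \<epsilon> x) - \<epsilon>\<^sup>2 / 2 * (drift2_prec \<epsilon> y - drift2_prec \<epsilon> x)"

lemmas D_intros = unif_O_intros D_growth

context
  fixes X Y :: "real \<Rightarrow> 's::real_normed_vector \<Rightarrow> real"
  assumes X: "unif_O 0 X" and YX: "unif_O 1 (\<lambda>\<epsilon> z. Y \<epsilon> z - X \<epsilon> z)"
begin

abbreviation (input) "m \<epsilon> z \<equiv> (X \<epsilon> z + Y \<epsilon> z) / 2"
abbreviation (input) "\<delta> \<epsilon> z \<equiv> Y \<epsilon> z - X \<epsilon> z"

lemma X': "unif_O 0 (\<lambda>\<epsilon> z. norm (X \<epsilon> z))" and Y': "unif_O 0 (\<lambda>\<epsilon> z. norm (Y \<epsilon> z))"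
  using X unif_O_Y[OF X YX] by (auto intro: unif_O_abs)

lemma w_O: "unif_O 0 (\<lambda>\<epsilon> z. \<delta> \<epsilon> z / \<epsilon>)"
  using unif_O_divide_eps[of 0 1, simplified, OF YX[unfolded One_nat_def]] by simp

lemmas diffI = taylor_diff[OF X YX]
lemmas sumI = taylor_sum[OF X YX]

lemma g_diff: "unif_cong 6 (\<lambda>\<epsilon> z. g (Y \<epsilon> z) - g (X \<epsilon> z))
  (\<lambda>\<epsilon> z. D 1 (m \<epsilon> z) * \<delta> \<epsilon> z + D 3 (m \<epsilon> z) * \<delta> \<epsilon> z ^ 3 / 24 + D 5 (m \<epsilon> z) * \<delta> \<epsilon> z ^ 5 / 1920)"
proof -
  have "unif_O 0 (\<lambda>_. D 6)" by (rule D_growth) simp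
  then show ?thesis using diffI(3)[of 6 D] D_deriv by (simp add: D_0)
qed

lemma D2_diff:
  "unif_cong 4 (\<lambda>\<epsilon> z. D 2 (Y \<epsilon> z) * c - D 2 (X \<epsilon> z) * c)
    (\<lambda>\<epsilon> z. D 3 (m \<epsilon> z) * c * \<delta> \<epsilon> z + D 5 (m \<epsilon> z) * c * \<delta> \<epsilon> z ^ 3 / 24)"
proof -
  have O: "unif_O 0 (\<lambda>_ x. D (4 + 2) x * c)" by (intro D_intros) simp
  have d: "((\<lambda>x. D (k + 2) x * c) has_real_derivative D (Suc k + 2) x * c) (at x)" if "k < 4" for k x
    using D_deriv[of "k + 2" x] that by (simp add: DERIV_cmult_right)
  have *: "0 + 2 = (2::nat)" "1 + 2 = (3::nat)" "3 + 2 = (5::nat)" by auto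
  show ?thesis using diffI(2)[of 4 "\<lambda>k x. D (k + 2) x * c", OF d O refl] by (simp only: *)
qed

text \<open>
  Here and in the following lemmas \<open>?f k\<close> is the \<open>k\<close>-th derivative of the function to be expanded,
  for as many \<open>k\<close> as the required order demands.
\<close>
lemma D2_square_diff:
  "unif_cong 2 (\<lambda>\<epsilon> z. c * D 2 (Y \<epsilon> z) ^ 2 - c * D 2 (X \<epsilon> z) ^ 2)
    (\<lambda>\<epsilon> z. 2 * c * D 2 (m \<epsilon> z) * D 3 (m \<epsilon> z) * \<delta> \<epsilon> z)"
proof -
  let ?f = "\<lambda>(k::nat) x. if k = 0 then c * D 2 x ^ 2
     else if k = 1 then 2 * c * D 2 x * D 3 x
     else 2 * c * (D 3 x ^ 2 + D 2 x * D 4 x)"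
  have O: "unif_O 0 (\<lambda>_. ?f 2)" by (simp del: One_nat_def, intro D_intros) auto
  have d: "(?f k has_real_derivative ?f (Suc k) x) (at x)" if k: "k < 2" for k x
  proof -
    consider "k = 0" | "k = 1" using k by linarith
    then show ?thesis
      by cases (auto simp del: One_nat_def simp: algebra_simps power2_eq_square power3_eq_cube intro!: derivative_eq_intros D_derivs)
  qed
  show ?thesis using diffI(1)[of 2 ?f, OF d O] by simp
qed

lemma drift_prec_sum_0: "unif_cong 5 (\<lambda>\<epsilon> z. D 1 (Y \<epsilon> z) / 2 + D 1 (X \<epsilon> z) / 2)
  (\<lambda>\<epsilon> z. 2 * (D 1 (m \<epsilon> z) / 2) + D 3 (m \<epsilon> z) / 2 * \<delta> \<epsilon> z ^ 2 / 4 + D 5 (m \<epsilon> z) / 2 * \<delta> \<epsilon> z ^ 4 / 192)"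
proof -
  have "unif_O 0 (\<lambda>_ x. D 6 x / 2)" by (intro D_intros) simp
  then show ?thesis using sumI(3)[of 5 "\<lambda>k x. D (k + 1) x / 2"] D_deriv[of "_ + 1"]
    by (simp add: DERIV_cdivide)
qed

lemma drift_prec_sum_1: "unif_cong 3 (\<lambda>\<epsilon> z. (- D 3 (Y \<epsilon> z) / 24 - D 1 (Y \<epsilon> z) * D 2 (Y \<epsilon> z) / 8)
    + (- D 3 (X \<epsilon> z) / 24 - D 1 (X \<epsilon> z) * D 2 (X \<epsilon> z) / 8))
  (\<lambda>\<epsilon> z. 2 * (- D 3 (m \<epsilon> z) / 24 - D 1 (m \<epsilon> z) * D 2 (m \<epsilon> z) / 8)
    + (- D 5 (m \<epsilon> z) / 24 - (3 * D 2 (m \<epsilon> z) * D 3 (m \<epsilon> z) + D 1 (m \<epsilon> z) * D 4 (m \<epsilon> z)) / 8) * \<delta> \<epsilon> z ^ 2 / 4)"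
proof -
  let ?f = "\<lambda>(k::nat) x. if k = 0 then - D 3 x / 24 - D 1 x * D 2 x / 8
     else if k = 1 then - D 4 x / 24 - (D 2 x ^ 2 + D 1 x * D 3 x) / 8
     else if k = 2 then - D 5 x / 24 - (3 * D 2 x * D 3 x + D 1 x * D 4 x) / 8
     else - D 6 x / 24 - (3 * D 3 x ^ 2 + 4 * D 2 x * D 4 x + D 1 x * D 5 x) / 8"
  have O: "unif_O 0 (\<lambda>_. ?f 3)" by (simp del: One_nat_def, intro D_intros) auto
  have d: "(?f k has_real_derivative ?f (Suc k) x) (at x)" if k: "k < 3" for k x
  proof -
    consider "k = 0" | "k = 1" | "k = 2" using k by linarith
    then show ?thesis
      by cases (auto simp del: One_nat_def simp: algebra_simps power2_eq_square power3_eq_cube intro!: derivative_eq_intros D_derivs)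
  qed
  show ?thesis using sumI(2)[of 3 ?f, OF d O] by simp
qed

lemma drift_prec_sum_2: "unif_cong 1 (\<lambda>\<epsilon> z. (\<alpha> * (D 1 (Y \<epsilon> z) * D 2 (Y \<epsilon> z) ^ 2) + \<beta> * (D 2 (Y \<epsilon> z) * D 3 (Y \<epsilon> z)))
    + (\<alpha> * (D 1 (X \<epsilon> z) * D 2 (X \<epsilon> z) ^ 2) + \<beta> * (D 2 (X \<epsilon> z) * D 3 (X \<epsilon> z))))
  (\<lambda>\<epsilon> z. 2 * (\<alpha> * (D 1 (m \<epsilon> z) * D 2 (m \<epsilon> z) ^ 2) + \<beta> * (D 2 (m \<epsilon> z) * D 3 (m \<epsilon> z))))"
proof -
  let ?f = "\<lambda>(k::nat) x. if k = 0 then \<alpha> * (D 1 x * D 2 x ^ 2) + \<beta> * (D 2 x * D 3 x)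
     else \<alpha> * (D 2 x ^ 3 + 2 * D 1 x * D 2 x * D 3 x) + \<beta> * (D 3 x ^ 2 + D 2 x * D 4 x)"
  have O: "unif_O 0 (\<lambda>_. ?f 1)" by (simp del: One_nat_def, intro D_intros) auto
  have d: "(?f k has_real_derivative ?f (Suc k) x) (at x)" if k: "k < 1" for k x
    using k by (auto simp del: One_nat_def simp: algebra_simps power2_eq_square power3_eq_cube intro!: derivative_eq_intros D_derivs)
  show ?thesis using sumI(1)[of 1 ?f, OF d O] by simp
qed

lemma drift2_prec_diff_0: "unif_cong 4 (\<lambda>\<epsilon> z. D 1 (Y \<epsilon> z) ^ 2 / 4 - D 1 (X \<epsilon> z) ^ 2 / 4)
  (\<lambda>\<epsilon> z. D 1 (m \<epsilon> z) * D 2 (m \<epsilon> z) / 2 * \<delta> \<epsilon> z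
    + (3 * D 2 (m \<epsilon> z) * D 3 (m \<epsilon> z) + D 1 (m \<epsilon> z) * D 4 (m \<epsilon> z)) / 2 * \<delta> \<epsilon> z ^ 3 / 24)"
proof -
  let ?f = "\<lambda>(k::nat) x. if k = 0 then D 1 x ^ 2 / 4
     else if k = 1 then D 1 x * D 2 x / 2
     else if k = 2 then (D 2 x ^ 2 + D 1 x * D 3 x) / 2
     else if k = 3 then (3 * D 2 x * D 3 x + D 1 x * D 4 x) / 2
     else (3 * D 3 x ^ 2 + 4 * D 2 x * D 4 x + D 1 x * D 5 x) / 2"
  have O: "unif_O 0 (\<lambda>_. ?f 4)" by (simp del: One_nat_def, intro D_intros) auto
  have d: "(?f k has_real_derivative ?f (Suc k) x) (at x)" if k: "k < 4" for k x
  proof -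
    consider "k = 0" | "k = 1" | "k = 2" | "k = 3" using k by linarith
    then show ?thesis
      by cases (auto simp del: One_nat_def simp: algebra_simps power2_eq_square power3_eq_cube intro!: derivative_eq_intros D_derivs)
  qed
  show ?thesis using diffI(2)[of 4 ?f, OF d O] by simp
qed

lemma drift2_prec_diff_1: "unif_cong 2 (\<lambda>\<epsilon> z. (- D 1 (Y \<epsilon> z) * D 3 (Y \<epsilon> z) / 24 - D 1 (Y \<epsilon> z) ^ 2 * D 2 (Y \<epsilon> z) / 12)
   - (- D 1 (X \<epsilon> z) * D 3 (X \<epsilon> z) / 24 - D 1 (X \<epsilon> z) ^ 2 * D 2 (X \<epsilon> z) / 12))
  (\<lambda>\<epsilon> z. (- (D 2 (m \<epsilon> z) * D 3 (m \<epsilon> z) + D 1 (m \<epsilon> z) * D 4 (m \<epsilon> z)) / 24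
     - (2 * D 1 (m \<epsilon> z) * D 2 (m \<epsilon> z) ^ 2 + D 1 (m \<epsilon> z) ^ 2 * D 3 (m \<epsilon> z)) / 12) * \<delta> \<epsilon> z)"
proof -
  let ?f = "\<lambda>(k::nat) x. if k = 0 then - D 1 x * D 3 x / 24 - D 1 x ^ 2 * D 2 x / 12
     else if k = 1 then - (D 2 x * D 3 x + D 1 x * D 4 x) / 24 - (2 * D 1 x * D 2 x ^ 2 + D 1 x ^ 2 * D 3 x) / 12
     else - (D 3 x ^ 2 + 2 * D 2 x * D 4 x + D 1 x * D 5 x) / 24
       - (2 * D 2 x ^ 3 + 6 * D 1 x * D 2 x * D 3 x + D 1 x ^ 2 * D 4 x) / 12"
  have O: "unif_O 0 (\<lambda>_. ?f 2)" by (simp del: One_nat_def, intro D_intros) auto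
  have d: "(?f k has_real_derivative ?f (Suc k) x) (at x)" if k: "k < 2" for k x
  proof -
    consider "k = 0" | "k = 1" using k by linarith
    then show ?thesis
      by cases (auto simp del: One_nat_def simp: add_divide_distrib diff_divide_distrib algebra_simps power2_eq_square power3_eq_cube intro!: derivative_eq_intros D_derivs)
  qed
  show ?thesis using diffI(1)[of 2 ?f, OF d O] by simp
qed


text \<open>
  A term that carries a factor \<open>\<epsilon>\<^sup>p\<close> needs a Taylor expansion that is shorter by \<open>p\<close>, and the
  error in \<open>G\<close> itself does not have to be expanded at all.
\<close>
lemma two_scale_diff:
  assumes G: "unif_cong n G (\<lambda>\<epsilon> x. c0 + \<epsilon> ^ p * f x + \<epsilon> ^ q * h x)"
    and f: "unif_cong i (\<lambda>\<epsilon> z. f (Y \<epsilon> z) - f (X \<epsilon> z)) f'" and n: "n = p + i"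
    and h: "unif_cong j (\<lambda>\<epsilon> z. h (Y \<epsilon> z) - h (X \<epsilon> z)) h'" and n': "n = q + j"
  shows "unif_cong n (\<lambda>\<epsilon> z. G \<epsilon> (Y \<epsilon> z) - G \<epsilon> (X \<epsilon> z)) (\<lambda>\<epsilon> z. \<epsilon> ^ p * f' \<epsilon> z + \<epsilon> ^ q * h' \<epsilon> z)"
proof -
  have "unif_cong n (\<lambda>\<epsilon> z. \<epsilon> ^ p * (f (Y \<epsilon> z) - f (X \<epsilon> z)) + \<epsilon> ^ q * (h (Y \<epsilon> z) - h (X \<epsilon> z)))
    (\<lambda>\<epsilon> z. \<epsilon> ^ p * f' \<epsilon> z + \<epsilon> ^ q * h' \<epsilon> z)"
    by (rule unif_cong_add[OF unif_cong_mult_O[OF f unif_O_eps[of p], folded n]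
        unif_cong_mult_O[OF h unif_O_eps[of q], folded n']])
  moreover have "unif_cong n (\<lambda>\<epsilon> z. G \<epsilon> (Y \<epsilon> z) - G \<epsilon> (X \<epsilon> z))
     (\<lambda>\<epsilon> z. \<epsilon> ^ p * (f (Y \<epsilon> z) - f (X \<epsilon> z)) + \<epsilon> ^ q * (h (Y \<epsilon> z) - h (X \<epsilon> z)))"
    using unif_cong_diff[OF unif_cong_compose[OF G Y'] unif_cong_compose[OF G X']]
    by (simp add: algebra_simps)
  ultimately show ?thesis by (rule unif_cong_trans[rotated])
qed

lemma log_sd_diff: "unif_cong 6 (\<lambda>\<epsilon> z. log_sd \<epsilon> (Y \<epsilon> z) - log_sd \<epsilon> (X \<epsilon> z))
  (\<lambda>\<epsilon> z. \<epsilon> ^ 2 * (D 3 (m \<epsilon> z) * (1 / 12) * \<delta> \<epsilon> z + D 5 (m \<epsilon> z) * (1 / 12) * \<delta> \<epsilon> z ^ 3 / 24)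
    + \<epsilon> ^ 4 * (2 * (a4\<^sup>2 / 12 - 1 / 144) * D 2 (m \<epsilon> z) * D 3 (m \<epsilon> z) * \<delta> \<epsilon> z))"
proof (rule two_scale_diff[OF _ D2_diff _ D2_square_diff])
  show "unif_cong 6 log_sd (\<lambda>\<epsilon> x. 0 + \<epsilon> ^ 2 * (D 2 x * (1 / 12)) + \<epsilon> ^ 4 * ((a4\<^sup>2 / 12 - 1 / 144) * D 2 x ^ 2))"
    using log_sd_cong by simp
qed simp_all

lemma prec_diff: "unif_cong 6 (\<lambda>\<epsilon> z. prec \<epsilon> (Y \<epsilon> z) - prec \<epsilon> (X \<epsilon> z))
  (\<lambda>\<epsilon> z. \<epsilon> ^ 2 * (D 3 (m \<epsilon> z) * (- 1 / 6) * \<delta> \<epsilon> z + D 5 (m \<epsilon> z) * (- 1 / 6) * \<delta> \<epsilon> z ^ 3 / 24)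
    + \<epsilon> ^ 4 * (2 * (1 / 36 - a4\<^sup>2 / 6) * D 2 (m \<epsilon> z) * D 3 (m \<epsilon> z) * \<delta> \<epsilon> z))"
proof (rule two_scale_diff[OF _ D2_diff _ D2_square_diff])
  show "unif_cong 6 prec (\<lambda>\<epsilon> x. 1 + \<epsilon> ^ 2 * (D 2 x * (- 1 / 6)) + \<epsilon> ^ 4 * ((1 / 36 - a4\<^sup>2 / 6) * D 2 x ^ 2))"
    using prec_cong by simp
qed simp_all

lemma drift2_prec_diff: "unif_cong 4 (\<lambda>\<epsilon> z. drift2_prec \<epsilon> (Y \<epsilon> z) - drift2_prec \<epsilon> (X \<epsilon> z))
  (\<lambda>\<epsilon> z. \<epsilon> ^ 0 * (D 1 (m \<epsilon> z) * D 2 (m \<epsilon> z) / 2 * \<delta> \<epsilon> z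
    + (3 * D 2 (m \<epsilon> z) * D 3 (m \<epsilon> z) + D 1 (m \<epsilon> z) * D 4 (m \<epsilon> z)) / 2 * \<delta> \<epsilon> z ^ 3 / 24)
   + \<epsilon> ^ 2 * ((- (D 2 (m \<epsilon> z) * D 3 (m \<epsilon> z) + D 1 (m \<epsilon> z) * D 4 (m \<epsilon> z)) / 24
     - (2 * D 1 (m \<epsilon> z) * D 2 (m \<epsilon> z) ^ 2 + D 1 (m \<epsilon> z) ^ 2 * D 3 (m \<epsilon> z)) / 12) * \<delta> \<epsilon> z))"
proof (rule two_scale_diff[OF _ drift2_prec_diff_0 _ drift2_prec_diff_1])
  show "unif_cong 4 drift2_prec (\<lambda>\<epsilon> x. 0 + \<epsilon> ^ 0 * (D 1 x ^ 2 / 4) + \<epsilon> ^ 2 * (- D 1 x * D 3 x / 24 - D 1 x ^ 2 * D 2 x / 12))"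
    using drift2_prec_cong by (simp del: One_nat_def)
qed simp_all

lemma drift_prec_sum: "unif_cong 5 (\<lambda>\<epsilon> z. drift_prec \<epsilon> (Y \<epsilon> z) + drift_prec \<epsilon> (X \<epsilon> z))
  (\<lambda>\<epsilon> z. (2 * (D 1 (m \<epsilon> z) / 2) + D 3 (m \<epsilon> z) / 2 * \<delta> \<epsilon> z ^ 2 / 4 + D 5 (m \<epsilon> z) / 2 * \<delta> \<epsilon> z ^ 4 / 192)
    + \<epsilon> ^ 2 * (2 * (- D 3 (m \<epsilon> z) / 24 - D 1 (m \<epsilon> z) * D 2 (m \<epsilon> z) / 8)
    + (- D 5 (m \<epsilon> z) / 24 - (3 * D 2 (m \<epsilon> z) * D 3 (m \<epsilon> z) + D 1 (m \<epsilon> z) * D 4 (m \<epsilon> z)) / 8) * \<delta> \<epsilon> z ^ 2 / 4)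
    + \<epsilon> ^ 4 * (2 * ((a1\<^sup>2 / 48 + 1 / 48 - a4\<^sup>2 / 12) * (D 1 (m \<epsilon> z) * D 2 (m \<epsilon> z) ^ 2)
        + (1 - a3) / 144 * (D 2 (m \<epsilon> z) * D 3 (m \<epsilon> z)))))" (is "unif_cong 5 _ ?R")
proof -
  let ?e1 = "\<lambda>x. - D 3 x / 24 - D 1 x * D 2 x / 8"
  let ?e2 = "\<lambda>x. (a1\<^sup>2 / 48 + 1 / 48 - a4\<^sup>2 / 12) * (D 1 x * D 2 x ^ 2) + (1 - a3) / 144 * (D 2 x * D 3 x)"
  have five: "2 + 3 = (5::nat)" "4 + 1 = (5::nat)" by auto
  have "unif_cong 5 (\<lambda>\<epsilon> z. (D 1 (Y \<epsilon> z) / 2 + D 1 (X \<epsilon> z) / 2)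
     + \<epsilon> ^ 2 * (?e1 (Y \<epsilon> z) + ?e1 (X \<epsilon> z)) + \<epsilon> ^ 4 * (?e2 (Y \<epsilon> z) + ?e2 (X \<epsilon> z))) ?R"
    by (rule unif_cong_add[OF unif_cong_add[OF drift_prec_sum_0
        unif_cong_mult_O[OF drift_prec_sum_1 unif_O_eps[of 2], unfolded five]]
        unif_cong_mult_O[OF drift_prec_sum_2 unif_O_eps[of 4], unfolded five]])
  moreover have "unif_cong 5 (\<lambda>\<epsilon> z. drift_prec \<epsilon> (Y \<epsilon> z) + drift_prec \<epsilon> (X \<epsilon> z))
    (\<lambda>\<epsilon> z. (D 1 (Y \<epsilon> z) / 2 + D 1 (X \<epsilon> z) / 2)
     + \<epsilon> ^ 2 * (?e1 (Y \<epsilon> z) + ?e1 (X \<epsilon> z)) + \<epsilon> ^ 4 * (?e2 (Y \<epsilon> z) + ?e2 (X \<epsilon> z)))"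
    using unif_cong_le[OF unif_cong_add[OF unif_cong_compose[OF drift_prec_cong Y'] unif_cong_compose[OF drift_prec_cong X']], of 5]
    by (simp add: algebra_simps)
  ultimately show ?thesis by (rule unif_cong_trans[rotated])
qed

text \<open>
  The term with \<open>prec\<close> carries the factor \<open>(\<delta> / \<epsilon>)\<^sup>2\<close> of order 0, so \<open>prec\<close> is
  needed to order 6; the factors \<open>\<delta>\<close> and \<open>\<epsilon>\<^sup>2\<close> of the last two terms reduce the required orders to
  5 and 4.
\<close>
lemma log_ratio_midpoint: "unif_cong 6 (\<lambda>\<epsilon> z. log_ratio \<epsilon> (X \<epsilon> z) (Y \<epsilon> z))
   (\<lambda>\<epsilon> z. \<epsilon> ^ 5 * c_poly (m \<epsilon> z) (\<delta> \<epsilon> z / \<epsilon>))"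
proof -
  have w: "unif_O 0 (\<lambda>\<epsilon> z. (\<delta> \<epsilon> z / \<epsilon>)\<^sup>2 / 2)" by (intro unif_O_intros w_O)
  have e: "unif_O 2 (\<lambda>\<epsilon> (z::'s). \<epsilon>\<^sup>2 / 2)" by (intro unif_O_cdiv unif_O_eps)
  note 1 = unif_cong_mult_O[OF prec_diff w, simplified add_0]
  note 2 = unif_cong_mult_O[OF drift_prec_sum YX]
  note 3 = unif_cong_mult_O[OF drift2_prec_diff e]
  have six: "1 + 5 = (6::nat)" "2 + 4 = (6::nat)" by auto
  note all = unif_cong_diff[OF unif_cong_diff[OF unif_cong_diff[OF unif_cong_diff[OF g_diff log_sd_diff] 1] 2[unfolded six]] 3[unfolded six]]
  show ?thesis
    unfolding unif_cong_def
  proof (rule unif_O_cong[OF all[unfolded unif_cong_def], of 1])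
    fix \<epsilon> :: real and z assume \<epsilon>: "0 < \<epsilon>" "\<epsilon> \<le> 1"
    define w where "w = \<delta> \<epsilon> z / \<epsilon>"
    have d: "\<delta> \<epsilon> z = \<epsilon> * w" using \<epsilon> by (simp add: w_def)
    show "log_ratio \<epsilon> (X \<epsilon> z) (Y \<epsilon> z) - \<epsilon> ^ 5 * c_poly (m \<epsilon> z) (\<delta> \<epsilon> z / \<epsilon>) = (g (Y \<epsilon> z) - g (X \<epsilon> z) - (log_sd \<epsilon> (Y \<epsilon> z) - log_sd \<epsilon> (X \<epsilon> z)) -
         (\<delta> \<epsilon> z / \<epsilon>)\<^sup>2 / 2 * (prec \<epsilon> (Y \<epsilon> z) - prec \<epsilon> (X \<epsilon> z)) - \<delta> \<epsilon> z * (drift_prec \<epsilon> (Y \<epsilon> z) + drift_prec \<epsilon> (X \<epsilon> z)) - \<epsilon>\<^sup>2 / 2 * (drift2_prec \<epsilon> (Y \<epsilon> z) - drift2_prec \<epsilon> (X \<epsilon> z))) - (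
   (D 1 (m \<epsilon> z) * \<delta> \<epsilon> z + D 3 (m \<epsilon> z) * \<delta> \<epsilon> z ^ 3 / 24 + D 5 (m \<epsilon> z) * \<delta> \<epsilon> z ^ 5 / 1920)
   - (\<epsilon> ^ 2 * (D 3 (m \<epsilon> z) * (1 / 12) * \<delta> \<epsilon> z + D 5 (m \<epsilon> z) * (1 / 12) * \<delta> \<epsilon> z ^ 3 / 24)
    + \<epsilon> ^ 4 * (2 * (a4\<^sup>2 / 12 - 1 / 144) * D 2 (m \<epsilon> z) * D 3 (m \<epsilon> z) * \<delta> \<epsilon> z))
   - (\<delta> \<epsilon> z / \<epsilon>)\<^sup>2 / 2 * (\<epsilon> ^ 2 * (D 3 (m \<epsilon> z) * (- 1 / 6) * \<delta> \<epsilon> z + D 5 (m \<epsilon> z) * (- 1 / 6) * \<delta> \<epsilon> z ^ 3 / 24)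
    + \<epsilon> ^ 4 * (2 * (1 / 36 - a4\<^sup>2 / 6) * D 2 (m \<epsilon> z) * D 3 (m \<epsilon> z) * \<delta> \<epsilon> z))
   - \<delta> \<epsilon> z * ((2 * (D 1 (m \<epsilon> z) / 2) + D 3 (m \<epsilon> z) / 2 * \<delta> \<epsilon> z ^ 2 / 4 + D 5 (m \<epsilon> z) / 2 * \<delta> \<epsilon> z ^ 4 / 192)
    + \<epsilon> ^ 2 * (2 * (- D 3 (m \<epsilon> z) / 24 - D 1 (m \<epsilon> z) * D 2 (m \<epsilon> z) / 8)
    + (- D 5 (m \<epsilon> z) / 24 - (3 * D 2 (m \<epsilon> z) * D 3 (m \<epsilon> z) + D 1 (m \<epsilon> z) * D 4 (m \<epsilon> z)) / 8) * \<delta> \<epsilon> z ^ 2 / 4)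
    + \<epsilon> ^ 4 * (2 * ((a1\<^sup>2 / 48 + 1 / 48 - a4\<^sup>2 / 12) * (D 1 (m \<epsilon> z) * D 2 (m \<epsilon> z) ^ 2)
        + (1 - a3) / 144 * (D 2 (m \<epsilon> z) * D 3 (m \<epsilon> z)))))
   - \<epsilon>\<^sup>2 / 2 * (\<epsilon> ^ 0 * (D 1 (m \<epsilon> z) * D 2 (m \<epsilon> z) / 2 * \<delta> \<epsilon> z
    + (3 * D 2 (m \<epsilon> z) * D 3 (m \<epsilon> z) + D 1 (m \<epsilon> z) * D 4 (m \<epsilon> z)) / 2 * \<delta> \<epsilon> z ^ 3 / 24)
   + \<epsilon> ^ 2 * ((- (D 2 (m \<epsilon> z) * D 3 (m \<epsilon> z) + D 1 (m \<epsilon> z) * D 4 (m \<epsilon> z)) / 24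
     - (2 * D 1 (m \<epsilon> z) * D 2 (m \<epsilon> z) ^ 2 + D 1 (m \<epsilon> z) ^ 2 * D 3 (m \<epsilon> z)) / 12) * \<delta> \<epsilon> z)))"
      unfolding c_poly_def order5_identity[symmetric] log_ratio_def w_def[symmetric] d
      by (simp del: One_nat_def add: mult_ac)
  qed simp
qed

end

text \<open>
  The proposed position as a function of the current position \<open>fst z\<close> and the Gaussian \<open>snd z\<close>.
\<close>
definition proposal :: "real \<Rightarrow> real \<times> real \<Rightarrow> real" where
  "proposal \<epsilon> z = fst z + \<epsilon>\<^sup>2 * drift \<epsilon> (fst z) + \<epsilon> * sqrt (P (curv \<epsilon> (fst z))) * snd z"

lemma unif_O_fst: "unif_O 0 (\<lambda>\<epsilon> z :: real \<times> real. fst z)"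
  and unif_O_snd: "unif_O 0 (\<lambda>\<epsilon> z :: real \<times> real. snd z)"
  using norm_fst_le[of "_ :: real" "_ :: real"] norm_snd_le[of "_ :: real" "_ :: real"]
  by (auto intro!: unif_O_mono[OF unif_O_norm, of 1])

lemma unif_O_norm_fst: "unif_O 0 (\<lambda>\<epsilon> z :: real \<times> real. norm (fst z))"
  using unif_O_abs[OF unif_O_fst] by simp

lemma drift_O: "unif_O 0 drift"
  by (rule unif_O_congD[OF drift_cong]) (intro D_intros unif_O_eps0; simp)

lemma scale_cong: "unif_cong 2 (\<lambda>\<epsilon> x. sqrt (P (curv \<epsilon> x))) (\<lambda>\<epsilon> x. 1)"
  using unif_O_substitute[OF sqrt_P_bigo D2_bounded] by (simp add: unif_cong_def curv_def)

lemma increment_cong: "unif_cong 1 (\<lambda>\<epsilon> z. (proposal \<epsilon> z - fst z) / \<epsilon>) (\<lambda>\<epsilon> z. snd z)"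
proof -
  have "unif_O 1 (\<lambda>\<epsilon> z. (sqrt (P (curv \<epsilon> (fst z))) - 1) * snd z)"
    using unif_O_compose[OF scale_cong[unfolded unif_cong_def] unif_O_norm_fst]
    by (intro unif_O_mult0' unif_O_snd) (rule unif_O_le[of 2], simp_all)
  moreover have "unif_O 1 (\<lambda>\<epsilon> z :: real \<times> real. \<epsilon> ^ 1 * drift \<epsilon> (fst z))"
    by (intro unif_O_eps_mult unif_O_compose[OF drift_O] unif_O_norm_fst)
  ultimately have "unif_O 1 (\<lambda>\<epsilon> z. (sqrt (P (curv \<epsilon> (fst z))) - 1) * snd z + \<epsilon> ^ 1 * drift \<epsilon> (fst z))"
    by (rule unif_O_add)
  then show ?thesis unfolding unif_cong_def
    by (rule unif_O_cong[of _ _ 1]) (auto simp: proposal_def field_simps power2_eq_square)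
qed

lemma increment_O: "unif_O 1 (\<lambda>\<epsilon> z. proposal \<epsilon> z - fst z)"
proof -
  have "unif_O 1 (\<lambda>\<epsilon> z. \<epsilon> ^ 1 * ((proposal \<epsilon> z - fst z) / \<epsilon>))"
    by (intro unif_O_eps_mult unif_O_congD[OF increment_cong] unif_O_snd)
  then show ?thesis by (rule unif_O_cong[of _ _ 1]) auto
qed

lemma D_mid_cong:
  assumes "1 \<le> i" "i < 9"
  shows "unif_cong 1 (\<lambda>\<epsilon> z. D i ((fst z + proposal \<epsilon> z) / 2)) (\<lambda>\<epsilon> z. D i (fst z))"
proof -
  have d: "unif_O 1 (\<lambda>\<epsilon> z. (proposal \<epsilon> z - fst z) / 2)" by (intro unif_O_cdiv increment_O)
  have "unif_O 1 (\<lambda>\<epsilon> z. D (i + 0) (fst z + (proposal \<epsilon> z - fst z) / 2)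
     - (\<Sum>k<1. D (i + k) (fst z) / fact k * ((proposal \<epsilon> z - fst z) / 2) ^ k))"
    by (rule unif_O_taylor[OF _ _ unif_O_fst d]) (use assms in \<open>auto intro!: D_growth D_deriv\<close>)
  moreover have "x + (y - x) / 2 = (x + y) / 2" for x y :: real by (simp add: field_simps)
  ultimately show ?thesis by (simp add: unif_cong_def)
qed

text \<open>
  The midpoint differs from \<open>x\<close>, and \<open>\<delta> / \<epsilon>\<close> from \<open>\<xi>\<close>, by \<open>O(\<epsilon>)\<close>. The leading coefficient already
  carries \<open>\<epsilon>\<^sup>5\<close>, so both replacements are absorbed in the error.
\<close>
theorem log_ratio_expansion:
  "unif_cong 6 (\<lambda>\<epsilon> z. log_ratio \<epsilon> (fst z) (proposal \<epsilon> z)) (\<lambda>\<epsilon> z. \<epsilon> ^ 5 * c_poly (fst z) (snd z))"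
proof -
  have DO: "unif_O 0 (\<lambda>\<epsilon> z :: real \<times> real. D i (fst z))" if "1 \<le> i" "i < 9" for i
    using that by (intro unif_O_compose_real[OF _ unif_O_fst] D_growth) auto
  have "unif_cong 1 (\<lambda>\<epsilon> z. c_poly ((fst z + proposal \<epsilon> z) / 2) ((proposal \<epsilon> z - fst z) / \<epsilon>)) (\<lambda>\<epsilon> z. c_poly (fst z) (snd z))"
    unfolding c_poly_def
    by (intro unif_cong_add unif_cong_mult unif_cong_power unif_cong_cdiv unif_cong_const D_mid_cong increment_cong
        unif_O_intros DO unif_O_snd; simp)
  then have "unif_cong (5 + 1) (\<lambda>\<epsilon> z. \<epsilon> ^ 5 * c_poly ((fst z + proposal \<epsilon> z) / 2) ((proposal \<epsilon> z - fst z) / \<epsilon>))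
     (\<lambda>\<epsilon> z. \<epsilon> ^ 5 * c_poly (fst z) (snd z))"
    by (rule unif_cong_mult_O[OF _ unif_O_eps])
  moreover note log_ratio_midpoint[OF unif_O_fst increment_O]
  ultimately show ?thesis using unif_cong_trans[of 6] by simp
qed

lemma c_poly_O: "unif_O 0 (\<lambda>\<epsilon> z. c_poly (fst z) (snd z))"
proof -
  have DO: "unif_O 0 (\<lambda>\<epsilon> z :: real \<times> real. D i (fst z))" if "1 \<le> i" "i < 9" for i
    using that by (intro unif_O_compose_real[OF _ unif_O_fst] D_growth) auto
  show ?thesis unfolding c_poly_def by (intro unif_O_intros DO unif_O_snd; simp)
qed

end

section \<open>Moments of the log-ratio and the acceptance rate\<close>

lemma integrable_binomial_moments:
  fixes f :: "real \<Rightarrow> real"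
  assumes mom: "\<And>k :: nat. integrable lborel (\<lambda>t. f t * t ^ k)" and f: "\<And>t. f t \<ge> 0"
  shows "integrable lborel (\<lambda>t. f t * (1 + \<bar>t\<bar>) ^ n)"
proof -
  have "integrable lborel (\<lambda>t. \<Sum>k\<le>n. real (n choose k) * (f t * \<bar>t\<bar> ^ k))"
  proof (intro Bochner_Integration.integrable_sum integrable_mult_right)
    fix k
    show "integrable lborel (\<lambda>t. f t * \<bar>t\<bar> ^ k)"
      using integrable_abs[OF mom[of k]] f by (simp add: abs_mult power_abs)
  qed
  moreover have "f t * (1 + \<bar>t\<bar>) ^ n = (\<Sum>k\<le>n. real (n choose k) * (f t * \<bar>t\<bar> ^ k))" for t
    using binomial_ring[of "\<bar>t\<bar>" 1 n] by (simp add: sum_distrib_left mult_ac add.commute)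
  ultimately show ?thesis by simp
qed

context gbO_params begin

lemma measurable_exprel1[measurable]: "exprel1 \<in> borel_measurable borel"
  unfolding exprel1_def[abs_def] by measurable

lemma measurable_exprel2[measurable]: "exprel2 \<in> borel_measurable borel"
  unfolding exprel2_def[abs_def] by measurable

lemma measurable_P[measurable]: "P \<in> borel_measurable borel"
  unfolding P_eq[abs_def] by measurable

lemma measurable_drift1[measurable]: "drift1 \<in> borel_measurable borel"
  unfolding drift1_def[abs_def] by measurable

lemma measurable_drift3[measurable]: "drift3 \<in> borel_measurable borel"
  unfolding drift3_def[abs_def] by measurable

end

locale gbO_chain = gbO_target +
  assumes g_moments: "\<And>k :: nat. integrable lborel (\<lambda>t. t ^ k * exp (g t))"
begin

lemma measurable_D: "i < 10 \<Longrightarrow> D i \<in> borel_measurable borel"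
  by (intro borel_measurable_continuous_onI D_cont)

lemma measurable_g[measurable]: "g \<in> borel_measurable borel"
  using measurable_D[of 0] by (simp add: D_0)

lemma measurable_D_1_5[measurable]: "D 1 \<in> borel_measurable borel" "D 2 \<in> borel_measurable borel"
  "D 3 \<in> borel_measurable borel" "D 4 \<in> borel_measurable borel" "D 5 \<in> borel_measurable borel"
  by (rule measurable_D; simp)+

definition prop_mean :: "real \<Rightarrow> real \<Rightarrow> real" where "prop_mean \<epsilon> x = x + \<epsilon>\<^sup>2 * drift \<epsilon> x"
definition prop_sd :: "real \<Rightarrow> real \<Rightarrow> real" where "prop_sd \<epsilon> x = \<epsilon> * sqrt (P (curv \<epsilon> x))"

lemma proposal_eq: "proposal \<epsilon> (x, \<xi>) = prop_mean \<epsilon> x + prop_sd \<epsilon> x * \<xi>"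
  by (simp add: proposal_def prop_mean_def prop_sd_def)

lemma prop_sd_pos: "\<epsilon> > 0 \<Longrightarrow> prop_sd \<epsilon> x > 0"
  using profile_pos by (simp add: prop_sd_def)

lemma measurable_curv[measurable]: "curv \<epsilon> \<in> borel_measurable borel"
  unfolding curv_def[abs_def] by measurable

lemma measurable_drift[measurable]: "drift \<epsilon> \<in> borel_measurable borel"
  unfolding drift_def[abs_def] by measurable

lemma measurable_prop_mean[measurable]: "prop_mean \<epsilon> \<in> borel_measurable borel"
  unfolding prop_mean_def[abs_def] by measurable

lemma measurable_prop_sd[measurable]: "prop_sd \<epsilon> \<in> borel_measurable borel"
  unfolding prop_sd_def[abs_def] by measurable

lemma measurable_proposal[measurable]: "proposal \<epsilon> \<in> borel_measurable (borel \<Otimes>\<^sub>M borel)"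
  unfolding proposal_def[abs_def] by measurable

lemma gbO_mean_eq: "\<epsilon> > 0 \<Longrightarrow> gbO_mean g a1 a2 a3 (\<epsilon>\<^sup>2) x = prop_mean \<epsilon> x"
proof -
  assume e: "\<epsilon> > 0"
  have D1: "deriv g = D 1" by (simp add: D_def)
  have "gbO_mean g a1 a2 a3 h x = x + h * (drift1 (h * D 2 x) * D 1 x - h / 3 * drift3 (h * D 2 x) * D 3 x)"
    if "h > 0" for h
    using that a_pos unfolding gbO_mean_def D1 D_def[symmetric] drift1_def drift3_def
    by (simp del: One_nat_def add: T1_eq T2_eq T3_eq) (simp add: field_simps power2_eq_square)
  from this[of "\<epsilon>\<^sup>2"] show ?thesis using e by (simp del: One_nat_def add: prop_mean_def drift_def curv_def)
qed

lemma gbO_sd_eq: "\<epsilon> > 0 \<Longrightarrow> gbO_sd g a4 a5 (\<epsilon>\<^sup>2) x = prop_sd \<epsilon> x"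
proof -
  assume e: "\<epsilon> > 0"
  have "T1 (D 2 x) (2 * h) a4 + (a4 / 2 - 1 / 6) * T2 (D 2 x) (2 * h) a5 = h * P (h * D 2 x)"
    if "h > 0" for h
    using that a_pos by (simp add: T1_eq T2_eq P_eq) (simp add: field_simps power2_eq_square)
  from this[of "\<epsilon>\<^sup>2"] show ?thesis
    using e by (simp add: gbO_sd_def D_def[symmetric] prop_sd_def curv_def real_sqrt_mult)
qed

definition Z :: real where "Z = (LINT u|lborel. exp (g u))"

lemma integrable_exp_g: "integrable lborel (\<lambda>t. exp (g t))"
  using g_moments[of 0] by simp

lemma Z_pos: "Z > 0"
proof -
  have "Z \<noteq> 0"
  proof
    assume "Z = 0"
    then have "AE t in lborel. exp (g t) = 0"
      unfolding Z_def by (subst (asm) integral_nonneg_eq_0_iff_AE) (auto intro: integrable_exp_g)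
    then have "AE t in (lborel :: real measure). False" by (rule AE_mp) simp
    then show False by (simp add: trivial_limit_def[symmetric] ae_filter_eq_bot_iff)
  qed
  moreover have "Z \<ge> 0" unfolding Z_def by (intro integral_nonneg_AE) auto
  ultimately show ?thesis by simp
qed

lemma target1_eq: "target1 g t = exp (g t) / Z" by (simp add: target1_def Z_def)

lemma target1_pos: "target1 g t > 0" using Z_pos by (simp add: target1_eq)

lemma measurable_target1[measurable]: "target1 g \<in> borel_measurable borel"
  unfolding target1_eq[abs_def] by measurable

abbreviation \<pi>1 :: "real measure" where "\<pi>1 \<equiv> density lborel (\<lambda>x. ennreal (target1 g x))"

abbreviation \<nu> :: "(real \<times> real) measure" where "\<nu> \<equiv> \<pi>1 \<Otimes>\<^sub>M std_normal_distribution"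

lemma prob_space_\<pi>1: "prob_space \<pi>1"
proof
  have "emeasure \<pi>1 (space \<pi>1) = (\<integral>\<^sup>+x. ennreal (target1 g x) \<partial>lborel)"
    by (simp add: emeasure_density)
  also have "\<dots> = ennreal (LINT x|lborel. target1 g x)"
    using target1_pos integrable_exp_g by (intro nn_integral_eq_integral) (auto simp: target1_eq less_imp_le Z_pos)
  also have "(LINT x|lborel. target1 g x) = 1"
    using Z_pos by (simp add: target1_eq Z_def[symmetric])
  finally show "emeasure \<pi>1 (space \<pi>1) = 1" by simp
qed

sublocale \<pi>1: prob_space \<pi>1 by (rule prob_space_\<pi>1)
sublocale std: prob_space std_normal_distribution
  using real_dist_normal_dist by (simp add: real_distribution_def)
sublocale \<nu>: pair_prob_space \<pi>1 std_normal_distribution ..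

lemma integrable_\<pi>1_power: "integrable \<pi>1 (\<lambda>x. (1 + \<bar>x\<bar>) ^ n)"
proof -
  have "integrable lborel (\<lambda>t. exp (g t) * (1 + \<bar>t\<bar>) ^ n)"
    using g_moments by (intro integrable_binomial_moments) (auto simp: mult.commute)
  then have "integrable lborel (\<lambda>t. exp (g t) * (1 + \<bar>t\<bar>) ^ n / Z)" by simp
  then show ?thesis
    using target1_pos by (subst integrable_density) (auto simp: less_imp_le target1_eq)
qed

lemma integrable_std_power: "integrable std_normal_distribution (\<lambda>x. (1 + \<bar>x\<bar>) ^ n)"
proof -
  have "integrable lborel (\<lambda>t. std_normal_density t * (1 + \<bar>t\<bar>) ^ n)"
    by (intro integrable_binomial_moments integrable_std_normal_moment) auto
  then show ?thesis by (subst integrable_density) auto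
qed

lemma integrable_\<nu>_power: "integrable \<nu> (\<lambda>z. (1 + norm z) ^ n)"
proof (rule Bochner_Integration.integrable_bound)
  show "integrable \<nu> (\<lambda>z. (1 + \<bar>fst z\<bar>) ^ n * (1 + \<bar>snd z\<bar>) ^ n)"
  proof (rule \<nu>.Fubini_integrable)
    show "integrable \<pi>1 (\<lambda>x. LINT y|std_normal_distribution. norm ((1 + \<bar>fst (x, y)\<bar>) ^ n * (1 + \<bar>snd (x, y)\<bar>) ^ n))"
      using integrable_\<pi>1_power[of n] by (simp add: abs_mult)
    show "AE x in \<pi>1. integrable std_normal_distribution (\<lambda>y. (1 + \<bar>fst (x, y)\<bar>) ^ n * (1 + \<bar>snd (x, y)\<bar>) ^ n)"
      using integrable_std_power[of n] by simp
  qed measurable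
  show "AE z in \<nu>. norm ((1 + norm z) ^ n) \<le> norm ((1 + \<bar>fst z\<bar>) ^ n * (1 + \<bar>snd z\<bar>) ^ n)"
  proof (intro AE_I2)
    fix z :: "real \<times> real"
    have "norm z \<le> \<bar>fst z\<bar> + \<bar>snd z\<bar>"
      using norm_Pair_le[of "fst z" "snd z"] by simp
    have "1 + norm z \<le> (1 + \<bar>fst z\<bar>) * (1 + \<bar>snd z\<bar>)"
    proof -
      have "(1 + a) * (1 + b) = 1 + a + b + a * b" for a b :: real by (simp add: algebra_simps)
      moreover have "\<bar>fst z\<bar> * \<bar>snd z\<bar> \<ge> 0" by simp
      ultimately show ?thesis using \<open>norm z \<le> \<bar>fst z\<bar> + \<bar>snd z\<bar>\<close> by (simp del: abs_mult_self_eq mult_nonneg_nonneg)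
    qed
    then have "(1 + norm z) ^ n \<le> ((1 + \<bar>fst z\<bar>) * (1 + \<bar>snd z\<bar>)) ^ n"
      by (intro power_mono) auto
    then show "norm ((1 + norm z) ^ n) \<le> norm ((1 + \<bar>fst z\<bar>) ^ n * (1 + \<bar>snd z\<bar>) ^ n)"
      by (simp add: power_mult_distrib)
  qed
qed (unfold norm_prod_def, measurable)

definition joint :: "real \<Rightarrow> real \<Rightarrow> real \<Rightarrow> real" where
  "joint \<epsilon> x y = target1 g x * normal_density (prop_mean \<epsilon> x) (prop_sd \<epsilon> x) y"

lemma joint_pos: "\<epsilon> > 0 \<Longrightarrow> joint \<epsilon> x y > 0"
  using target1_pos prop_sd_pos by (simp add: joint_def normal_density_pos)

lemma measurable_joint[measurable]: "(\<lambda>z. joint \<epsilon> (fst z) (snd z)) \<in> borel_measurable (borel \<Otimes>\<^sub>M borel)"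
  unfolding joint_def normal_density_def by measurable

text \<open>
  The substitution \<open>y = proposal \<epsilon> (x, \<xi>)\<close> in the inner integral: a pair with density \<open>joint \<epsilon>\<close> is the
  image of an independent pair of a stationary position and a standard Gaussian.
\<close>
lemma nn_integral_joint:
  assumes e: "\<epsilon> > 0" and f: "f \<in> borel_measurable (borel \<Otimes>\<^sub>M borel)"
  shows "(\<integral>\<^sup>+z. ennreal (joint \<epsilon> (fst z) (snd z)) * f z \<partial>(lborel \<Otimes>\<^sub>M lborel))
    = (\<integral>\<^sup>+z. f (fst z, proposal \<epsilon> z) \<partial>\<nu>)"
proof -
  note f[measurable]
  have inner: "(\<integral>\<^sup>+y. ennreal (joint \<epsilon> x y) * f (x, y) \<partial>lborel)
    = (\<integral>\<^sup>+\<xi>. ennreal (target1 g x) * ennreal (std_normal_density \<xi>) * f (x, proposal \<epsilon> (x, \<xi>)) \<partial>lborel)" for x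
  proof -
    have s: "prop_sd \<epsilon> x > 0" by (rule prop_sd_pos[OF e])
    have "(\<integral>\<^sup>+y. ennreal (joint \<epsilon> x y) * f (x, y) \<partial>lborel)
      = ennreal (prop_sd \<epsilon> x) * (\<integral>\<^sup>+\<xi>. ennreal (joint \<epsilon> x (prop_mean \<epsilon> x + prop_sd \<epsilon> x * \<xi>)) * f (x, prop_mean \<epsilon> x + prop_sd \<epsilon> x * \<xi>) \<partial>lborel)"
      using s unfolding joint_def normal_density_def
      by (subst nn_integral_real_affine[of _ "prop_sd \<epsilon> x" "prop_mean \<epsilon> x"]) auto
    also have "\<dots> = (\<integral>\<^sup>+\<xi>. ennreal (prop_sd \<epsilon> x) * (ennreal (joint \<epsilon> x (prop_mean \<epsilon> x + prop_sd \<epsilon> x * \<xi>)) * f (x, prop_mean \<epsilon> x + prop_sd \<epsilon> x * \<xi>)) \<partial>lborel)"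
      unfolding joint_def normal_density_def by (rule nn_integral_cmult[symmetric]) measurable
    also have "\<dots> = (\<integral>\<^sup>+\<xi>. ennreal (target1 g x) * ennreal (std_normal_density \<xi>) * f (x, proposal \<epsilon> (x, \<xi>)) \<partial>lborel)"
    proof (rule nn_integral_cong)
      fix \<xi>
      have "prop_sd \<epsilon> x * joint \<epsilon> x (prop_mean \<epsilon> x + prop_sd \<epsilon> x * \<xi>) = target1 g x * std_normal_density \<xi>"
        using s by (simp add: joint_def normal_density_def real_sqrt_mult power_mult_distrib field_simps)
      then have "ennreal (prop_sd \<epsilon> x) * ennreal (joint \<epsilon> x (prop_mean \<epsilon> x + prop_sd \<epsilon> x * \<xi>)) = ennreal (target1 g x) * ennreal (std_normal_density \<xi>)"
        using s joint_pos[OF e] target1_pos[of x] by (simp add: ennreal_mult[symmetric] less_imp_le)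
      then show "ennreal (prop_sd \<epsilon> x) * (ennreal (joint \<epsilon> x (prop_mean \<epsilon> x + prop_sd \<epsilon> x * \<xi>)) * f (x, prop_mean \<epsilon> x + prop_sd \<epsilon> x * \<xi>))
        = ennreal (target1 g x) * ennreal (std_normal_density \<xi>) * f (x, proposal \<epsilon> (x, \<xi>))"
        by (simp add: proposal_eq mult.assoc[symmetric])
    qed
    finally show ?thesis .
  qed
  have "(\<integral>\<^sup>+z. ennreal (joint \<epsilon> (fst z) (snd z)) * f z \<partial>(lborel \<Otimes>\<^sub>M lborel))
    = (\<integral>\<^sup>+x. \<integral>\<^sup>+y. ennreal (joint \<epsilon> x y) * f (x, y) \<partial>lborel \<partial>lborel)"
    by (subst lborel.nn_integral_fst[symmetric]) auto
  also have "\<dots> = (\<integral>\<^sup>+x. \<integral>\<^sup>+\<xi>. ennreal (target1 g x) * ennreal (std_normal_density \<xi>) * f (x, proposal \<epsilon> (x, \<xi>)) \<partial>lborel \<partial>lborel)"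
    by (simp only: inner)
  also have "\<dots> = (\<integral>\<^sup>+z. (case z of (x, \<xi>) \<Rightarrow> ennreal (target1 g x) * ennreal (std_normal_density \<xi>)) * f (fst z, proposal \<epsilon> z) \<partial>(lborel \<Otimes>\<^sub>M lborel))"
    by (subst lborel.nn_integral_fst[symmetric]) (auto simp: split_beta')
  also have "\<dots> = (\<integral>\<^sup>+z. f (fst z, proposal \<epsilon> z) \<partial>density (lborel \<Otimes>\<^sub>M lborel) (\<lambda>(x, \<xi>). ennreal (target1 g x) * ennreal (std_normal_density \<xi>)))"
    by (subst nn_integral_density) auto
  also have "density (lborel \<Otimes>\<^sub>M lborel) (\<lambda>(x, \<xi>). ennreal (target1 g x) * ennreal (std_normal_density \<xi>)) = \<nu>"
    by (rule pair_measure_density[symmetric])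
      (auto intro: std.sigma_finite_measure_axioms lborel.sigma_finite_measure_axioms)
  finally show ?thesis .
qed

lemma mh_pair_joint: "\<epsilon> > 0 \<Longrightarrow> mh_pair lborel (joint \<epsilon>)"
proof -
  assume e: "\<epsilon> > 0"
  show ?thesis
  proof
    show "case_prod (joint \<epsilon>) \<in> borel_measurable (lborel \<Otimes>\<^sub>M lborel)"
      using measurable_joint[of \<epsilon>] by (simp add: split_beta')
    show "joint \<epsilon> x y > 0" for x y by (rule joint_pos[OF e])
    have "(\<integral>\<^sup>+z. ennreal (joint \<epsilon> (fst z) (snd z)) \<partial>(lborel \<Otimes>\<^sub>M lborel)) = 1"
      using nn_integral_joint[OF e, of "\<lambda>_. 1"] \<nu>.P.emeasure_space_1 by simp
    then show "has_bochner_integral (lborel \<Otimes>\<^sub>M lborel) (case_prod (joint \<epsilon>)) 1"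
      using measurable_joint[of \<epsilon>] joint_pos[OF e]
      by (intro has_bochner_integral_nn_integral) (auto simp: split_beta' less_imp_le)
  qed
qed

lemma law_joint:
  assumes e: "\<epsilon> > 0"
  shows "mh_pair.law lborel (joint \<epsilon>) = distr \<nu> (lborel \<Otimes>\<^sub>M lborel) (\<lambda>z. (fst z, proposal \<epsilon> z))"
proof -
  interpret mh_pair lborel "joint \<epsilon>" by (rule mh_pair_joint[OF e])
  have [measurable]: "(\<lambda>z. (fst z, proposal \<epsilon> z)) \<in> measurable \<nu> (lborel \<Otimes>\<^sub>M lborel)" by measurable
  show ?thesis
  proof (rule measure_eqI)
    fix A assume "A \<in> sets law"
    then have A: "A \<in> sets (lborel \<Otimes>\<^sub>M lborel)" by (simp add: sets_law)
    then have A'[measurable]: "A \<in> sets (borel \<Otimes>\<^sub>M borel)" by simp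
    have "emeasure law A = (\<integral>\<^sup>+z. ennreal (joint \<epsilon> (fst z) (snd z)) * indicator A z \<partial>(lborel \<Otimes>\<^sub>M lborel))"
      using A unfolding law_def by (subst emeasure_density) (auto simp: split_beta')
    also have "\<dots> = (\<integral>\<^sup>+z. indicator A (fst z, proposal \<epsilon> z) \<partial>\<nu>)"
      by (rule nn_integral_joint[OF e]) measurable
    also have "\<dots> = (\<integral>\<^sup>+z. indicator A z \<partial>distr \<nu> (lborel \<Otimes>\<^sub>M lborel) (\<lambda>z. (fst z, proposal \<epsilon> z)))"
      using A by (subst nn_integral_distr) auto
    also have "\<dots> = emeasure (distr \<nu> (lborel \<Otimes>\<^sub>M lborel) (\<lambda>z. (fst z, proposal \<epsilon> z))) A"
      using A by simp
    finally show "emeasure law A = emeasure (distr \<nu> (lborel \<Otimes>\<^sub>M lborel) (\<lambda>z. (fst z, proposal \<epsilon> z))) A" .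
  qed (simp add: sets_law)
qed

lemma logratio_joint:
  assumes e: "\<epsilon> > 0"
  shows "mh_pair.logratio (joint \<epsilon>) (x, y) = log_ratio \<epsilon> x y"
proof -
  interpret mh_pair lborel "joint \<epsilon>" by (rule mh_pair_joint[OF e])
  have ln_joint: "ln (joint \<epsilon> x y) = g x - ln Z - ln (2 * pi * \<epsilon>\<^sup>2) / 2 - log_sd \<epsilon> x - (y - x - \<epsilon>\<^sup>2 * drift \<epsilon> x)\<^sup>2 * prec \<epsilon> x / (2 * \<epsilon>\<^sup>2)" for x y
  proof -
    have p: "P (curv \<epsilon> x) > 0" by (rule profile_pos)
    have s: "(prop_sd \<epsilon> x)\<^sup>2 = \<epsilon>\<^sup>2 * P (curv \<epsilon> x)" using p by (simp add: prop_sd_def power_mult_distrib)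
    have "ln (sqrt (2 * pi * (prop_sd \<epsilon> x)\<^sup>2)) = ln (2 * pi * \<epsilon>\<^sup>2) / 2 + log_sd \<epsilon> x"
    proof -
      have "2 * pi * (prop_sd \<epsilon> x)\<^sup>2 = (2 * pi * \<epsilon>\<^sup>2) * P (curv \<epsilon> x)" by (simp add: s)
      moreover have "ln ((2 * pi * \<epsilon>\<^sup>2) * P (curv \<epsilon> x)) = ln (2 * pi * \<epsilon>\<^sup>2) + ln (P (curv \<epsilon> x))"
        using e p by (intro ln_mult_pos) auto
      ultimately have "ln (2 * pi * (prop_sd \<epsilon> x)\<^sup>2) = ln (2 * pi * \<epsilon>\<^sup>2) + ln (P (curv \<epsilon> x))"
        by (simp only:)
      moreover have "2 * pi * (prop_sd \<epsilon> x)\<^sup>2 > 0" using prop_sd_pos[OF e, of x] by simp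
      ultimately show ?thesis by (simp only: ln_sqrt log_sd_def add_divide_distrib)
    qed
    moreover have "ln (joint \<epsilon> x y) = ln (target1 g x) + (- ln (sqrt (2 * pi * (prop_sd \<epsilon> x)\<^sup>2)) + - (y - prop_mean \<epsilon> x)\<^sup>2 / (2 * (prop_sd \<epsilon> x)\<^sup>2))"
      using target1_pos[of x] prop_sd_pos[OF e, of x] by (simp add: joint_def normal_density_def ln_mult_pos ln_div)
    moreover have "ln (target1 g x) = g x - ln Z" using Z_pos by (simp add: target1_eq ln_div)
    moreover have "(y - prop_mean \<epsilon> x)\<^sup>2 / (2 * (prop_sd \<epsilon> x)\<^sup>2) = (y - x - \<epsilon>\<^sup>2 * drift \<epsilon> x)\<^sup>2 * prec \<epsilon> x / (2 * \<epsilon>\<^sup>2)"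
      unfolding s using e p by (simp add: prec_def prop_mean_def algebra_simps)
    ultimately show ?thesis by simp
  qed
  have "logratio (x, y) = ln (joint \<epsilon> y x) - ln (joint \<epsilon> x y)"
    unfolding logratio_def using joint_pos[OF e, of x y] joint_pos[OF e, of y x] by (simp add: ln_div)
  also have "\<dots> = log_ratio \<epsilon> x y"
    unfolding ln_joint log_ratio_def drift_prec_def drift2_prec_def using e
    by (simp add: field_simps power2_eq_square)
  finally show ?thesis .
qed


lemma measurable_c_poly[measurable]: "(\<lambda>z. c_poly (fst z) (snd z)) \<in> borel_measurable (borel \<Otimes>\<^sub>M borel)"
  unfolding c_poly_def by measurable

lemma measurable_log_ratio[measurable]:
  "(\<lambda>z. log_ratio \<epsilon> (fst z) (snd z)) \<in> borel_measurable (borel \<Otimes>\<^sub>M borel)"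
  unfolding log_ratio_def log_sd_def prec_def drift_prec_def drift2_prec_def by measurable

text \<open>
  Dividing by the leading order \<open>\<epsilon>\<^sup>5\<close> leaves a function that converges to \<open>c\<close>.
\<close>
definition scaled_ratio :: "real \<Rightarrow> real \<times> real \<Rightarrow> real" where
  "scaled_ratio \<epsilon> z = log_ratio \<epsilon> (fst z) (proposal \<epsilon> z) / \<epsilon> ^ 5"

lemma measurable_scaled_ratio[measurable]: "scaled_ratio \<epsilon> \<in> borel_measurable (borel \<Otimes>\<^sub>M borel)"
  unfolding scaled_ratio_def[abs_def] log_ratio_def log_sd_def prec_def drift_prec_def drift2_prec_def by measurable

lemma scaled_ratio_bounds:
  obtains C N \<epsilon>0 where "\<epsilon>0 > 0"
    "\<And>\<epsilon> z. 0 < \<epsilon> \<Longrightarrow> \<epsilon> \<le> \<epsilon>0 \<Longrightarrow> \<bar>scaled_ratio \<epsilon> z - c_poly (fst z) (snd z)\<bar> \<le> \<epsilon> * (C * (1 + norm z) ^ N)"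
    "\<And>\<epsilon> z. 0 < \<epsilon> \<Longrightarrow> \<epsilon> \<le> \<epsilon>0 \<Longrightarrow> \<bar>scaled_ratio \<epsilon> z\<bar> \<le> C * (1 + norm z) ^ N"
proof -
  have "unif_O (1 + 5) (\<lambda>\<epsilon> z. log_ratio \<epsilon> (fst z) (proposal \<epsilon> z) - \<epsilon> ^ 5 * c_poly (fst z) (snd z))"
    using log_ratio_expansion by (simp add: unif_cong_def)
  from unif_O_divide_eps[OF this]
  have "unif_O 1 (\<lambda>\<epsilon> z. scaled_ratio \<epsilon> z - c_poly (fst z) (snd z))"
    by (rule unif_O_cong[of _ _ 1]) (simp_all add: scaled_ratio_def diff_divide_distrib)
  note 1 = this
  have "unif_O 0 (\<lambda>\<epsilon> z. (scaled_ratio \<epsilon> z - c_poly (fst z) (snd z)) + c_poly (fst z) (snd z))"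
    by (rule unif_O_add[OF unif_O_le[OF 1] c_poly_O]) simp
  then have 2: "unif_O 0 scaled_ratio" by simp
  obtain C N \<epsilon>0 where a: "C \<ge> 0" "\<epsilon>0 > 0"
    "\<And>\<epsilon> z. 0 < \<epsilon> \<Longrightarrow> \<epsilon> \<le> \<epsilon>0 \<Longrightarrow> \<bar>scaled_ratio \<epsilon> z - c_poly (fst z) (snd z)\<bar> \<le> C * \<epsilon> ^ 1 * (1 + norm z) ^ N"
    using 1 by (rule unif_OE) blast
  obtain C' N' \<epsilon>0' where b: "C' \<ge> 0" "\<epsilon>0' > 0"
    "\<And>\<epsilon> z. 0 < \<epsilon> \<Longrightarrow> \<epsilon> \<le> \<epsilon>0' \<Longrightarrow> \<bar>scaled_ratio \<epsilon> z\<bar> \<le> C' * \<epsilon> ^ 0 * (1 + norm z) ^ N'"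
    using 2 by (rule unif_OE) blast
  have mono: "c * (1 + norm z) ^ n \<le> max C C' * (1 + norm z) ^ max N N'"
    if "0 \<le> c" "c \<le> max C C'" "n \<le> max N N'" for c n and z :: "real \<times> real"
    using that by (intro mult_mono power_increasing) auto
  show thesis
  proof (rule that[of "min \<epsilon>0 \<epsilon>0'" "max C C'" "max N N'"])
    fix \<epsilon> z assume e: "0 < \<epsilon>" "\<epsilon> \<le> min \<epsilon>0 \<epsilon>0'"
    have "\<bar>scaled_ratio \<epsilon> z - c_poly (fst z) (snd z)\<bar> \<le> \<epsilon> * (C * (1 + norm z) ^ N)"
      using a(3)[of \<epsilon> z] e by (simp add: mult_ac)
    also have "\<dots> \<le> \<epsilon> * (max C C' * (1 + norm z) ^ max N N')"
      using e a(1) by (intro mult_left_mono mono) auto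
    finally show "\<bar>scaled_ratio \<epsilon> z - c_poly (fst z) (snd z)\<bar> \<le> \<epsilon> * (max C C' * (1 + norm z) ^ max N N')" .
    have "\<bar>scaled_ratio \<epsilon> z\<bar> \<le> C' * (1 + norm z) ^ N'"
      using b(3)[of \<epsilon> z] e by simp
    also have "\<dots> \<le> max C C' * (1 + norm z) ^ max N N'"
      using b(1) by (intro mono) auto
    finally show "\<bar>scaled_ratio \<epsilon> z\<bar> \<le> max C C' * (1 + norm z) ^ max N N'" .
  qed (use a b in auto)
qed

text \<open>
  Dominated convergence: the polynomial that dominates \<open>scaled_ratio\<close> does not depend on \<open>\<epsilon>\<close>, and
  all its powers are integrable.
\<close>
lemma scaled_ratio_moments:
  assumes e: "\<And>n. e n > 0" "e \<longlonglongrightarrow> 0"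
  shows "(\<lambda>n. LINT z|\<nu>. \<bar>scaled_ratio (e n) z\<bar> ^ k) \<longlonglongrightarrow> (LINT z|\<nu>. \<bar>c_poly (fst z) (snd z)\<bar> ^ k)"
    and "\<forall>\<^sub>F n in sequentially. integrable \<nu> (\<lambda>z. \<bar>scaled_ratio (e n) z\<bar> ^ k)"
proof -
  obtain C N \<epsilon>0 where \<epsilon>0: "\<epsilon>0 > 0"
    and close: "\<And>\<epsilon> z. 0 < \<epsilon> \<Longrightarrow> \<epsilon> \<le> \<epsilon>0 \<Longrightarrow> \<bar>scaled_ratio \<epsilon> z - c_poly (fst z) (snd z)\<bar> \<le> \<epsilon> * (C * (1 + norm z) ^ N)"
    and bnd: "\<And>\<epsilon> z. 0 < \<epsilon> \<Longrightarrow> \<epsilon> \<le> \<epsilon>0 \<Longrightarrow> \<bar>scaled_ratio \<epsilon> z\<bar> \<le> C * (1 + norm z) ^ N"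
    by (rule scaled_ratio_bounds) blast
  have "\<forall>\<^sub>F n in sequentially. e n < \<epsilon>0" using e(2) \<epsilon>0 by (rule order_tendstoD)
  then have ev: "\<forall>\<^sub>F n in sequentially. e n \<le> \<epsilon>0" by eventually_elim simp
  then obtain n0 where n0: "\<And>n. n \<ge> n0 \<Longrightarrow> e n \<le> \<epsilon>0" by (auto simp: eventually_sequentially)
  have W: "integrable \<nu> (\<lambda>z. (C * (1 + norm z) ^ N) ^ k)"
    using integrable_\<nu>_power[of "N * k"] by (simp add: power_mult_distrib power_mult)
  have bk: "norm (\<bar>scaled_ratio (e n) z\<bar> ^ k) \<le> (C * (1 + norm z) ^ N) ^ k" if "e n \<le> \<epsilon>0" for n z
    using bnd[OF e(1) that, of z] by (simp add: power_mono)
  show "\<forall>\<^sub>F n in sequentially. integrable \<nu> (\<lambda>z. \<bar>scaled_ratio (e n) z\<bar> ^ k)"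
    using ev
  proof eventually_elim
    case (elim n)
    show ?case
      by (rule Bochner_Integration.integrable_bound[OF W]) (use bk[OF elim] in \<open>auto intro!: AE_I2 order_trans[OF _ abs_ge_self]\<close>)
  qed
  have lim: "(\<lambda>n. scaled_ratio (e n) z) \<longlonglongrightarrow> c_poly (fst z) (snd z)" for z
  proof -
    have "(\<lambda>n. scaled_ratio (e n) z - c_poly (fst z) (snd z)) \<longlonglongrightarrow> 0"
    proof (rule Lim_null_comparison)
      show "\<forall>\<^sub>F n in sequentially. norm (scaled_ratio (e n) z - c_poly (fst z) (snd z)) \<le> e n * (C * (1 + norm z) ^ N)"
        using ev by eventually_elim (use close[OF e(1)] in auto)
      show "(\<lambda>n. e n * (C * (1 + norm z) ^ N)) \<longlonglongrightarrow> 0"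
        by (rule tendsto_mult_left_zero[OF e(2)])
    qed
    then show ?thesis by (simp add: LIM_zero_iff)
  qed
  have "(\<lambda>n. LINT z|\<nu>. \<bar>scaled_ratio (e (n + n0)) z\<bar> ^ k) \<longlonglongrightarrow> (LINT z|\<nu>. \<bar>c_poly (fst z) (snd z)\<bar> ^ k)"
  proof (rule integral_dominated_convergence[where w = "\<lambda>z. (C * (1 + norm z) ^ N) ^ k"])
    show "AE z in \<nu>. (\<lambda>n. \<bar>scaled_ratio (e (n + n0)) z\<bar> ^ k) \<longlonglongrightarrow> \<bar>c_poly (fst z) (snd z)\<bar> ^ k"
      by (intro AE_I2 tendsto_power tendsto_rabs LIMSEQ_ignore_initial_segment lim)
    show "AE z in \<nu>. norm (\<bar>scaled_ratio (e (n + n0)) z\<bar> ^ k) \<le> (C * (1 + norm z) ^ N) ^ k" for n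
      by (intro AE_I2 bk n0) simp
  qed (use W in \<open>measurable\<close>)
  then show "(\<lambda>n. LINT z|\<nu>. \<bar>scaled_ratio (e n) z\<bar> ^ k) \<longlonglongrightarrow> (LINT z|\<nu>. \<bar>c_poly (fst z) (snd z)\<bar> ^ k)"
    by (rule LIMSEQ_offset)
qed

lemma
  assumes e: "\<epsilon> > 0" and f[measurable]: "f \<in> borel_measurable borel"
  shows integral_law_joint: "(LINT z|mh_pair.law lborel (joint \<epsilon>). f (mh_pair.logratio (joint \<epsilon>) z) :: real)
      = (LINT z|\<nu>. f (\<epsilon> ^ 5 * scaled_ratio \<epsilon> z))"
    and integrable_law_joint: "integrable (mh_pair.law lborel (joint \<epsilon>)) (\<lambda>z. f (mh_pair.logratio (joint \<epsilon>) z) :: real)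
      \<longleftrightarrow> integrable \<nu> (\<lambda>z. f (\<epsilon> ^ 5 * scaled_ratio \<epsilon> z))"
proof -
  have eq: "(\<lambda>z. f (mh_pair.logratio (joint \<epsilon>) z)) = (\<lambda>z. f (log_ratio \<epsilon> (fst z) (snd z)))"
    using logratio_joint[OF e] by (metis prod.collapse)
  have n: "log_ratio \<epsilon> (fst z) (proposal \<epsilon> z) = \<epsilon> ^ 5 * scaled_ratio \<epsilon> z" for z
    using e by (simp add: scaled_ratio_def)
  have [measurable]: "(\<lambda>z. (fst z, proposal \<epsilon> z)) \<in> measurable \<nu> (lborel \<Otimes>\<^sub>M lborel)" by measurable
  show "(LINT z|mh_pair.law lborel (joint \<epsilon>). f (mh_pair.logratio (joint \<epsilon>) z) :: real)
      = (LINT z|\<nu>. f (\<epsilon> ^ 5 * scaled_ratio \<epsilon> z))"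
    unfolding law_joint[OF e] eq by (subst integral_distr) (auto simp: n)
  show "integrable (mh_pair.law lborel (joint \<epsilon>)) (\<lambda>z. f (mh_pair.logratio (joint \<epsilon>) z) :: real)
      \<longleftrightarrow> integrable \<nu> (\<lambda>z. f (\<epsilon> ^ 5 * scaled_ratio \<epsilon> z))"
    unfolding law_joint[OF e] eq by (subst integrable_distr_eq) (auto simp: n)
qed

lemma K_eq: "(gbO_K g a1 a3 a4)\<^sup>2 = (LINT z|\<nu>. \<bar>c_poly (fst z) (snd z)\<bar> ^ 2)"
  by (simp add: gbO_K_def gbO_c_eq)

lemma target_prod: "target g n x = (\<Prod>i<n. target1 g (x i))"
proof -
  interpret product_sigma_finite "\<lambda>_::nat. lborel :: real measure" ..
  have "(LINT x|Rd n. (\<Prod>i<n. exp (g (x i)))) = (\<Prod>i<n. Z)"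
    unfolding Rd_def Z_def using integrable_exp_g by (intro product_integral_prod) auto
  then show ?thesis by (simp add: target_def norm_const_def target1_eq prod_dividef)
qed

lemma gbO_acceptance_eq:
  assumes e: "\<epsilon> > 0" and h: "l\<^sup>2 * real n powr (- 1 / 5) = \<epsilon>\<^sup>2"
  shows "gbO_acceptance g a1 a2 a3 a4 a5 l n =
    (LINT y|Pi\<^sub>M {..<n} (\<lambda>_. lborel). LINT x|Pi\<^sub>M {..<n} (\<lambda>_. lborel).
       min (\<Prod>i<n. joint \<epsilon> (x i) (y i)) (\<Prod>i<n. joint \<epsilon> (y i) (x i)))"
proof -
  have pq: "target g n x * gbO_density g a1 a2 a3 a4 a5 (\<epsilon>\<^sup>2) n x y = (\<Prod>i<n. joint \<epsilon> (x i) (y i))" for x y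
    by (simp add: target_prod gbO_density_def gbO_mean_eq[OF e] gbO_sd_eq[OF e] joint_def prod.distrib)
  have pos: "(\<Prod>i<n. joint \<epsilon> (x i) (y i)) > 0" for x y
    by (intro prod_pos joint_pos[OF e] ballI)
  have min: "p * min 1 (r / p) = min p r" if "p > 0" for p r :: real
    using that by (simp add: min_mult_distrib_left)
  show ?thesis
    unfolding gbO_acceptance_def h Let_def mean_acceptance_rate_def MH_acceptance_def pq
    by (simp add: min pos Rd_def)
qed

text \<open>
  With \<open>\<epsilon> = l d\<^sup>-\<^sup>1\<^sup>/\<^sup>1\<^sup>0\<close> one has \<open>\<epsilon>\<^sup>2 = h\<close> and \<open>d \<epsilon>\<^sup>1\<^sup>0 = l\<^sup>1\<^sup>0\<close>, so the second moments converge to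
  \<open>K\<^sup>2 l\<^sup>1\<^sup>0\<close> and the third ones are \<open>O(d\<^sup>-\<^sup>1\<^sup>/\<^sup>2)\<close> after multiplication by \<open>d\<close>.
\<close>
theorem acceptance_limit:
  assumes l: "l > 0"
  shows "(\<lambda>d. gbO_acceptance g a1 a2 a3 a4 a5 l d) \<longlonglongrightarrow> 2 * Phi (- gbO_K g a1 a3 a4 * l ^ 5 / 2)"
proof -
    \<comment> \<open>At \<open>n = 0\<close> the power would vanish, and \<open>\<epsilon> > 0\<close> is needed for every member of the sequence.\<close>
  define e where "e n = l * real (max 1 n) powr (- 1 / 10)" for n :: nat
  have e_pos: "e n > 0" for n using l by (simp add: e_def)
  have e_lim: "e \<longlonglongrightarrow> 0"
  proof -
    have "(\<lambda>n. l * real n powr (- 1 / 10)) \<longlonglongrightarrow> l * 0"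
      by (intro tendsto_mult tendsto_const tendsto_neg_powr filterlim_real_sequentially) simp
    then have "(\<lambda>n. l * real n powr (- 1 / 10)) \<longlonglongrightarrow> 0" by simp
    then show ?thesis
      by (rule Lim_transform_eventually) (auto simp: e_def max_def intro!: eventually_sequentiallyI[of 1])
  qed
  have e2: "l\<^sup>2 * real n powr (- 1 / 5) = (e n)\<^sup>2" if "n \<ge> 1" for n
    using that by (simp add: e_def power_mult_distrib powr_power)
  have e10: "real n * e n ^ 10 = l ^ 10" if "n \<ge> 1" for n
    using that by (simp add: e_def powr_minus_divide power_divide powr_power)
  define \<sigma> where "\<sigma> = gbO_K g a1 a3 a4 * l ^ 5"
  have \<sigma>: "\<sigma> \<ge> 0" using l by (simp add: \<sigma>_def gbO_K_def)
  have "(\<lambda>n. LINT y|Pi\<^sub>M {..<n} (\<lambda>_. lborel). LINT x|Pi\<^sub>M {..<n} (\<lambda>_. lborel).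
       min (\<Prod>i<n. joint (e n) (x i) (y i)) (\<Prod>i<n. joint (e n) (y i) (x i))) \<longlonglongrightarrow> 2 * Phi (- \<sigma> / 2)"
  proof (rule product_acceptance_limit[OF mh_pair_joint[OF e_pos] \<sigma>])
    show "\<forall>\<^sub>F n in sequentially. integrable (mh_pair.law lborel (joint (e n))) (\<lambda>z. \<bar>mh_pair.logratio (joint (e n)) z\<bar> ^ 3)"
      using scaled_ratio_moments(2)[OF e_pos e_lim, of 3]
    proof eventually_elim
      case (elim n)
      have "integrable \<nu> (\<lambda>z. \<bar>e n ^ 5\<bar> ^ 3 * \<bar>scaled_ratio (e n) z\<bar> ^ 3)" using elim by simp
      then show ?case
        by (subst integrable_law_joint[OF e_pos, of "\<lambda>r. \<bar>r\<bar> ^ 3"]) (simp_all add: abs_mult power_mult_distrib)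
    qed
    show "(\<lambda>n. real n * (LINT z|mh_pair.law lborel (joint (e n)). (mh_pair.logratio (joint (e n)) z)\<^sup>2)) \<longlonglongrightarrow> \<sigma>\<^sup>2"
    proof (rule Lim_transform_eventually)
      show "(\<lambda>n. l ^ 10 * (LINT z|\<nu>. \<bar>scaled_ratio (e n) z\<bar> ^ 2)) \<longlonglongrightarrow> \<sigma>\<^sup>2"
        using tendsto_mult[OF tendsto_const scaled_ratio_moments(1)[OF e_pos e_lim, of 2], of "l ^ 10"]
        by (simp only: \<sigma>_def power_mult_distrib K_eq) (simp add: mult_ac)
      show "\<forall>\<^sub>F n in sequentially. l ^ 10 * (LINT z|\<nu>. \<bar>scaled_ratio (e n) z\<bar> ^ 2)
        = real n * (LINT z|mh_pair.law lborel (joint (e n)). (mh_pair.logratio (joint (e n)) z)\<^sup>2)"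
      proof (rule eventually_sequentiallyI[of 1])
        fix n :: nat assume n: "n \<ge> 1"
        have "(LINT z|mh_pair.law lborel (joint (e n)). (mh_pair.logratio (joint (e n)) z)\<^sup>2)
          = e n ^ 10 * (LINT z|\<nu>. \<bar>scaled_ratio (e n) z\<bar> ^ 2)"
          by (subst integral_law_joint[OF e_pos, of "\<lambda>r. r\<^sup>2"]) (simp_all add: power_mult_distrib flip: power_mult)
        then show "l ^ 10 * (LINT z|\<nu>. \<bar>scaled_ratio (e n) z\<bar> ^ 2)
          = real n * (LINT z|mh_pair.law lborel (joint (e n)). (mh_pair.logratio (joint (e n)) z)\<^sup>2)"
          using e10[OF n] by (simp only: mult.assoc[symmetric])
      qed
    qed
    show "(\<lambda>n. real n * (LINT z|mh_pair.law lborel (joint (e n)). \<bar>mh_pair.logratio (joint (e n)) z\<bar> ^ 3)) \<longlonglongrightarrow> 0"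
    proof (rule Lim_transform_eventually)
      have "(\<lambda>n. l ^ 10 * e n ^ 5 * (LINT z|\<nu>. \<bar>scaled_ratio (e n) z\<bar> ^ 3)) \<longlonglongrightarrow> l ^ 10 * 0 ^ 5 * (LINT z|\<nu>. \<bar>c_poly (fst z) (snd z)\<bar> ^ 3)"
        by (intro tendsto_mult tendsto_const tendsto_power e_lim scaled_ratio_moments(1) e_pos)
      then show "(\<lambda>n. l ^ 10 * e n ^ 5 * (LINT z|\<nu>. \<bar>scaled_ratio (e n) z\<bar> ^ 3)) \<longlonglongrightarrow> 0" by simp
      show "\<forall>\<^sub>F n in sequentially. l ^ 10 * e n ^ 5 * (LINT z|\<nu>. \<bar>scaled_ratio (e n) z\<bar> ^ 3)
        = real n * (LINT z|mh_pair.law lborel (joint (e n)). \<bar>mh_pair.logratio (joint (e n)) z\<bar> ^ 3)"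
      proof (rule eventually_sequentiallyI[of 1])
        fix n :: nat assume n: "n \<ge> 1"
        have "(LINT z|mh_pair.law lborel (joint (e n)). \<bar>mh_pair.logratio (joint (e n)) z\<bar> ^ 3)
          = e n ^ 10 * (e n ^ 5 * (LINT z|\<nu>. \<bar>scaled_ratio (e n) z\<bar> ^ 3))"
          using e_pos[of n]
          by (subst integral_law_joint[OF e_pos, of "\<lambda>r. \<bar>r\<bar> ^ 3"])
            (simp_all add: abs_mult power_mult_distrib flip: power_mult power_add mult.assoc)
        then show "l ^ 10 * e n ^ 5 * (LINT z|\<nu>. \<bar>scaled_ratio (e n) z\<bar> ^ 3)
          = real n * (LINT z|mh_pair.law lborel (joint (e n)). \<bar>mh_pair.logratio (joint (e n)) z\<bar> ^ 3)"
          using e10[OF n] by (simp only: mult.assoc[symmetric])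
      qed
    qed
  qed
  then have "(\<lambda>d. gbO_acceptance g a1 a2 a3 a4 a5 l d) \<longlonglongrightarrow> 2 * Phi (- \<sigma> / 2)"
    by (rule Lim_transform_eventually)
      (use gbO_acceptance_eq[OF e_pos e2] in \<open>auto intro!: eventually_sequentiallyI[of 1]\<close>)
  then show ?thesis by (simp add: \<sigma>_def)
qed

end

theorem theorem3p4:
  fixes g :: "real \<Rightarrow> real" and a1 a2 a3 a4 a5 l :: real
  assumes a_pos: "a1 > 0" "a2 > 0" "a3 > 0" "a4 > 0" "a5 > 0"
    and profile_pos: "\<And>t. gbO_positivity_fun a4 a5 t > 0"
    and g_C10: "C_k 10 g"
    and g2_bounded: "bounded (range ((deriv ^^ 2) g))"
    and g_growth: "\<exists>C \<kappa> :: real. \<forall>i\<in>{1..10}. \<forall>t. \<bar>(deriv ^^ i) g t\<bar> \<le> C * (1 + \<bar>t\<bar> powr \<kappa>)"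
    and g_moments: "\<And>k :: nat. integrable lborel (\<lambda>t. t ^ k * exp (g t))"
    and l_pos: "l > 0"
  shows "(\<lambda>d. gbO_acceptance g a1 a2 a3 a4 a5 l d)
           \<longlonglongrightarrow> 2 * Phi (- gbO_K g a1 a3 a4 * l ^ 5 / 2)"
proof -
  interpret gbO_chain a1 a2 a3 a4 a5 g
    by standard (rule a_pos profile_pos g_C10 g2_bounded g_growth g_moments)+
  show ?thesis by (rule acceptance_limit[OF l_pos])
qed

end
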